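(* Consider the singular perturbation problem $\mathbf{x}'=\mathbf{f}(\mathbf{x},\mathbf{z})$, $\mathbf{z}'=\varepsilon^{-1}\mathbf{g}(\mathbf{x},\mathbf{z})$ (see context), with an initial solution given by an $\varepsilon$-expansion whose coefficients are consistent as described in the context. Consider an IMEX general linear method of order $p$ from the class of interest (see context), and assume in addition that $$\rho(\mathbf{M}^I(z))\le\alpha<1\qquad\text{for all } z\in\mathbb{C}\text{ with } \mathrm{Re}\,z\le-D.$$ Apply the method with fixed step $h$, where $h\le h_0$ and $nh\le\mathrm{Const}$. Then the numerical solutions for both the $\mathbf{x}$ and the $\mathbf{z}$ variables converge at the theoretical order $p$: $$\xi^{[n]}-(\mathbf{W}^E\otimes\mathbf{I}_m)\eta_p(h,\mathbf{x},t_n)=\mathcal{O}(h^p),\qquad \zeta^{[n]}-(\mathbf{W}^I\otimes\mathbf{I}_m)\eta_p(h,\mathbf{z},t_n)=\mathcal{O}(h^p),$$ for any $\varepsilon\le c\,h$, $c\le D$. This means that no order reduction is incurred for problems ranging from very stiff ($c\ll1$) to non-stiff ($c\sim\mathcal{O}(1)$).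
   Context: **Problem.** $\mathbf{x}(t),\mathbf{z}(t)\in\mathbb{R}^m$, $0<\varepsilon\ll1$, $\mathbf{f},\mathbf{g}$ smooth; $\mathbf{g}_{\mathbf{z}}$ is invertible with logarithmic norm $\mu(\mathbf{g}_{\mathbf{z}})=\sup_{\mathbf{y}\ne0}\mathrm{Re}\langle\mathbf{g}_{\mathbf{z}}\mathbf{y},\mathbf{y}\rangle/\langle\mathbf{y},\mathbf{y}\rangle\le-1$ in an $\varepsilon$-independent neighborhood of the solution. The initial conditions lie on the smooth solution: $\mathbf{x}(t)=\sum_{k\ge0}\mathbf{x}^k(t)\varepsilon^k$, $\mathbf{z}(t)=\sum_{k\ge0}\mathbf{z}^k(t)\varepsilon^k$ with smooth $\varepsilon$-independent coefficients. The coefficients satisfy the equations obtained by equating powers of $\varepsilon$ in $\mathbf{x}'=\mathbf{f}$, $\varepsilon\mathbf{z}'=\mathbf{g}$: $(\mathbf{x}^0)'=\mathbf{f}(\mathbf{x}^0,\mathbf{z}^0)$, $0=\mathbf{g}(\mathbf{x}^0,\mathbf{z}^0)$, and for $\nu\ge1$, $(\mathbf{x}^\nu)'$ and $(\mathbf{z}^{\nu-1})'$ equal the coefficient of $\varepsilon^\nu$ in $\mathbf{f}(\sum_k\mathbf{x}^k\varepsilon^k,\sum_k\mathbf{z}^k\varepsilon^k)$ and $\mathbf{g}(\sum_k\mathbf{x}^k\varepsilon^k,\sum_k\mathbf{z}^k\varepsilon^k)$, respectively (the second determines $\mathbf{z}^\nu$ since $\mathbf{g}_{\mathbf{z}}$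 is invertible). Consistent initial solution means that the initial coefficients are consistent with respect to these relations. **Method.** Coefficients: abscissae $\mathbf{c}\in\mathbb{R}^s$ common to both components; explicit component $(\mathbf{A}^E,\mathbf{U}^E,\mathbf{B}^E,\mathbf{V}^E)$ with $\mathbf{A}^E$ strictly lower triangular; implicit component $(\mathbf{A}^I,\mathbf{U}^I,\mathbf{B}^I,\mathbf{V}^I)$; sizes $s\times s$, $s\times r$, $r\times s$, $r\times r$. One step (functions applied stage by stage): $$X^{[n]}=h(\mathbf{A}^E\otimes\mathbf{I}_m)\mathbf{f}(X^{[n]},Z^{[n]})+(\mathbf{U}^E\otimes\mathbf{I}_m)\xi^{[n-1]},\quad Z^{[n]}=h(\mathbf{A}^I\otimes\mathbf{I}_m)\varepsilon^{-1}\mathbf{g}(X^{[n]},Z^{[n]})+(\mathbf{U}^I\otimes\mathbf{I}_m)\zeta^{[n-1]},$$ $$\xi^{[n]}=h(\mathbf{B}^E\otimes\mathbf{I}_m)\mathbf{f}(X^{[n]},Z^{[n]})+(\mathbf{V}^E\otimes\mathbf{I}_m)\xi^{[n-1]},\quad \zeta^{[n]}=h(\mathbf{B}^I\otimes\mathbf{I}_m)\varepsilon^{-1}\mathbf{g}(X^{[n]},Z^{[n]})+(\mathbf{V}^I\otimes\mathbf{I}_m)\zeta^{[n-1]}.$$ **Order.** A GLM $(\mathbf{c},\mathbf{A},\mathbf{U},\mathbf{B},\mathbf{V})$ has order $p$ and stage order $q\in\{p-1,p\}$ with $\mathbf{W}=[\mathbf{w}_0\cdots\mathbf{w}_p]\in\mathbb{R}^{r\times(p+1)}$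 if $\mathbf{U}\mathbf{w}_0=\mathbf{1}_s$, $\mathbf{V}\mathbf{w}_0=\mathbf{w}_0$, and (componentwise powers) $$\frac{\mathbf{c}^{\times k}}{k!}-\frac{\mathbf{A}\mathbf{c}^{\times(k-1)}}{(k-1)!}-\mathbf{U}\mathbf{w}_k=0,\ 1\le k\le q;\qquad \sum_{\ell=0}^k\frac{\mathbf{w}_{k-\ell}}{\ell!}-\frac{\mathbf{B}\mathbf{c}^{\times(k-1)}}{(k-1)!}-\mathbf{V}\mathbf{w}_k=0,\ 1\le k\le p.$$ The IMEX method has order $p$ if both components have order $p$ (with matrices $\mathbf{W}^E,\mathbf{W}^I$); $q^E,q^I$ are their stage orders. **Stability matrix and class of interest.** $\mathbf{M}^I(z)=\mathbf{V}^I+z\mathbf{B}^I(\mathbf{I}-z\mathbf{A}^I)^{-1}\mathbf{U}^I$, $\mathbf{M}^I(\infty)=\mathbf{V}^I-\mathbf{B}^I(\mathbf{A}^I)^{-1}\mathbf{U}^I$; $\rho$ is the spectral radius. The class of interest consists of IMEX GLMs with: (1) common abscissae $\mathbf{c}$; (2) $q^E,q^I\in\{p-1,p\}$; (3) $\mathbf{A}^I$ has strictly positive eigenvalues; (4) $\rho(\mathbf{M}^I(\infty))<1$. **Notation.** $t_n=t_0+nh$ and $\eta_p(h,\mathbf{y},t)=[\mathbf{y}(t)^T,h\mathbf{y}'(t)^T,\dots,h^p\mathbf{y}^{(p)}(t)^T]^T$ (Nordsieck vector).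
   Formalization: V^E is assumed power bounded (zero-stable), and c ≤ D is replaced by c ≤ 1/D; without either change the claim is false. Numerical solutions are those with stages near the exact solution (existence proved); the expansion holds on an open interval around [t_0, t_0+Const]. *)

theory Defs
  imports "HOL-Analysis.Analysis"
begin

text \<open>Smoothness (all derivatives of all orders exist and are continuous) on an open set. Iterated
  directional derivatives are used so that the type of the function stays the same.\<close>

fun higher_differentiable_on ::
    "'a::real_normed_vector set \<Rightarrow> ('a \<Rightarrow> 'b::real_normed_vector) \<Rightarrow> nat \<Rightarrow> bool" where
  "higher_differentiable_on S F 0 \<longleftrightarrow> continuous_on S F"
| "higher_differentiable_on S F (Suc n) \<longleftrightarrow>
     (\<forall>x\<in>S. F differentiable (at x)) \<and>
     (\<forall>v. higher_differentiable_on S (\<lambda>x. frechet_derivative F (at x) v) n)"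

definition smooth_on :: "'a::real_normed_vector set \<Rightarrow> ('a \<Rightarrow> 'b::real_normed_vector) \<Rightarrow> bool" where
  "smooth_on S F \<longleftrightarrow> (\<forall>n. higher_differentiable_on S F n)"

definition nderiv :: "nat \<Rightarrow> (real \<Rightarrow> 'a::real_normed_vector) \<Rightarrow> real \<Rightarrow> 'a" where
  "nderiv k y = ((\<lambda>u t. vector_derivative u (at t)) ^^ k) y"


subsection \<open>Matrices\<close>

definition eigenvalues :: "complex^'n^'n \<Rightarrow> complex set" where
  "eigenvalues M = {l. \<exists>v. v \<noteq> 0 \<and> M *v v = l *s v}"

definition spectral_radius :: "complex^'n^'n \<Rightarrow> real" where
  "spectral_radius M = (SUP l\<in>eigenvalues M. cmod l)"

definition log_norm :: "real^'n^'n \<Rightarrow> real" where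
  "log_norm G = (SUP y\<in>{y. y \<noteq> 0}. ((G *v y) \<bullet> y) / (y \<bullet> y))"

abbreviation cmatrix :: "real^'n^'k \<Rightarrow> complex^'n^'k" where
  "cmatrix \<equiv> map_matrix complex_of_real"

definition power_bounded :: "real^'n^'n \<Rightarrow> bool" where
  "power_bounded V \<longleftrightarrow> bounded (range (\<lambda>n. (((**) V) ^^ n) (mat 1)))"


subsection \<open>The singular perturbation problem\<close>

definition partial_z :: "((real^'m) \<times> (real^'m) \<Rightarrow> real^'m) \<Rightarrow> (real^'m) \<times> (real^'m) \<Rightarrow> real^'m^'m" where
  "partial_z g w = jacobian (\<lambda>v. g (fst w, v)) (at (snd w))"

text \<open>The coefficient of \<open>\<epsilon>\<^sup>\<nu>\<close> in \<open>F (\<Sum>k. a k \<epsilon>\<^sup>k, \<Sum>k. b k \<epsilon>\<^sup>k)\<close>, as a Taylor coefficient at 0.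
  Truncating the inner series after order \<open>\<nu>\<close> does not change it.\<close>

definition eps_coeff ::
    "((real^'m) \<times> (real^'m) \<Rightarrow> real^'m) \<Rightarrow> (nat \<Rightarrow> real^'m) \<Rightarrow> (nat \<Rightarrow> real^'m) \<Rightarrow> nat \<Rightarrow> real^'m" where
  "eps_coeff F a b \<nu> =
     (1 / fact \<nu>) *\<^sub>R nderiv \<nu> (\<lambda>e. F (\<Sum>k\<le>\<nu>. e ^ k *\<^sub>R a k, \<Sum>k\<le>\<nu>. e ^ k *\<^sub>R b k)) 0"

definition consistent_coefficients ::
    "((real^'m) \<times> (real^'m) \<Rightarrow> real^'m) \<Rightarrow> ((real^'m) \<times> (real^'m) \<Rightarrow> real^'m) \<Rightarrow> real set \<Rightarrow>
     (nat \<Rightarrow> real \<Rightarrow> real^'m) \<Rightarrow> (nat \<Rightarrow> real \<Rightarrow> real^'m) \<Rightarrow> bool" where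
  "consistent_coefficients f g J xk zk \<longleftrightarrow>
     (\<forall>k. smooth_on J (xk k) \<and> smooth_on J (zk k)) \<and>
     (\<forall>t\<in>J.
        (xk 0 has_vector_derivative f (xk 0 t, zk 0 t)) (at t) \<and>
        g (xk 0 t, zk 0 t) = 0 \<and>
        (\<forall>\<nu>\<ge>1.
           (xk \<nu> has_vector_derivative eps_coeff f (\<lambda>k. xk k t) (\<lambda>k. zk k t) \<nu>) (at t) \<and>
           (zk (\<nu> - 1) has_vector_derivative eps_coeff g (\<lambda>k. xk k t) (\<lambda>k. zk k t) \<nu>) (at t)))"

text \<open>\<open>y \<epsilon> t = \<Sum>k. yk k t \<epsilon>\<^sup>k\<close> as an asymptotic series for \<open>\<epsilon> \<rightarrow> 0\<close>, uniformly in time. The series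
  need not converge.\<close>

definition eps_expansion ::
    "real \<Rightarrow> real set \<Rightarrow> (real \<Rightarrow> real \<Rightarrow> 'a::real_normed_vector) \<Rightarrow> (nat \<Rightarrow> real \<Rightarrow> 'a) \<Rightarrow> bool" where
  "eps_expansion \<epsilon>\<^sub>0 J y yk \<longleftrightarrow>
     (\<forall>N. \<exists>K. \<forall>\<epsilon>\<in>{0<..\<epsilon>\<^sub>0}. \<forall>t\<in>J. norm (y \<epsilon> t - (\<Sum>k\<le>N. \<epsilon> ^ k *\<^sub>R yk k t)) \<le> K * \<epsilon> ^ (N + 1))"

definition spp_solution ::
    "((real^'m) \<times> (real^'m) \<Rightarrow> real^'m) \<Rightarrow> ((real^'m) \<times> (real^'m) \<Rightarrow> real^'m) \<Rightarrow> real \<Rightarrow> real set \<Rightarrow>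
     (real \<Rightarrow> real^'m) \<Rightarrow> (real \<Rightarrow> real^'m) \<Rightarrow> bool" where
  "spp_solution f g \<epsilon> J x z \<longleftrightarrow>
     (\<forall>t\<in>J. (x has_vector_derivative f (x t, z t)) (at t) \<and>
            (z has_vector_derivative (1 / \<epsilon>) *\<^sub>R g (x t, z t)) (at t))"


subsection \<open>IMEX general linear methods\<close>

definition cpower :: "real^'s \<Rightarrow> nat \<Rightarrow> real^'s" where
  "cpower c k = (\<chi> i. (c $ i) ^ k)"

text \<open>The columns of the matrix \<open>W\<close> are \<open>w 0, \<dots>, w p\<close>.\<close>

definition glm_order ::
    "nat \<Rightarrow> nat \<Rightarrow> real^'s \<Rightarrow> real^'s^'s \<Rightarrow> real^'r^'s \<Rightarrow> real^'s^'r \<Rightarrow> real^'r^'r \<Rightarrow>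
     (nat \<Rightarrow> real^'r) \<Rightarrow> bool" where
  "glm_order p q c A U B V w \<longleftrightarrow>
     (q = p \<or> Suc q = p) \<and>
     U *v w 0 = (\<chi> i. 1) \<and> V *v w 0 = w 0 \<and>
     (\<forall>k\<in>{1..q}. (1 / fact k) *\<^sub>R cpower c k
         - (1 / fact (k - 1)) *\<^sub>R (A *v cpower c (k - 1)) - U *v w k = 0) \<and>
     (\<forall>k\<in>{1..p}. (\<Sum>l\<le>k. (1 / fact l) *\<^sub>R w (k - l))
         - (1 / fact (k - 1)) *\<^sub>R (B *v cpower c (k - 1)) - V *v w k = 0)"

definition strictly_lower_triangular :: "real^'s::{finite,linorder}^'s::{finite,linorder} \<Rightarrow> bool" where
  "strictly_lower_triangular A \<longleftrightarrow> (\<forall>i j. i \<le> j \<longrightarrow> A $ i $ j = 0)"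

definition stab_matrix ::
    "real^'s^'s \<Rightarrow> real^'r^'s \<Rightarrow> real^'s^'r \<Rightarrow> real^'r^'r \<Rightarrow> complex \<Rightarrow> complex^'r^'r" where
  "stab_matrix A U B V z =
     cmatrix V + map_matrix ((*) z)
       (cmatrix B ** matrix_inv (mat 1 - map_matrix ((*) z) (cmatrix A)) ** cmatrix U)"

definition stab_matrix_inf ::
    "real^'s^'s \<Rightarrow> real^'r^'s \<Rightarrow> real^'s^'r \<Rightarrow> real^'r^'r \<Rightarrow> real^'r^'r" where
  "stab_matrix_inf A U B V = V - B ** matrix_inv A ** U"

text \<open>A block vector of \<open>k\<close> blocks in \<open>\<real>\<^sup>m\<close> is the matrix \<open>Y :: real^'m^'k\<close> whose rows are its blocks;
  then \<open>(A \<otimes> I\<^sub>m) Y\<close> is the matrix product \<open>A ** Y\<close>.\<close>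

definition stagewise :: "((real^'m) \<times> (real^'m) \<Rightarrow> real^'m) \<Rightarrow> real^'m^'s \<Rightarrow> real^'m^'s \<Rightarrow> real^'m^'s" where
  "stagewise F X Z = (\<chi> i. F (X $ i, Z $ i))"

definition imex_step ::
    "((real^'m) \<times> (real^'m) \<Rightarrow> real^'m) \<Rightarrow> ((real^'m) \<times> (real^'m) \<Rightarrow> real^'m) \<Rightarrow> real \<Rightarrow> real \<Rightarrow>
     real^'s^'s \<Rightarrow> real^'r^'s \<Rightarrow> real^'s^'r \<Rightarrow> real^'r^'r \<Rightarrow>
     real^'s^'s \<Rightarrow> real^'r^'s \<Rightarrow> real^'s^'r \<Rightarrow> real^'r^'r \<Rightarrow>
     real^'m^'r \<Rightarrow> real^'m^'r \<Rightarrow> real^'m^'s \<Rightarrow> real^'m^'s \<Rightarrow> real^'m^'r \<Rightarrow> real^'m^'r \<Rightarrow> bool" where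
  "imex_step f g \<epsilon> h A\<^sub>E U\<^sub>E B\<^sub>E V\<^sub>E A\<^sub>I U\<^sub>I B\<^sub>I V\<^sub>I \<xi> \<zeta> X Z \<xi>' \<zeta>' \<longleftrightarrow>
     X = h *\<^sub>R (A\<^sub>E ** stagewise f X Z) + U\<^sub>E ** \<xi> \<and>
     Z = h *\<^sub>R (A\<^sub>I ** ((1 / \<epsilon>) *\<^sub>R stagewise g X Z)) + U\<^sub>I ** \<zeta> \<and>
     \<xi>' = h *\<^sub>R (B\<^sub>E ** stagewise f X Z) + V\<^sub>E ** \<xi> \<and>
     \<zeta>' = h *\<^sub>R (B\<^sub>I ** ((1 / \<epsilon>) *\<^sub>R stagewise g X Z)) + V\<^sub>I ** \<zeta>"

definition nordsieck :: "real \<Rightarrow> (real \<Rightarrow> real^'m) \<Rightarrow> real \<Rightarrow> nat \<Rightarrow> real^'m" where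
  "nordsieck h y t k = h ^ k *\<^sub>R nderiv k y t"

text \<open>\<open>(W \<otimes> I\<^sub>m) \<eta>\<^sub>p(h, y, t)\<close>\<close>

definition exact_ext ::
    "nat \<Rightarrow> (nat \<Rightarrow> real^'r) \<Rightarrow> real \<Rightarrow> (real \<Rightarrow> real^'m) \<Rightarrow> real \<Rightarrow> real^'m^'r" where
  "exact_ext p w h y t = (\<chi> i. \<Sum>k\<le>p. (w k $ i) *\<^sub>R nordsieck h y t k)"

text \<open>The stage equations are nonlinear and may have solutions unrelated to the exact solution, so
  the stage values of step \<open>n + 1\<close> (from \<open>t\<^sub>0 + n h\<close>) are taken within distance \<open>\<delta>\<close> of it.\<close>

definition stages_near ::
    "real \<Rightarrow> real \<Rightarrow> real \<Rightarrow> real^'s \<Rightarrow> nat \<Rightarrow> (real \<Rightarrow> real^'m) \<Rightarrow> (nat \<Rightarrow> real^'m^'s) \<Rightarrow> bool" where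
  "stages_near \<delta> t\<^sub>0 h c N y Y \<longleftrightarrow>
     (\<forall>n<N. \<forall>i. dist (Y (Suc n) $ i) (y (t\<^sub>0 + real n * h + c $ i * h)) \<le> \<delta>)"

end

theory Submission
  imports Defs "HOL-Computational_Algebra.Fundamental_Theorem_Algebra"
begin

text \<open>The error equations are written with \<open>\<theta> = \<epsilon> / h\<close> and with \<open>\<gamma>\<close>, which is \<open>h / \<epsilon>\<close> times the difference between \<open>g\<close> at
  the numerical and at the exact stages. Then no term is divided by \<open>\<epsilon>\<close>, the parameter \<open>\<theta>\<close> ranges over the
  compact interval \<open>[0, 1 / D]\<close>, and infinite stiffness \<open>\<theta> = 0\<close> is an ordinary value.

  Linearize at a frozen point of the reduced solution, with \<open>J = g\<^sub>z\<close>. The stages become \<open>\<theta> \<gamma> = J (A \<gamma> + U \<Delta>\<zeta>)\<close>,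
  which is solvable since \<open>A\<close> has positive eigenvalues and \<open>J\<close> is dissipative (\<open>stage_operator_inj\<close>). The error
  \<open>\<Delta>\<zeta>\<close> is mapped to \<open>V \<Delta>\<zeta> + B \<gamma>\<close>. This linear map commutes with \<open>J\<close>, so each of its eigenvalues is an eigenvalue of the
  stability matrix at some \<open>\<mu> / \<theta>\<close>, where \<open>\<mu>\<close> is an eigenvalue of \<open>J\<close>. As \<open>Re \<mu> \<le> -1\<close> and \<open>\<theta> \<le> 1 / D\<close>, it
  has modulus less than one (\<open>propagation_eigenvalue\<close>), and some power of the map is a contraction. The number of
  steps and all constants are uniform by compactness, and \<open>J\<close> changes little during a fixed number of steps;
  hence the stiff error contracts in blocks (\<open>uniform_contracting_block\<close>). It is bounded by
  the nonstiff errors and the residuals. The nonstiff error obeys a zero-stable recursion with perturbations of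
  size \<open>h\<close>, and a Gronwall argument closes the estimate (\<open>global_error_bound\<close>). Since the stiff
  component contracts, stage residuals of order \<open>h\<^sup>p\<close>, as delivered by stage order \<open>p - 1\<close>, cost no order.

  The residuals are Taylor remainders, so the derivatives of the exact solutions must be bounded independently
  of \<open>\<epsilon>\<close>. The differential equation yields bounds by powers of \<open>1 / \<epsilon>\<close> only. But the solutions differ from
  smooth partial sums of their expansion by arbitrarily high powers of \<open>\<epsilon>\<close>, and interpolation between the two
  bounds shows that the expansion may be differentiated (\<open>solution_derivatives_uniformly_bounded\<close>).

  Stage values near the exact ones exist by Brouwer's fixed point theorem (\<open>stage_values_exist\<close>) as long as the
  errors are small, and this is ensured step by step by the error bound itself.\<close>

section \<open>Real operators with complex eigenvalues in the open unit disc\<close>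

text \<open>Multiplication by a complex number on the complexification \<open>E \<times> E\<close> of a real space \<open>E\<close>: the pair
  \<open>(a, b)\<close> stands for \<open>a + i b\<close>, and the complexification of an operator \<open>L\<close> is \<open>map_prod L L\<close>. Eigenvalues
  of operators on block vectors can then be discussed without choosing a basis.\<close>

definition cscale :: "complex \<Rightarrow> 'a \<times> 'a \<Rightarrow> 'a \<times> 'a::real_vector" where
  "cscale c v = (Re c *\<^sub>R fst v - Im c *\<^sub>R snd v, Im c *\<^sub>R fst v + Re c *\<^sub>R snd v)"

lemma cscale_simps [simp]:
  "cscale 0 v = 0" "cscale 1 v = v" "cscale c 0 = 0"
  by (auto simp: cscale_def prod_eq_iff)

lemma cscale_algebra:
  "cscale c (v + w) = cscale c v + cscale c w"
  "cscale (c + d) v = cscale c v + cscale d v"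
  "cscale (c * d) v = cscale c (cscale d v)"
  "cscale (- c) v = - cscale c v"
  "cscale (of_real r) v = r *\<^sub>R v"
  by (auto simp: cscale_def prod_eq_iff algebra_simps)

lemma norm_cscale: "norm (cscale c v) = cmod c * norm v"
  for v :: "'a \<times> 'a::real_inner"
proof -
  have "(norm (cscale c v))\<^sup>2 = (cmod c * norm v)\<^sup>2"
    unfolding power_mult_distrib
    by (simp only: cmod_power2 cscale_def power2_norm_eq_inner[where 'a = "'a \<times> 'a"])
      (simp add: inner_prod_def inner_simps algebra_simps inner_commute power2_eq_square)
  then show ?thesis by (metis abs_of_nonneg mult_nonneg_nonneg norm_ge_zero power2_eq_iff_nonneg)
qed

lemma cscale_eq_0_iff: "cscale c v = 0 \<longleftrightarrow> c = 0 \<or> v = 0"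
  for v :: "'a \<times> 'a::real_inner"
  using norm_cscale[of c v] by (metis mult_eq_0_iff norm_eq_zero)

lemma map_prod_cscale: "linear L \<Longrightarrow> map_prod L L (cscale c v) = cscale c (map_prod L L v)"
  by (auto simp: cscale_def prod_eq_iff linear_add linear_diff linear_scale)

lemma map_prod_add: "linear L \<Longrightarrow> map_prod L L (v + w) = map_prod L L v + map_prod L L w"
  by (auto simp: prod_eq_iff linear_add)

lemma map_prod_0: "linear L \<Longrightarrow> map_prod L L 0 = 0"
  by (simp add: prod_eq_iff linear_0 zero_prod_def)

text \<open>The vector \<open>q(L) v\<close>, evaluated by Horner's scheme.\<close>

definition poly_action :: "('a \<Rightarrow> 'a) \<Rightarrow> complex poly \<Rightarrow> 'a \<times> 'a \<Rightarrow> 'a \<times> 'a::real_vector" where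
  "poly_action L q v = fold_coeffs (\<lambda>a w. cscale a v + map_prod L L w) q 0"

lemma poly_action_0 [simp]: "poly_action L 0 v = 0"
  by (simp add: poly_action_def)

lemma poly_action_pCons [simp]:
  "linear L \<Longrightarrow> poly_action L (pCons a q) v = cscale a v + map_prod L L (poly_action L q v)"
  by (cases "q = 0 \<and> a = 0") (auto simp: poly_action_def map_prod_0)

lemma poly_action_add:
  assumes "linear L"
  shows "poly_action L (p + q) v = poly_action L p v + poly_action L q v"
  by (induction p q rule: poly_induct2)
    (simp_all add: assms cscale_algebra map_prod_add)

lemma poly_action_smult:
  assumes "linear L"
  shows "poly_action L (smult c p) v = cscale c (poly_action L p v)"
  by (induction p)
    (simp_all add: assms cscale_algebra map_prod_cscale)

lemma poly_action_monom:
  assumes "linear L"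
  shows "poly_action L (monom c n) v = cscale c ((map_prod L L ^^ n) v)"
  by (induction n)
    (simp_all add: assms monom_0 monom_Suc map_prod_cscale map_prod_0[OF assms])

lemma poly_action_vec:
  assumes "linear L"
  shows "poly_action L p (v + w) = poly_action L p v + poly_action L p w"
    "poly_action L p (cscale c v) = cscale c (poly_action L p v)"
    "poly_action L p (map_prod L L v) = map_prod L L (poly_action L p v)"
proof -
  note [simp] = assms map_prod_cscale[OF assms] map_prod_add[OF assms]
  have com: "cscale a (cscale b u) = cscale b (cscale a u)" for a b and u :: "'a \<times> 'a"
    by (metis cscale_algebra(3) mult.commute)
  show "poly_action L p (v + w) = poly_action L p v + poly_action L p w"
    by (induction p) (simp_all add: cscale_algebra)
  show "poly_action L p (cscale c v) = cscale c (poly_action L p v)"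
    by (induction p) (simp_all add: cscale_algebra(1) com)
  show "poly_action L p (map_prod L L v) = map_prod L L (poly_action L p v)"
    by (induction p) (simp_all add: map_prod_0[OF assms])
qed

lemma poly_action_root:
  assumes "linear L"
  shows "poly_action L ([:- a, 1:] * q) v = map_prod L L (poly_action L q v) - cscale a (poly_action L q v)"
    "poly_action L ([:- a, 1:] * q) v = poly_action L q (map_prod L L v - cscale a v)"
proof -
  have *: "[:- a, 1:] * q = smult (- a) q + pCons 0 q"
    by simp
  show 1: "poly_action L ([:- a, 1:] * q) v = map_prod L L (poly_action L q v) - cscale a (poly_action L q v)"
    unfolding * poly_action_add[OF assms] poly_action_smult[OF assms]
    by (simp add: assms cscale_algebra)
  have "poly_action L q (map_prod L L v + cscale (- a) v)
      = map_prod L L (poly_action L q v) + cscale (- a) (poly_action L q v)"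
    by (simp only: poly_action_vec[OF assms])
  then show "poly_action L ([:- a, 1:] * q) v = poly_action L q (map_prod L L v - cscale a v)"
    using 1 by (simp add: cscale_algebra)
qed

lemma linear_map_prod: "linear L \<Longrightarrow> linear (map_prod L L)"
  by (auto intro!: linearI simp: prod_eq_iff linear_add linear_scale)

lemma poly_action_sum_real:
  assumes "linear L" "finite I"
  shows "poly_action L (\<Sum>i\<in>I. monom (of_real (r i)) i) v = (\<Sum>i\<in>I. r i *\<^sub>R (map_prod L L ^^ i) v)"
  using assms(2) by (induction I) (simp_all add: poly_action_add poly_action_monom assms(1) cscale_algebra)

text \<open>In finite dimension the iterates \<open>v, L v, L\<^sup>2 v, \<dots>\<close> are linearly dependent, or two of them
  coincide; either relation is a polynomial.\<close>

lemma annihilating_poly_exists: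
  fixes L :: "'a::euclidean_space \<Rightarrow> 'a"
  assumes L: "linear L"
  shows "\<exists>q. q \<noteq> 0 \<and> poly_action L q v = 0"
proof -
  let ?n = "DIM('a \<times> 'a)"
  let ?s = "\<lambda>i. (map_prod L L ^^ i) v"
  show ?thesis
  proof (cases "inj_on ?s {..?n}")
    case False
    then obtain i j where ij: "i \<noteq> j" "?s i = ?s j" by (auto simp: inj_on_def)
    let ?q = "monom 1 i + monom (-1) j :: complex poly"
    have "coeff ?q i = 1" using ij by simp
    then have "?q \<noteq> 0" by (metis coeff_0 zero_neq_one)
    moreover have "poly_action L ?q v = 0"
      using ij by (simp add: poly_action_add poly_action_monom L cscale_algebra)
    ultimately show ?thesis by blast
  next
    case True
    have "dependent (?s ` {..?n})"
    proof (rule ccontr)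
      assume "\<not> dependent (?s ` {..?n})"
      then have "card (?s ` {..?n}) \<le> ?n" using independent_bound by blast
      then show False using card_image[OF True] by simp
    qed
    then obtain u b where u: "(\<Sum>w\<in>?s ` {..?n}. u w *\<^sub>R w) = 0" "b \<in> ?s ` {..?n}" "u b \<noteq> 0"
      by (subst (asm) dependent_finite) blast+
    define r where "r i = u (?s i)" for i
    let ?q = "\<Sum>i\<le>?n. monom (complex_of_real (r i)) i"
    obtain i where i: "i \<le> ?n" "r i \<noteq> 0" using u by (auto simp: r_def)
    have "coeff ?q i = r i"
      using i by (simp add: coeff_sum sum.If_cases if_distrib cong: if_cong)
    then have "?q \<noteq> 0" using i by auto
    moreover have "poly_action L ?q v = 0"
      using u(1) unfolding sum.reindex[OF True] by (simp add: poly_action_sum_real L r_def o_def)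
    ultimately show ?thesis by blast
  qed
qed

text \<open>The fundamental theorem of algebra, in the form used for induction on the degree.\<close>

lemma complex_poly_cases:
  fixes q :: "complex poly"
  assumes "q \<noteq> 0"
  obtains c where "c \<noteq> 0" "q = [:c:]"
  | a q' where "q = [:- a, 1:] * q'" "q' \<noteq> 0" "degree q' < degree q"
proof (cases "degree q = 0")
  case True
  then show ?thesis using assms that(1) by (metis degree_eq_zeroE pCons_0_0)
next
  case False
  then have "\<not> constant (poly q)" by (simp add: constant_degree)
  then obtain a where "poly q a = 0" using fundamental_theorem_of_algebra by blast
  then obtain q' where q': "q = [:- a, 1:] * q'" by (auto simp: poly_eq_0_iff_dvd elim: dvdE)
  have "q' \<noteq> 0" using q' assms by auto
  moreover have "degree q = Suc (degree q')"
    unfolding q' using \<open>q' \<noteq> 0\<close> by (subst degree_mult_eq) auto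
  ultimately show ?thesis using q' that(2) by auto
qed

text \<open>Linear factors are removed from an annihilating polynomial of \<open>v\<close> until the remaining one
  does not annihilate \<open>v\<close> any more; its value at \<open>v\<close> is an eigenvector, and it lies in \<open>N\<close> because
  \<open>N\<close> is invariant. When \<open>N\<close> is defined through an operator that commutes with \<open>L\<close>, this produces
  common eigenvectors.\<close>

lemma invariant_subspace_eigenvector:
  fixes L :: "'a::euclidean_space \<Rightarrow> 'a"
  assumes L: "linear L"
    and N: "\<And>v w. v \<in> N \<Longrightarrow> w \<in> N \<Longrightarrow> v + w \<in> N" "\<And>c v. v \<in> N \<Longrightarrow> cscale c v \<in> N"
      "\<And>v. v \<in> N \<Longrightarrow> map_prod L L v \<in> N"
    and v: "v \<in> N" "v \<noteq> 0"
  shows "\<exists>w\<in>N. w \<noteq> 0 \<and> (\<exists>a. map_prod L L w = cscale a w)"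
proof -
  have act: "poly_action L q v \<in> N" for q
  proof (induction q)
    case 0
    then show ?case using N(2)[OF v(1), of 0] by simp
  next
    case (pCons a q)
    then show ?case using N v by (simp add: L)
  qed
  have "\<exists>w\<in>N. w \<noteq> 0 \<and> (\<exists>a. map_prod L L w = cscale a w)"
    if "q \<noteq> 0" "poly_action L q v = 0" for q
    using that
  proof (induction "degree q" arbitrary: q rule: less_induct)
    case less
    from less(2) show ?case
    proof (cases rule: complex_poly_cases)
      case (1 c)
      then show ?thesis using less(3) v by (simp add: L map_prod_0 cscale_eq_0_iff)
    next
      case (2 a q')
      show ?thesis
      proof (cases "poly_action L q' v = 0")
        case True
        then show ?thesis using less(1)[of q'] 2 by auto
      next
        case False
        then show ?thesis using less(3) act[of q'] unfolding 2(1) poly_action_root(1)[OF L]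
          by (intro bexI[of _ "poly_action L q' v"]) auto
      qed
    qed
  qed
  then show ?thesis using annihilating_poly_exists[OF L, of v] by blast
qed

lemma contraction_with_vanishing_source:
  fixes a :: complex and s :: "nat \<Rightarrow> 'a \<times> 'a::euclidean_space"
  assumes a: "cmod a < 1" and s: "\<And>n. s (Suc n) = cscale a (s n) + u n" and u: "u \<longlonglongrightarrow> 0"
  shows "s \<longlonglongrightarrow> 0"
proof (rule LIMSEQ_I)
  fix r :: real assume r: "0 < r"
  define d where "d = (1 - cmod a) * (r / 2)"
  have "d > 0" using a r by (simp add: d_def)
  then obtain N where N: "\<And>n. n \<ge> N \<Longrightarrow> norm (u n) < d"
    using LIMSEQ_D[OF u] by auto
  have bd: "norm (s (N + k)) \<le> cmod a ^ k * norm (s N) + r / 2" for k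
  proof (induction k)
    case 0
    then show ?case using r by simp
  next
    case (Suc k)
    have "norm (s (N + Suc k)) \<le> cmod a * norm (s (N + k)) + norm (u (N + k))"
      using norm_triangle_ineq[of "cscale a (s (N + k))" "u (N + k)"] by (simp add: s norm_cscale)
    also have "\<dots> \<le> cmod a * (cmod a ^ k * norm (s N) + r / 2) + d"
      using Suc N[of "N + k"] by (intro add_mono mult_left_mono) auto
    also have "\<dots> = cmod a ^ Suc k * norm (s N) + r / 2"
      by (simp add: d_def field_simps)
    finally show ?case .
  qed
  have "(\<lambda>k. cmod a ^ k * norm (s N)) \<longlonglongrightarrow> 0 * norm (s N)"
    using a by (intro tendsto_mult LIMSEQ_power_zero tendsto_const) auto
  then have "\<forall>\<^sub>F k in sequentially. cmod a ^ k * norm (s N) < r / 2"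
    using order_tendstoD(2)[of _ 0 sequentially "r / 2"] r by simp
  then obtain K where K: "\<And>k. k \<ge> K \<Longrightarrow> cmod a ^ k * norm (s N) < r / 2"
    by (auto simp: eventually_sequentially)
  show "\<exists>no. \<forall>n\<ge>no. norm (s n - 0) < r"
  proof (intro exI[of _ "N + K"] allI impI)
    fix n assume "n \<ge> N + K"
    then obtain k where k: "n = N + k" "k \<ge> K" by (metis add_le_cancel_left le_Suc_ex le_add1 le_trans)
    show "norm (s n - 0) < r" using bd[of k] K[OF k(2)] k(1) by simp
  qed
qed

lemma funpow_linear: "linear L \<Longrightarrow> linear (L ^^ n)" for L :: "'a::real_vector \<Rightarrow> 'a"
proof (induction n)
  case 0
  show ?case by (simp add: linear_id[unfolded id_def] id_def)
next
  case (Suc n)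
  then show ?case using linear_compose[of "L ^^ n" L] by (simp add: o_def)
qed

text \<open>Induction over the linear factors \<open>x - a\<close> of an annihilating polynomial. If \<open>|a| < 1\<close>, the iterates
  satisfy a contracting recursion whose source tends to zero by induction. If \<open>|a| \<ge> 1\<close>, then \<open>a\<close> is
  not an eigenvalue and the factor can be cancelled.\<close>

lemma powers_tend_to_zero:
  fixes L :: "'a::euclidean_space \<Rightarrow> 'a"
  assumes L: "linear L"
    and eig: "\<And>a v. v \<noteq> 0 \<Longrightarrow> map_prod L L v = cscale a v \<Longrightarrow> cmod a < 1"
  shows "(\<lambda>n. (map_prod L L ^^ n) v) \<longlonglongrightarrow> 0"
proof -
  have "(\<lambda>n. (map_prod L L ^^ n) v) \<longlonglongrightarrow> 0"
    if "q \<noteq> 0" "poly_action L q v = 0" for q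
    using that
  proof (induction "degree q" arbitrary: q v rule: less_induct)
    case less
    note lin = funpow_linear[OF linear_map_prod[OF L]]
    from less(2) show ?case
    proof (cases rule: complex_poly_cases)
      case (1 c)
      then have "v = 0" using less(3) by (simp add: L map_prod_0 cscale_eq_0_iff)
      then show ?thesis using lin by (simp add: linear_0)
    next
      case (2 a q')
      show ?thesis
      proof (cases "cmod a < 1")
        case True
        let ?w = "map_prod L L v - cscale a v"
        have "(\<lambda>n. (map_prod L L ^^ n) ?w) \<longlonglongrightarrow> 0"
          using less(1)[of q' ?w] less(3) 2 poly_action_root(2)[OF L, of a q' v] by auto
        moreover have "(map_prod L L ^^ Suc n) v
            = cscale a ((map_prod L L ^^ n) v) + (map_prod L L ^^ n) ?w" for n
        proof -
          have "(map_prod L L ^^ n) (cscale a v) = cscale a ((map_prod L L ^^ n) v)"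
            by (induction n) (simp_all add: map_prod_cscale[OF L])
          then show ?thesis using linear_diff[OF lin] by (simp add: funpow_swap1)
        qed
        ultimately show ?thesis
          by (intro contraction_with_vanishing_source[OF True, where s = "\<lambda>n. (map_prod L L ^^ n) v"
                and u = "\<lambda>n. (map_prod L L ^^ n) (map_prod L L v - cscale a v)"])
      next
        case False
        have "map_prod L L (poly_action L q' v) = cscale a (poly_action L q' v)"
          using less(3) unfolding 2(1) poly_action_root(1)[OF L] by simp
        then have "poly_action L q' v = 0" using eig False by blast
        then show ?thesis using less(1)[of q' v] 2 by auto
      qed
    qed
  qed
  then show ?thesis using annihilating_poly_exists[OF L, of v] by blast
qed

text \<open>Convergence to zero on each of the finitely many basis vectors bounds the operator norm of
  a high power.\<close>

lemma some_power_contracts: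
  fixes L :: "'a::euclidean_space \<Rightarrow> 'a"
  assumes L: "linear L"
    and eig: "\<And>a v. v \<noteq> 0 \<Longrightarrow> map_prod L L v = cscale a v \<Longrightarrow> cmod a < 1"
    and r: "0 < r"
  shows "\<exists>k\<ge>1. \<forall>y. norm ((L ^^ k) y) \<le> r * norm y"
proof -
  have lim: "(\<lambda>n. (L ^^ n) y) \<longlonglongrightarrow> 0" for y
  proof -
    have "(map_prod L L ^^ n) (y, 0) = ((L ^^ n) y, (L ^^ n) 0)" for n
      by (induction n) auto
    then show ?thesis
      using tendsto_fst[OF powers_tend_to_zero[OF L eig, where v = "(y, 0)"]] by simp
  qed
  define r' where "r' = r / DIM('a)"
  have "r' > 0" using r by (simp add: r'_def)
  have "\<forall>b\<in>(Basis::'a set). \<forall>\<^sub>F n in sequentially. norm ((L ^^ n) b) < r'"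
    using lim \<open>r' > 0\<close> by (auto simp: tendsto_iff dist_norm)
  then have "\<forall>\<^sub>F n in sequentially. \<forall>b\<in>(Basis::'a set). norm ((L ^^ n) b) < r'"
    by (simp add: eventually_ball_finite_distrib)
  then obtain K where K: "\<And>n b. n \<ge> K \<Longrightarrow> b \<in> Basis \<Longrightarrow> norm ((L ^^ n) b :: 'a) < r'"
    unfolding eventually_sequentially by blast
  define k where "k = Suc K"
  have "norm ((L ^^ k) y) \<le> r * norm y" for y
  proof -
    have lk: "linear (L ^^ k)" by (rule funpow_linear[OF L])
    have "(L ^^ k) y = (L ^^ k) (\<Sum>b\<in>Basis. (y \<bullet> b) *\<^sub>R b)"
      by (simp add: euclidean_representation)
    also have "\<dots> = (\<Sum>b\<in>Basis. (y \<bullet> b) *\<^sub>R (L ^^ k) b)"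
      by (simp add: linear_sum[OF lk] linear_scale[OF lk])
    also have "norm \<dots> \<le> (\<Sum>b\<in>(Basis::'a set). norm y * r')"
    proof (intro sum_norm_le)
      fix b :: 'a assume "b \<in> Basis"
      then show "norm ((y \<bullet> b) *\<^sub>R (L ^^ k) b) \<le> norm y * r'"
        using K[of k b] by (auto simp: k_def Basis_le_norm intro!: mult_mono)
    qed
    also have "\<dots> = r * norm y" by (simp add: r'_def)
    finally show ?thesis .
  qed
  then show ?thesis by (intro exI[of _ k]) (auto simp: k_def)
qed

section \<open>The linearized implicit stages\<close>

text \<open>The operator \<open>I \<otimes> J\<close> on block vectors. It commutes with every \<open>A \<otimes> I\<close>, here \<open>(**) A\<close>, and all
  spectral arguments below rest on this.\<close>

definition stage_map :: "real^'m^'m \<Rightarrow> real^'m^'n \<Rightarrow> real^'m^'n" where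
  "stage_map J Y = (\<chi> i. J *v (Y $ i))"

lemma matrix_mult_row: "(A ** Y) $ i = (\<Sum>k\<in>UNIV. (A $ i $ k) *\<^sub>R (Y $ k))"
  for A :: "real^'n^'k" and Y :: "real^'m^'n"
  by (simp add: matrix_matrix_mult_def vec_eq_iff)

lemma linear_matrix_mult: "linear (\<lambda>Y. A ** Y)"
  for A :: "real^'n^'k" and Y :: "real^'m^'n"
  by (rule linearI) (simp_all add: vec_eq_iff matrix_matrix_mult_def algebra_simps sum.distrib sum_distrib_left)

lemma matrix_mult_bound: "\<exists>K>0. \<forall>Y::real^'m^'n. norm (A ** Y) \<le> K * norm Y"
  for A :: "real^'n^'k"
  using linear_bounded_pos[OF linear_matrix_mult[of A]] by metis

lemma linear_stage_map: "linear (stage_map J)"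
  by (rule linearI) (simp_all add: stage_map_def vec_eq_iff matrix_vector_right_distrib
      matrix_vector_mult_scaleR)

lemma stage_map_matrix_mult: "stage_map J (A ** Y) = A ** stage_map J Y"
  for A :: "real^'n^'k"
  by (simp add: vec_eq_iff[where 'b = 'k] stage_map_def matrix_mult_row linear_sum linear_scale
      matrix_vector_mult_scaleR)

lemma stage_map_dissipative:
  assumes "\<And>y. (J *v y) \<bullet> y \<le> - (y \<bullet> y)"
  shows "stage_map J Y \<bullet> Y \<le> - (Y \<bullet> Y)"
proof -
  have "(\<Sum>i\<in>UNIV. stage_map J Y $ i \<bullet> Y $ i) \<le> (\<Sum>i\<in>UNIV. - (Y $ i \<bullet> Y $ i))"
    by (intro sum_mono) (simp add: stage_map_def assms)
  then show ?thesis by (simp add: inner_vec_def[of Y] inner_vec_def[of "stage_map J Y"] sum_negf)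
qed

text \<open>Component \<open>j\<close> of all blocks of \<open>a + i b\<close>. On such a column \<open>A \<otimes> I\<close> acts as the complex matrix \<open>A\<close>,
  so eigenvectors of block operators become eigenvectors of the small matrices whose spectra are
  prescribed.\<close>

definition complex_column :: "'m \<Rightarrow> (real^'m^'n) \<times> (real^'m^'n) \<Rightarrow> complex^'n" where
  "complex_column j v = (\<chi> i. Complex (fst v $ i $ j) (snd v $ i $ j))"

lemma complex_column_cscale: "complex_column j (cscale c v) = c *s complex_column j v"
  by (simp add: complex_column_def cscale_def vec_eq_iff complex_eq_iff)

lemma complex_column_add: "complex_column j (v + w) = complex_column j v + complex_column j w"
  by (simp add: complex_column_def vec_eq_iff complex_eq_iff)

lemma complex_column_scaleR: "complex_column j (r *\<^sub>R v) = complex_of_real r *s complex_column j v"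
  by (simp add: complex_column_def vec_eq_iff complex_eq_iff)

lemma complex_column_matrix_mult:
  "complex_column j (map_prod ((**) A) ((**) A) v) = cmatrix A *v complex_column j v"
  by (simp add: complex_column_def vec_eq_iff complex_eq_iff matrix_matrix_mult_def
      matrix_vector_mult_def)

lemma complex_column_nonzero: "v \<noteq> 0 \<Longrightarrow> \<exists>j. complex_column j v \<noteq> 0"
  by (auto simp: complex_column_def vec_eq_iff complex_eq_iff prod_eq_iff)

text \<open>Without a bound on the spectrum the supremum in the spectral radius would say nothing about
  the eigenvalues.\<close>

lemma eigenvalues_bounded: "bdd_above (cmod ` eigenvalues M)"
proof -
  obtain K where K: "\<And>v. norm (M *v v) \<le> norm v * K"
    using bounded_linear.bounded[of "(*v) M"] by auto
  have "cmod l \<le> K" if l: "l \<in> eigenvalues M" for l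
  proof -
    obtain v where v: "v \<noteq> 0" "M *v v = l *s v" using l by (auto simp: eigenvalues_def)
    have "norm (l *s v) = cmod l * norm v"
      by (simp add: norm_vec_def L2_set_def norm_mult power_mult_distrib real_sqrt_mult
          flip: sum_distrib_left)
    then show ?thesis using K[of v] v by (simp add: mult.commute)
  qed
  then show ?thesis by (intro bdd_aboveI2)
qed

lemma eigenvalue_le_spectral_radius: "l \<in> eigenvalues M \<Longrightarrow> cmod l \<le> spectral_radius M"
  unfolding spectral_radius_def by (rule cSUP_upper[OF _ eigenvalues_bounded])

text \<open>The quotients in the logarithmic norm are bounded by the operator norm of \<open>G\<close>, hence each of
  them is below the supremum.\<close>

lemma log_norm_dissipative:
  assumes "log_norm G \<le> - 1"
  shows "(G *v y) \<bullet> y \<le> - (y \<bullet> y)"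
proof (cases "y = 0")
  case False
  obtain K where K: "\<And>v. norm (G *v v) \<le> norm v * K"
    using bounded_linear.bounded[of "(*v) G"] by auto
  have "((G *v y) \<bullet> y) / (y \<bullet> y) \<le> K" if "y \<noteq> 0" for y
  proof -
    have "(G *v y) \<bullet> y \<le> norm (G *v y) * norm y" by (rule norm_cauchy_schwarz)
    also have "\<dots> \<le> (norm y * K) * norm y" by (intro mult_right_mono K) auto
    finally show ?thesis using that by (simp add: field_simps power2_eq_square flip: power2_norm_eq_inner)
  qed
  then have "bdd_above ((\<lambda>y. ((G *v y) \<bullet> y) / (y \<bullet> y)) ` {y. y \<noteq> 0})"
    by (intro bdd_aboveI2[of _ _ K]) auto
  then have "((G *v y) \<bullet> y) / (y \<bullet> y) \<le> log_norm G"
    unfolding log_norm_def using False by (intro cSUP_upper) auto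
  then have "((G *v y) \<bullet> y) / (y \<bullet> y) \<le> - 1" using assms by simp
  then show ?thesis using False by (simp add: divide_le_eq)
qed simp

lemma matrix_inv_left_of_invertible: "invertible M \<Longrightarrow> matrix_inv M ** M = mat 1"
  unfolding invertible_def matrix_inv_def by (metis (mono_tags, lifting) someI_ex)

definition dissipative :: "real^'m^'m \<Rightarrow> bool" where
  "dissipative J \<longleftrightarrow> (\<forall>y. (J *v y) \<bullet> y \<le> - (y \<bullet> y))"

text \<open>Add the inequalities for the real and the imaginary part of the eigenvector: the terms with
  \<open>Im c\<close> cancel.\<close>

lemma dissipative_eigenvalue:
  assumes J: "dissipative J" and v: "v \<noteq> 0"
    and eig: "map_prod (stage_map J) (stage_map J) v = cscale c v"
  shows "Re c \<le> - 1"
proof -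
  obtain a b where ab: "v = (a, b)" by force
  have "stage_map J a \<bullet> a + stage_map J b \<bullet> b \<le> - (a \<bullet> a + b \<bullet> b)"
    using stage_map_dissipative[of J a] stage_map_dissipative[of J b] J by (simp add: dissipative_def)
  also have "stage_map J a \<bullet> a + stage_map J b \<bullet> b = Re c * (a \<bullet> a + b \<bullet> b)"
  proof -
    have *: "stage_map J a = Re c *\<^sub>R a - Im c *\<^sub>R b" "stage_map J b = Im c *\<^sub>R a + Re c *\<^sub>R b"
      using eig by (auto simp: ab cscale_def)
    show ?thesis unfolding * by (simp add: inner_simps algebra_simps inner_commute[of a b])
  qed
  finally have "(Re c + 1) * (a \<bullet> a + b \<bullet> b) \<le> 0" by (simp add: algebra_simps)
  moreover have "a \<bullet> a + b \<bullet> b > 0" using v ab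
    by (metis add_pos_nonneg add_nonneg_pos inner_ge_zero inner_gt_zero_iff zero_prod_def)
  ultimately show ?thesis by (simp add: mult_le_0_iff)
qed

definition positive_spectrum :: "real^'n^'n \<Rightarrow> bool" where
  "positive_spectrum A \<longleftrightarrow> (\<forall>l\<in>eigenvalues (cmatrix A). l \<in> \<real> \<and> 0 < Re l)"

text \<open>Let \<open>\<theta> = \<epsilon> / h\<close>. In terms of the scaled slopes \<open>\<gamma>\<close> (\<open>h / \<epsilon>\<close> times the values of \<open>g\<close>) the linearized
  implicit stages read \<open>\<theta> \<gamma> = J (A \<gamma> + U \<zeta>)\<close>. The operator below collects the terms with \<open>\<gamma>\<close>; it is
  continuous up to \<open>\<theta> = 0\<close>, the limit of infinite stiffness.\<close>

definition stage_operator :: "real \<Rightarrow> real^'m^'m \<Rightarrow> real^'n^'n \<Rightarrow> real^'m^'n \<Rightarrow> real^'m^'n" where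
  "stage_operator \<theta> J A Y = \<theta> *\<^sub>R Y - stage_map J (A ** Y)"

lemma linear_stage_operator: "linear (stage_operator \<theta> J A)"
  by (rule linearI)
    (simp_all add: stage_operator_def linear_add[OF linear_matrix_mult] linear_add[OF linear_stage_map]
      linear_scale[OF linear_matrix_mult] linear_scale[OF linear_stage_map] algebra_simps)

text \<open>Since \<open>A\<close> commutes with \<open>I \<otimes> J\<close>, a nonzero kernel contains an eigenvector of \<open>A\<close>, with eigenvalue
  \<open>a > 0\<close>. On it \<open>I \<otimes> J\<close> has the eigenvalue \<open>\<theta> / a \<ge> 0\<close>, which a dissipative \<open>J\<close> does not have.\<close>

lemma stage_operator_inj:
  fixes A :: "real^'n^'n" and J :: "real^'m^'m"
  assumes A: "positive_spectrum A" and J: "dissipative J" and \<theta>: "0 \<le> \<theta>"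
  shows "inj (stage_operator \<theta> J A)"
proof -
  note linT = linear_stage_map[of J] and linA = linear_matrix_mult[of A]
  let ?N = "{v. \<theta> *\<^sub>R v = map_prod (stage_map J) (stage_map J) (map_prod ((**) A) ((**) A) v)}"
  have False if "Y \<noteq> 0" "stage_operator \<theta> J A Y = 0" for Y
  proof -
    have "\<exists>w\<in>?N. w \<noteq> 0 \<and> (\<exists>a. map_prod ((**) A) ((**) A) w = cscale a w)"
    proof (rule invariant_subspace_eigenvector[OF linA])
      show "(Y, 0) \<in> ?N"
        using that by (auto simp: stage_operator_def linear_0[OF linT] linear_0[OF linA])
    next
      fix v w assume "v \<in> ?N" "w \<in> ?N"
      then show "v + w \<in> ?N"
        by (simp only: mem_Collect_eq map_prod_add[OF linA] map_prod_add[OF linT] scaleR_add_right)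
    next
      fix c v assume v: "v \<in> ?N"
      have "\<theta> *\<^sub>R cscale c v = cscale c (\<theta> *\<^sub>R v)"
        by (simp add: cscale_def scaleR_add_right scaleR_diff_right mult.commute)
      then show "cscale c v \<in> ?N"
        using v by (simp only: mem_Collect_eq map_prod_cscale[OF linA] map_prod_cscale[OF linT])
    next
      fix v assume v: "v \<in> ?N"
      have "\<theta> *\<^sub>R map_prod ((**) A) ((**) A) v = map_prod ((**) A) ((**) A) (\<theta> *\<^sub>R v)"
        by (simp add: prod_eq_iff linear_scale[OF linA])
      also have "\<dots> = map_prod ((**) A) ((**) A)
          (map_prod (stage_map J) (stage_map J) (map_prod ((**) A) ((**) A) v))"
        using v by simp
      also have "\<dots> = map_prod (stage_map J) (stage_map J)
          (map_prod ((**) A) ((**) A) (map_prod ((**) A) ((**) A) v))"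
        by (simp add: prod_eq_iff stage_map_matrix_mult)
      finally show "map_prod ((**) A) ((**) A) v \<in> ?N" by simp
    qed (use that in \<open>simp add: prod_eq_iff\<close>)
    then obtain w a where w: "w \<in> ?N" "w \<noteq> 0" "map_prod ((**) A) ((**) A) w = cscale a w" by blast
    obtain j where j: "complex_column j w \<noteq> 0" using complex_column_nonzero[OF w(2)] by blast
    have "cmatrix A *v complex_column j w = a *s complex_column j w"
      unfolding complex_column_matrix_mult[symmetric] w(3) by (rule complex_column_cscale)
    then have "a \<in> eigenvalues (cmatrix A)" using j by (auto simp: eigenvalues_def)
    then have a: "a = of_real (Re a)" "0 < Re a"
      using A by (auto simp: positive_spectrum_def complex_is_Real_iff complex_eq_iff)
    have "\<theta> *\<^sub>R w = map_prod (stage_map J) (stage_map J) (map_prod ((**) A) ((**) A) w)"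
      using w(1) by (rule CollectD)
    then have "\<theta> *\<^sub>R w = map_prod (stage_map J) (stage_map J) (cscale a w)"
      unfolding w(3) .
    then have "\<theta> *\<^sub>R w = Re a *\<^sub>R map_prod (stage_map J) (stage_map J) w"
      by (subst (asm) a(1)) (simp only: cscale_algebra(5) linear_scale[OF linear_map_prod[OF linT]])
    then have "(1 / Re a) *\<^sub>R (\<theta> *\<^sub>R w) = (1 / Re a) *\<^sub>R (Re a *\<^sub>R map_prod (stage_map J) (stage_map J) w)"
      by (rule arg_cong)
    also have "\<dots> = map_prod (stage_map J) (stage_map J) w"
      using a(2) by (simp only: scaleR_scaleR) simp
    finally have "map_prod (stage_map J) (stage_map J) w = cscale (of_real (\<theta> / Re a)) w"
      unfolding cscale_algebra(5) by simp
    from dissipative_eigenvalue[OF J w(2) this] have "\<theta> / Re a \<le> - 1" by simp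
    moreover have "0 \<le> \<theta> / Re a" using \<theta> a by simp
    ultimately show False by linarith
  qed
  then show ?thesis using linear_injective_0[OF linear_stage_operator] by blast
qed

text \<open>The scaled slopes that an incoming error \<open>\<zeta>\<close> causes in the linearized stages.\<close>

definition stage_response ::
    "real \<Rightarrow> real^'m^'m \<Rightarrow> real^'s^'s \<Rightarrow> real^'r^'s \<Rightarrow> real^'m^'r \<Rightarrow> real^'m^'s" where
  "stage_response \<theta> J A U \<zeta> = inv (stage_operator \<theta> J A) (stage_map J (U ** \<zeta>))"

text \<open>The linearized error map of one implicit step with \<open>J\<close> frozen: for \<open>\<theta> > 0\<close> it is the stability matrix with
  the matrix \<open>J / \<theta>\<close> in place of the scalar argument.\<close>

definition propagation ::
    "real \<Rightarrow> real^'m^'m \<Rightarrow> real^'s^'s \<Rightarrow> real^'r^'s \<Rightarrow> real^'s^'r \<Rightarrow> real^'r^'r \<Rightarrow>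
     real^'m^'r \<Rightarrow> real^'m^'r" where
  "propagation \<theta> J A U B V \<zeta> = V ** \<zeta> + B ** stage_response \<theta> J A U \<zeta>"

lemma inv_stage_operator:
  assumes "positive_spectrum A" "dissipative J" "0 \<le> \<theta>"
  shows "linear (inv (stage_operator \<theta> J A))"
    "stage_operator \<theta> J A (inv (stage_operator \<theta> J A) Y) = Y"
    "inv (stage_operator \<theta> J A) (stage_operator \<theta> J A Y) = Y"
proof -
  have i: "inj (stage_operator \<theta> J A)" by (rule stage_operator_inj[OF assms])
  then have s: "surj (stage_operator \<theta> J A)"
    using linear_stage_operator linear_injective_imp_surjective by blast
  show "linear (inv (stage_operator \<theta> J A))"
    using inj_linear_imp_inv_linear[OF linear_stage_operator i] .
  show "stage_operator \<theta> J A (inv (stage_operator \<theta> J A) Y) = Y" by (rule surj_f_inv_f[OF s])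
  show "inv (stage_operator \<theta> J A) (stage_operator \<theta> J A Y) = Y" by (rule inv_f_f[OF i])
qed

lemma linear_stage_response:
  assumes "positive_spectrum A" "dissipative J" "0 \<le> \<theta>"
  shows "linear (stage_response \<theta> J A U)"
  by (rule linearI)
    (simp_all only: stage_response_def linear_add[OF linear_matrix_mult] linear_add[OF linear_stage_map]
      linear_scale[OF linear_matrix_mult] linear_scale[OF linear_stage_map]
      linear_add[OF inv_stage_operator(1)[OF assms]] linear_scale[OF inv_stage_operator(1)[OF assms]])

lemma linear_propagation:
  assumes "positive_spectrum A" "dissipative J" "0 \<le> \<theta>"
  shows "linear (propagation \<theta> J A U B V)"
  by (rule linearI)
    (simp_all add: propagation_def linear_add[OF linear_matrix_mult] linear_scale[OF linear_matrix_mult]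
      linear_add[OF linear_stage_response[OF assms]] linear_scale[OF linear_stage_response[OF assms]]
      algebra_simps)

lemma stage_response_eq:
  assumes "positive_spectrum A" "dissipative J" "0 \<le> \<theta>"
  shows "\<theta> *\<^sub>R stage_response \<theta> J A U \<zeta> = stage_map J (A ** stage_response \<theta> J A U \<zeta> + U ** \<zeta>)"
  using inv_stage_operator(2)[OF assms, of "stage_map J (U ** \<zeta>)"]
  unfolding stage_response_def stage_operator_def linear_add[OF linear_stage_map]
  by (simp add: algebra_simps)

lemma stage_response_stage_map:
  assumes "positive_spectrum A" "dissipative J" "0 \<le> \<theta>"
  shows "stage_response \<theta> J A U (stage_map J \<zeta>) = stage_map J (stage_response \<theta> J A U \<zeta>)"
proof -
  have "stage_operator \<theta> J A (stage_map J (stage_response \<theta> J A U \<zeta>))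
      = stage_map J (stage_operator \<theta> J A (stage_response \<theta> J A U \<zeta>))"
    unfolding stage_operator_def
    by (simp add: linear_diff[OF linear_stage_map] linear_scale[OF linear_stage_map]
        stage_map_matrix_mult)
  also have "\<dots> = stage_map J (U ** stage_map J \<zeta>)"
    unfolding stage_response_def by (simp add: inv_stage_operator[OF assms] stage_map_matrix_mult)
  finally show ?thesis
    using inv_stage_operator(3)[OF assms, of "stage_map J (stage_response \<theta> J A U \<zeta>)"]
    unfolding stage_response_def by simp
qed

text \<open>A kernel vector would be an eigenvector of \<open>A\<close> for the eigenvalue \<open>1 / z\<close>, which has negative
  real part.\<close>

lemma one_minus_scaled_invertible:
  assumes A: "positive_spectrum A" and z: "Re z < 0"
  shows "invertible (mat 1 - map_matrix ((*) z) (cmatrix A))"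
proof -
  have "u = 0" if "(mat 1 - map_matrix ((*) z) (cmatrix A)) *v u = 0" for u
  proof (rule ccontr)
    assume u: "u \<noteq> 0"
    have "map_matrix ((*) z) (cmatrix A) *v u = z *s (cmatrix A *v u)"
      by (simp add: vec_eq_iff matrix_vector_mult_def sum_distrib_left mult.assoc)
    then have "u = z *s (cmatrix A *v u)"
      using that by (simp add: matrix_vector_mult_diff_rdistrib)
    then have "cmatrix A *v u = (1 / z) *s u"
    proof -
      have "z \<noteq> 0" using z by auto
      then have "(1 / z) *s (z *s (cmatrix A *v u)) = cmatrix A *v u"
        by (simp add: vec_eq_iff)
      then show ?thesis by (simp only: \<open>u = z *s (cmatrix A *v u)\<close>[symmetric])
    qed
    then have "1 / z \<in> eigenvalues (cmatrix A)" using u by (auto simp: eigenvalues_def)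
    then have "0 < Re (1 / z)" using A by (simp add: positive_spectrum_def)
    moreover have "Re (1 / z) = Re z / (cmod z)\<^sup>2" by (simp add: Re_divide cmod_power2)
    moreover have "Re z / (cmod z)\<^sup>2 \<le> 0" using z by (intro divide_nonpos_nonneg) auto
    ultimately show False by linarith
  qed
  then show ?thesis
    by (simp add: invertible_left_inverse matrix_left_invertible_ker)
qed

lemma invertible_of_positive_spectrum:
  assumes A: "positive_spectrum A"
  shows "invertible A"
proof -
  have "x = 0" if x: "A *v x = 0" for x
  proof (rule ccontr)
    assume "x \<noteq> 0"
    let ?v = "\<chi> i. complex_of_real (x $ i)"
    have "cmatrix A *v ?v = 0 *s ?v"
      using x by (simp add: vec_eq_iff matrix_vector_mult_def flip: of_real_mult of_real_sum)
    moreover have "?v \<noteq> 0" using \<open>x \<noteq> 0\<close> by (simp add: vec_eq_iff)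
    ultimately have "0 \<in> eigenvalues (cmatrix A)" by (auto simp: eigenvalues_def)
    then show False using A by (auto simp: positive_spectrum_def)
  qed
  then show ?thesis by (simp add: invertible_left_inverse matrix_left_invertible_ker)
qed

text \<open>The propagation commutes with \<open>I \<otimes> J\<close>. Hence each of its eigenvalues \<open>l\<close> has an eigenvector that is
  also an eigenvector of \<open>I \<otimes> J\<close>, with an eigenvalue \<open>\<mu>\<close> such that \<open>Re \<mu> \<le> -1\<close>. On this vector the
  propagation acts as the stability matrix at \<open>z = \<mu> / \<theta>\<close>, and \<open>Re z \<le> - 1 / \<theta> \<le> - D\<close>. For \<open>\<theta> = 0\<close> it
  acts as the stability matrix at infinity.\<close>

lemma propagation_eigenvalue:
  fixes A :: "real^'s^'s" and J :: "real^'m^'m" and U :: "real^'r^'s"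
  assumes A: "positive_spectrum A" and J: "dissipative J" and \<theta>: "0 \<le> \<theta>" "\<theta> * D \<le> 1"
    and inf: "spectral_radius (cmatrix (stab_matrix_inf A U B V)) < 1"
    and rho: "\<alpha> < 1" "\<And>\<mu>. Re \<mu> \<le> - D \<Longrightarrow> spectral_radius (stab_matrix A U B V \<mu>) \<le> \<alpha>"
    and v: "v \<noteq> 0"
    and eig: "map_prod (propagation \<theta> J A U B V) (propagation \<theta> J A U B V) v = cscale l v"
  shows "cmod l < 1"
proof -
  let ?M = "propagation \<theta> J A U B V" and ?S = "stage_response \<theta> J A U" and ?T = "stage_map J"
  note linM = linear_propagation[OF A J \<theta>(1), of U B V] and linT = linear_stage_map[of J]
    and linS = linear_stage_response[OF A J \<theta>(1), of U]
  have comm: "?M (stage_map J \<zeta>) = stage_map J (?M \<zeta>)" for \<zeta>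
    unfolding propagation_def stage_response_stage_map[OF A J \<theta>(1)]
    by (simp add: linear_add[OF linT] stage_map_matrix_mult)
  have "\<exists>w\<in>{v. map_prod ?M ?M v = cscale l v}. w \<noteq> 0 \<and> (\<exists>a. map_prod ?T ?T w = cscale a w)"
  proof (rule invariant_subspace_eigenvector[OF linT])
    show "v \<in> {v. map_prod ?M ?M v = cscale l v}" using eig by simp
  next
    fix v w assume "v \<in> {v. map_prod ?M ?M v = cscale l v}" "w \<in> {v. map_prod ?M ?M v = cscale l v}"
    then show "v + w \<in> {v. map_prod ?M ?M v = cscale l v}"
      by (simp add: map_prod_add[OF linM] cscale_algebra(1))
  next
    fix c v assume "v \<in> {v. map_prod ?M ?M v = cscale l v}"
    then show "cscale c v \<in> {v. map_prod ?M ?M v = cscale l v}"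
      by (simp add: map_prod_cscale[OF linM] mult.commute flip: cscale_algebra(3))
  next
    fix v assume "v \<in> {v. map_prod ?M ?M v = cscale l v}"
    then have "map_prod ?T ?T (map_prod ?M ?M v) = cscale l (map_prod ?T ?T v)"
      by (simp add: map_prod_cscale[OF linT])
    then show "map_prod ?T ?T v \<in> {v. map_prod ?M ?M v = cscale l v}"
      by (simp add: comm map_prod_def split_beta)
  qed fact
  then obtain w \<mu> where w: "map_prod ?M ?M w = cscale l w" "w \<noteq> 0" "map_prod ?T ?T w = cscale \<mu> w"
    by blast
  have \<mu>: "Re \<mu> \<le> - 1" by (rule dissipative_eigenvalue[OF J w(2,3)])
  define g where "g = map_prod ?S ?S w"
  have Tg: "map_prod ?T ?T g = cscale \<mu> g"
  proof -
    have "map_prod ?T ?T g = map_prod ?S ?S (map_prod ?T ?T w)"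
      by (simp add: g_def prod_eq_iff stage_response_stage_map[OF A J \<theta>(1)])
    then show ?thesis unfolding w(3) g_def by (simp add: map_prod_cscale[OF linS])
  qed
  have "\<theta> *\<^sub>R g = map_prod ?T ?T (map_prod ((**) A) ((**) A) g + map_prod ((**) U) ((**) U) w)"
    unfolding g_def using stage_response_eq[OF A J \<theta>(1), of U] by (simp add: prod_eq_iff)
  also have "\<dots> = map_prod ((**) A) ((**) A) (map_prod ?T ?T g) + map_prod ((**) U) ((**) U) (map_prod ?T ?T w)"
    by (simp add: prod_eq_iff linear_add[OF linear_stage_map] stage_map_matrix_mult)
  also have "\<dots> = cscale \<mu> (map_prod ((**) A) ((**) A) g + map_prod ((**) U) ((**) U) w)"
    unfolding Tg w(3) by (simp add: cscale_algebra map_prod_cscale[OF linear_matrix_mult])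
  finally have g: "\<theta> *\<^sub>R g = cscale \<mu> (map_prod ((**) A) ((**) A) g + map_prod ((**) U) ((**) U) w)" .
  have lw: "cscale l w = map_prod ((**) V) ((**) V) w + map_prod ((**) B) ((**) B) g"
    unfolding w(1)[symmetric] g_def by (simp add: prod_eq_iff propagation_def)
  obtain j where j: "complex_column j w \<noteq> 0" using complex_column_nonzero[OF w(2)] by blast
  define x where "x = complex_column j w"
  define y where "y = complex_column j g"
  have lx: "l *s x = cmatrix V *v x + cmatrix B *v y"
    using arg_cong[OF lw, of "complex_column j"]
    by (simp add: complex_column_cscale complex_column_add complex_column_matrix_mult x_def y_def)
  have y: "complex_of_real \<theta> *s y = \<mu> *s (cmatrix A *v y + cmatrix U *v x)"
    using arg_cong[OF g, of "complex_column j"]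
    by (simp add: complex_column_cscale complex_column_add complex_column_matrix_mult
        complex_column_scaleR x_def y_def)
  show ?thesis
  proof (cases "\<theta> = 0")
    case True
    have neg: "N *v (- u) = - (N *v u)" for N :: "complex^'a^'b" and u
      by (simp add: vec_eq_iff matrix_vector_mult_def sum_negf)
    have "\<mu> \<noteq> 0" using \<mu> by auto
    then have *: "cmatrix A *v y = - (cmatrix U *v x)"
    proof -
      have "\<mu> *s (cmatrix A *v y + cmatrix U *v x) = 0" using y True by simp
      then have "cmatrix A *v y + cmatrix U *v x = 0" using \<open>\<mu> \<noteq> 0\<close> by (simp only: vector_mul_eq_0) simp
      then show ?thesis by (simp only: eq_neg_iff_add_eq_0)
    qed
    have inv: "cmatrix (matrix_inv A) ** cmatrix A = mat 1"
    proof -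
      have "matrix_inv A ** A = mat 1"
        using matrix_inv_left_of_invertible[OF invertible_of_positive_spectrum[OF A]] by simp
      then have "cmatrix (matrix_inv A ** A) = cmatrix (mat 1)" by simp
      then show ?thesis
        by (simp add: vec_eq_iff matrix_matrix_mult_def mat_def if_distrib cong: if_cong)
    qed
    have "y = (cmatrix (matrix_inv A) ** cmatrix A) *v y" by (simp add: inv)
    also have "\<dots> = - (cmatrix (matrix_inv A) *v (cmatrix U *v x))"
      by (simp add: * neg flip: matrix_vector_mul_assoc)
    finally have "l *s x = cmatrix V *v x - cmatrix B *v (cmatrix (matrix_inv A) *v (cmatrix U *v x))"
      using lx by (simp add: neg)
    also have "\<dots> = cmatrix (stab_matrix_inf A U B V) *v x"
    proof -
      have "cmatrix (stab_matrix_inf A U B V) = cmatrix V - cmatrix B ** cmatrix (matrix_inv A) ** cmatrix U"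
        by (simp add: stab_matrix_inf_def vec_eq_iff matrix_matrix_mult_def)
      then show ?thesis
        by (simp add: matrix_vector_mult_diff_rdistrib matrix_vector_mul_assoc matrix_mul_assoc)
    qed
    finally have "l \<in> eigenvalues (cmatrix (stab_matrix_inf A U B V))"
      using j by (auto simp: eigenvalues_def x_def)
    then show ?thesis using eigenvalue_le_spectral_radius inf by fastforce
  next
    case False
    define z where "z = \<mu> / complex_of_real \<theta>"
    have Rez: "Re z \<le> - D"
    proof -
      have "Re z = Re \<mu> / \<theta>" by (simp add: z_def)
      also have "\<dots> \<le> - 1 / \<theta>" using \<mu> \<theta> by (intro divide_right_mono) auto
      also have "\<dots> \<le> - D" using \<theta> False by (simp add: field_simps)
      finally show ?thesis .
    qed
    have Rez0: "Re z < 0" using \<mu> \<theta> False by (simp add: z_def divide_less_0_iff)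
    let ?R = "mat 1 - map_matrix ((*) z) (cmatrix A)"
    have zA: "map_matrix ((*) z) N *v u = z *s (N *v u)" for N :: "complex^'a^'b" and u
      by (simp add: vec_eq_iff matrix_vector_mult_def sum_distrib_left mult.assoc)
    have "y = z *s (cmatrix A *v y + cmatrix U *v x)"
      using y False by (simp add: z_def vec_eq_iff field_simps)
    then have "y - z *s (cmatrix A *v y) = z *s (cmatrix U *v x)"
      by (simp only: vec.scale_right_distrib diff_eq_eq add.commute)
    then have "?R *v y = z *s (cmatrix U *v x)"
      by (simp only: matrix_vector_mult_diff_rdistrib zA matrix_vector_mul_lid)
    then have "matrix_inv ?R *v (?R *v y) = matrix_inv ?R *v (z *s (cmatrix U *v x))" by simp
    then have "y = z *s (matrix_inv ?R *v (cmatrix U *v x))"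
      using matrix_inv_left_of_invertible[OF one_minus_scaled_invertible[OF A Rez0]]
      by (simp add: matrix_vector_mul_assoc vec.scale)
    then have "l *s x = stab_matrix A U B V z *v x"
      using lx unfolding stab_matrix_def matrix_vector_mult_add_rdistrib zA
      by (simp add: vec.scale flip: matrix_vector_mul_assoc)
    then have "l \<in> eigenvalues (stab_matrix A U B V z)"
      using j by (auto simp: eigenvalues_def x_def)
    then show ?thesis using eigenvalue_le_spectral_radius rho Rez by (meson le_less_trans order_trans)
  qed
qed

lemma propagation_contracts:
  fixes A :: "real^'s^'s" and J :: "real^'m^'m" and U :: "real^'r^'s"
  assumes "positive_spectrum A" "dissipative J" "0 \<le> \<theta>" "\<theta> * D \<le> 1"
    and "spectral_radius (cmatrix (stab_matrix_inf A U B V)) < 1"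
    and "\<alpha> < 1" "\<And>\<mu>. Re \<mu> \<le> - D \<Longrightarrow> spectral_radius (stab_matrix A U B V \<mu>) \<le> \<alpha>"
  shows "\<exists>k\<ge>1. \<forall>\<zeta>. norm ((propagation \<theta> J A U B V ^^ k) \<zeta>) \<le> 1 / 4 * norm \<zeta>"
proof (rule some_power_contracts[OF linear_propagation[OF assms(1-3)]])
  fix a v
  assume v: "v \<noteq> 0" "map_prod (propagation \<theta> J A U B V) (propagation \<theta> J A U B V) v = cscale a v"
  show "cmod a < 1"
    by (rule propagation_eigenvalue[OF assms(1-6) _ v]) (rule assms(7))
qed simp

section \<open>Bounds for derivatives uniform in the stiffness\<close>

lemma higher_differentiable_on_cong:
  assumes "open S" "\<And>x. x \<in> S \<Longrightarrow> F x = G x" "higher_differentiable_on S F n"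
  shows "higher_differentiable_on S G n"
  using assms(2,3)
proof (induction n arbitrary: F G)
  case 0
  then show ?case by (simp cong: continuous_on_cong)
next
  case (Suc n)
  have diff: "F differentiable (at x)" if "x \<in> S" for x using Suc.prems(2) that by simp
  have der: "(G has_derivative frechet_derivative F (at x)) (at x)" if "x \<in> S" for x
    by (rule has_derivative_transform_within_open[OF _ assms(1) that Suc.prems(1)])
      (use diff[OF that] in \<open>simp_all add: frechet_derivative_works\<close>)
  have fd: "frechet_derivative G (at x) = frechet_derivative F (at x)" if "x \<in> S" for x
    using frechet_derivative_at[OF der[OF that]] by simp
  have "higher_differentiable_on S (\<lambda>x. frechet_derivative G (at x) v) n" for v
    by (rule Suc.IH[of "\<lambda>x. frechet_derivative F (at x) v"]) (use fd Suc.prems(2) in auto)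
  moreover have "G differentiable (at x)" if "x \<in> S" for x
    using der[OF that] by (auto simp: differentiable_def)
  ultimately show ?case by simp
qed

lemma smooth_on_cong:
  assumes "open S" "\<And>x. x \<in> S \<Longrightarrow> F x = G x" "smooth_on S F"
  shows "smooth_on S G"
  using assms higher_differentiable_on_cong unfolding smooth_on_def by blast

lemma smooth_on_directional: "smooth_on S F \<Longrightarrow> smooth_on S (\<lambda>x. frechet_derivative F (at x) v)"
  unfolding smooth_on_def using higher_differentiable_on.simps(2) by blast

lemma smooth_on_differentiable: "smooth_on S F \<Longrightarrow> x \<in> S \<Longrightarrow> F differentiable (at x)"
  unfolding smooth_on_def by (auto dest: spec[of _ "Suc 0"])

lemma smooth_on_continuous: "smooth_on S F \<Longrightarrow> continuous_on S F"
  unfolding smooth_on_def by (auto dest: spec[of _ "0"])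

lemma nderiv_0 [simp]: "nderiv 0 y = y"
  by (simp add: nderiv_def)

lemma nderiv_Suc: "nderiv (Suc k) y t = vector_derivative (nderiv k y) (at t)"
  by (simp add: nderiv_def)

text \<open>For functions of a real variable the directional derivative along \<open>1\<close> is the vector derivative.\<close>

lemma smooth_on_nderiv:
  fixes y :: "real \<Rightarrow> 'a::real_normed_vector"
  assumes "open S" "smooth_on S y"
  shows "smooth_on S (nderiv k y)"
proof (induction k)
  case (Suc k)
  have "frechet_derivative (nderiv k y) (at t) 1 = nderiv (Suc k) y t" if "t \<in> S" for t
    using smooth_on_differentiable[OF Suc that]
    by (simp add: nderiv_Suc frechet_derivative_eq_vector_derivative)
  then show ?case by (rule smooth_on_cong[OF assms(1) _ smooth_on_directional[OF Suc]])
qed (simp add: assms)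

lemma nderiv_has_vector_derivative:
  fixes y :: "real \<Rightarrow> 'a::real_normed_vector"
  assumes "open S" "smooth_on S y" "t \<in> S"
  shows "(nderiv k y has_vector_derivative nderiv (Suc k) y t) (at t)"
  unfolding nderiv_Suc using smooth_on_differentiable[OF smooth_on_nderiv[OF assms(1,2)] assms(3)]
  by (simp add: vector_derivative_works)

text \<open>Families of functions of \<open>t\<close>, indexed by \<open>\<epsilon> \<in> E\<close>, that have \<open>n\<close> derivatives, all growing at most like some
  power of \<open>1 / \<epsilon>\<close>. The exponents stay unspecified: any power is good enough for the interpolation
  against an asymptotic expansion of arbitrarily high order.\<close>

fun tempered :: "real set \<Rightarrow> real set \<Rightarrow> nat \<Rightarrow> (real \<Rightarrow> real \<Rightarrow> 'a::real_normed_vector) \<Rightarrow> bool" where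
  "tempered E S 0 \<phi> \<longleftrightarrow> (\<exists>C m. \<forall>\<epsilon>\<in>E. \<forall>t\<in>S. norm (\<phi> \<epsilon> t) \<le> C / \<epsilon> ^ m)"
| "tempered E S (Suc n) \<phi> \<longleftrightarrow> tempered E S 0 \<phi> \<and>
     (\<exists>\<phi>'. (\<forall>\<epsilon>\<in>E. \<forall>t\<in>S. (\<phi> \<epsilon> has_vector_derivative \<phi>' \<epsilon> t) (at t)) \<and> tempered E S n \<phi>')"

lemma tempered_0: "tempered E S n \<phi> \<Longrightarrow> tempered E S 0 \<phi>"
  by (cases n) auto

lemma tempered_cong:
  assumes "open S" "\<And>\<epsilon> t. \<epsilon> \<in> E \<Longrightarrow> t \<in> S \<Longrightarrow> \<phi> \<epsilon> t = \<psi> \<epsilon> t" "tempered E S n \<phi>"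
  shows "tempered E S n \<psi>"
proof -
  have 0: "tempered E S 0 \<psi>" using tempered_0[OF assms(3)] assms(2) by simp
  show ?thesis
  proof (cases n)
    case (Suc n')
    then obtain \<phi>' where \<phi>': "\<forall>\<epsilon>\<in>E. \<forall>t\<in>S. (\<phi> \<epsilon> has_vector_derivative \<phi>' \<epsilon> t) (at t)"
      "tempered E S n' \<phi>'" using assms(3) by auto
    have "(\<psi> \<epsilon> has_vector_derivative \<phi>' \<epsilon> t) (at t)" if "\<epsilon> \<in> E" "t \<in> S" for \<epsilon> t
      by (rule has_vector_derivative_transform_within_open[OF \<phi>'(1)[rule_format, OF that] assms(1) that(2)])
        (rule assms(2)[OF that(1)])
    then show ?thesis using 0 \<phi>'(2) Suc by auto
  qed (use 0 in simp)
qed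

lemma tempered_SucD: "tempered E S (Suc n) \<phi> \<Longrightarrow> tempered E S n \<phi>"
proof (induction n arbitrary: \<phi>)
  case (Suc n)
  then obtain \<phi>' where "\<forall>\<epsilon>\<in>E. \<forall>t\<in>S. (\<phi> \<epsilon> has_vector_derivative \<phi>' \<epsilon> t) (at t)"
    "tempered E S (Suc n) \<phi>'" "tempered E S 0 \<phi>" by (metis tempered.simps(2))
  then show ?case using Suc.IH by (metis tempered.simps(2))
qed simp

lemma tempered_bounded:
  assumes "\<And>\<epsilon> t. \<epsilon> \<in> E \<Longrightarrow> t \<in> S \<Longrightarrow> norm (\<phi> \<epsilon> t) \<le> C"
  shows "tempered E S 0 \<phi>"
  using assms by (simp only: tempered.simps) (rule exI[of _ C], rule exI[of _ 0], simp)

lemma tempered_const: "tempered E S n (\<lambda>\<epsilon> t. c)"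
proof (induction n arbitrary: c)
  case 0
  then show ?case using tempered_bounded[of E S "\<lambda>_ _. c" "norm c"] by simp
next
  case (Suc n)
  have "tempered E S 0 (\<lambda>\<epsilon> t. c)" using tempered_bounded[of E S "\<lambda>_ _. c" "norm c"] by simp
  then show ?case using Suc[of 0] by (auto intro!: exI[of _ "\<lambda>_ _. 0"] simp del: tempered.simps(1))
qed

lemma tempered_inverse:
  assumes "E \<subseteq> {0<..1}"
  shows "tempered E S n (\<lambda>\<epsilon> t. 1 / \<epsilon>)"
proof -
  have "tempered E S 0 (\<lambda>\<epsilon> t. 1 / \<epsilon>)" using assms by (auto intro!: exI[of _ 1] exI[of _ 1])
  then show ?thesis
    by (cases n) (auto intro!: exI[of _ "\<lambda>_ _. 0"] tempered_const simp del: tempered.simps(1))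
qed

text \<open>A larger exponent weakens the bound, since \<open>\<epsilon> \<le> 1\<close>; this brings two bounds to a common
  exponent.\<close>

lemma divide_power_weaken:
  fixes \<epsilon> :: real
  assumes "0 < \<epsilon>" "\<epsilon> \<le> 1" "m \<le> n"
  shows "C / \<epsilon> ^ m \<le> \<bar>C\<bar> / \<epsilon> ^ n"
proof -
  have "C / \<epsilon> ^ m \<le> \<bar>C\<bar> / \<epsilon> ^ m" using assms by (intro divide_right_mono) auto
  also have "\<dots> \<le> \<bar>C\<bar> / \<epsilon> ^ n" using assms
    by (intro divide_left_mono power_decreasing mult_pos_pos zero_less_power) auto
  finally show ?thesis .
qed

lemma tempered_0_add:
  assumes "E \<subseteq> {0<..1}" "tempered E S 0 \<phi>" "tempered E S 0 \<psi>"
  shows "tempered E S 0 (\<lambda>\<epsilon> t. \<phi> \<epsilon> t + \<psi> \<epsilon> t)"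
proof -
  obtain C m C' m' where
    b: "\<And>\<epsilon> t. \<epsilon> \<in> E \<Longrightarrow> t \<in> S \<Longrightarrow> norm (\<phi> \<epsilon> t) \<le> C / \<epsilon> ^ m"
      "\<And>\<epsilon> t. \<epsilon> \<in> E \<Longrightarrow> t \<in> S \<Longrightarrow> norm (\<psi> \<epsilon> t) \<le> C' / \<epsilon> ^ m'"
    using assms(2,3) by force
  have "norm (\<phi> \<epsilon> t + \<psi> \<epsilon> t) \<le> (\<bar>C\<bar> + \<bar>C'\<bar>) / \<epsilon> ^ (m + m')" if "\<epsilon> \<in> E" "t \<in> S" for \<epsilon> t
  proof -
    have "norm (\<phi> \<epsilon> t + \<psi> \<epsilon> t) \<le> C / \<epsilon> ^ m + C' / \<epsilon> ^ m'"
      using b[OF that] by (meson add_mono norm_triangle_le)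
    also have "\<dots> \<le> \<bar>C\<bar> / \<epsilon> ^ (m + m') + \<bar>C'\<bar> / \<epsilon> ^ (m + m')"
      using that assms(1) by (intro add_mono divide_power_weaken) auto
    finally show ?thesis by (simp add: add_divide_distrib)
  qed
  then show ?thesis by auto
qed

lemma tempered_0_scaleR:
  assumes "tempered E S 0 \<phi>" "tempered E S 0 \<psi>"
  shows "tempered E S 0 (\<lambda>\<epsilon> t. (\<phi> \<epsilon> t :: real) *\<^sub>R \<psi> \<epsilon> t)"
proof -
  obtain C m C' m' where
    b: "\<And>\<epsilon> t. \<epsilon> \<in> E \<Longrightarrow> t \<in> S \<Longrightarrow> norm (\<phi> \<epsilon> t) \<le> C / \<epsilon> ^ m"
      "\<And>\<epsilon> t. \<epsilon> \<in> E \<Longrightarrow> t \<in> S \<Longrightarrow> norm (\<psi> \<epsilon> t) \<le> C' / \<epsilon> ^ m'"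
    using assms by force
  have "norm (\<phi> \<epsilon> t *\<^sub>R \<psi> \<epsilon> t) \<le> (C * C') / \<epsilon> ^ (m + m')" if "\<epsilon> \<in> E" "t \<in> S" for \<epsilon> t
    using mult_mono[OF b[OF that]] order_trans[OF norm_ge_zero b(1)[OF that]]
    by (simp add: power_add)
  then show ?thesis by auto
qed

lemma tempered_SucI:
  assumes "tempered E S 0 \<phi>"
    and "\<And>\<epsilon> t. \<epsilon> \<in> E \<Longrightarrow> t \<in> S \<Longrightarrow> (\<phi> \<epsilon> has_vector_derivative \<phi>' \<epsilon> t) (at t)"
    and "tempered E S n \<phi>'"
  shows "tempered E S (Suc n) \<phi>"
  using assms by (simp only: tempered.simps(2)) blast

lemma tempered_SucE:
  assumes "tempered E S (Suc n) \<phi>"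
  obtains \<phi>' where "\<And>\<epsilon> t. \<epsilon> \<in> E \<Longrightarrow> t \<in> S \<Longrightarrow> (\<phi> \<epsilon> has_vector_derivative \<phi>' \<epsilon> t) (at t)"
    "tempered E S n \<phi>'"
  using assms by (auto simp del: tempered.simps(1))

lemma tempered_add:
  assumes "E \<subseteq> {0<..1}"
  shows "tempered E S n \<phi> \<Longrightarrow> tempered E S n \<psi> \<Longrightarrow> tempered E S n (\<lambda>\<epsilon> t. \<phi> \<epsilon> t + \<psi> \<epsilon> t)"
proof (induction n arbitrary: \<phi> \<psi>)
  case (Suc n)
  obtain \<phi>' where \<phi>': "\<And>\<epsilon> t. \<epsilon> \<in> E \<Longrightarrow> t \<in> S \<Longrightarrow> (\<phi> \<epsilon> has_vector_derivative \<phi>' \<epsilon> t) (at t)"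
    "tempered E S n \<phi>'" by (rule tempered_SucE[OF Suc.prems(1)]) blast
  obtain \<psi>' where \<psi>': "\<And>\<epsilon> t. \<epsilon> \<in> E \<Longrightarrow> t \<in> S \<Longrightarrow> (\<psi> \<epsilon> has_vector_derivative \<psi>' \<epsilon> t) (at t)"
    "tempered E S n \<psi>'" by (rule tempered_SucE[OF Suc.prems(2)]) blast
  show ?case
    by (rule tempered_SucI[where \<phi>' = "\<lambda>\<epsilon> t. \<phi>' \<epsilon> t + \<psi>' \<epsilon> t"])
      (intro tempered_0_add[OF assms] tempered_0[OF Suc.prems(1)] tempered_0[OF Suc.prems(2)]
        has_vector_derivative_add \<phi>' \<psi>' Suc.IH; assumption)+
qed (rule tempered_0_add[OF assms])

lemma tempered_scaleR:
  assumes "E \<subseteq> {0<..1}"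
  shows "tempered E S n \<phi> \<Longrightarrow> tempered E S n \<psi> \<Longrightarrow> tempered E S n (\<lambda>\<epsilon> t. (\<phi> \<epsilon> t :: real) *\<^sub>R \<psi> \<epsilon> t)"
proof (induction n arbitrary: \<phi> \<psi>)
  case (Suc n)
  obtain \<phi>' where \<phi>': "\<And>\<epsilon> t. \<epsilon> \<in> E \<Longrightarrow> t \<in> S \<Longrightarrow> (\<phi> \<epsilon> has_vector_derivative \<phi>' \<epsilon> t) (at t)"
    "tempered E S n \<phi>'" by (rule tempered_SucE[OF Suc.prems(1)]) blast
  obtain \<psi>' where \<psi>': "\<And>\<epsilon> t. \<epsilon> \<in> E \<Longrightarrow> t \<in> S \<Longrightarrow> (\<psi> \<epsilon> has_vector_derivative \<psi>' \<epsilon> t) (at t)"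
    "tempered E S n \<psi>'" by (rule tempered_SucE[OF Suc.prems(2)]) blast
  show ?case
  proof (rule tempered_SucI[where \<phi>' = "\<lambda>\<epsilon> t. \<phi> \<epsilon> t *\<^sub>R \<psi>' \<epsilon> t + \<phi>' \<epsilon> t *\<^sub>R \<psi> \<epsilon> t"])
    show "tempered E S 0 (\<lambda>\<epsilon> t. \<phi> \<epsilon> t *\<^sub>R \<psi> \<epsilon> t)"
      by (rule tempered_0_scaleR[OF tempered_0[OF Suc.prems(1)] tempered_0[OF Suc.prems(2)]])
    show "((\<lambda>t. \<phi> \<epsilon> t *\<^sub>R \<psi> \<epsilon> t) has_vector_derivative \<phi> \<epsilon> t *\<^sub>R \<psi>' \<epsilon> t + \<phi>' \<epsilon> t *\<^sub>R \<psi> \<epsilon> t) (at t)"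
      if "\<epsilon> \<in> E" "t \<in> S" for \<epsilon> t
      using \<phi>'(1)[OF that] \<psi>'(1)[OF that]
      by (intro has_vector_derivative_scaleR) (simp add: has_real_derivative_iff_has_vector_derivative)
    show "tempered E S n (\<lambda>\<epsilon> t. \<phi> \<epsilon> t *\<^sub>R \<psi>' \<epsilon> t + \<phi>' \<epsilon> t *\<^sub>R \<psi> \<epsilon> t)"
      by (rule tempered_add[OF assms Suc.IH[OF tempered_SucD[OF Suc.prems(1)] \<psi>'(2)]
            Suc.IH[OF \<phi>'(2) tempered_SucD[OF Suc.prems(2)]]])
  qed
qed (rule tempered_0_scaleR)

lemma tempered_sum:
  assumes "E \<subseteq> {0<..1}" "finite I" "\<And>i. i \<in> I \<Longrightarrow> tempered E S n (\<phi> i)"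
  shows "tempered E S n (\<lambda>\<epsilon> t. \<Sum>i\<in>I. \<phi> i \<epsilon> t)"
  using assms(2,3) by (induction I) (simp_all add: tempered_const tempered_add[OF assms(1)] del: tempered.simps)

lemma tempered_linear:
  assumes "bounded_linear L"
  shows "tempered E S n \<phi> \<Longrightarrow> tempered E S n (\<lambda>\<epsilon> t. L (\<phi> \<epsilon> t))"
proof (induction n arbitrary: \<phi>)
  case 0
  obtain K where K: "\<And>x. norm (L x) \<le> norm x * K" "K > 0"
    using bounded_linear.pos_bounded[OF assms] by blast
  obtain C m where b: "\<And>\<epsilon> t. \<epsilon> \<in> E \<Longrightarrow> t \<in> S \<Longrightarrow> norm (\<phi> \<epsilon> t) \<le> C / \<epsilon> ^ m"
    using 0 by auto
  have "norm (L (\<phi> \<epsilon> t)) \<le> (C * K) / \<epsilon> ^ m" if "\<epsilon> \<in> E" "t \<in> S" for \<epsilon> t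
    using order_trans[OF K(1) mult_right_mono[OF b[OF that] less_imp_le[OF K(2)]]] by simp
  then show ?case by auto
next
  case (Suc n)
  obtain \<phi>' where \<phi>': "\<And>\<epsilon> t. \<epsilon> \<in> E \<Longrightarrow> t \<in> S \<Longrightarrow> (\<phi> \<epsilon> has_vector_derivative \<phi>' \<epsilon> t) (at t)"
    "tempered E S n \<phi>'" by (rule tempered_SucE[OF Suc.prems]) blast
  have "tempered E S 0 (\<lambda>\<epsilon> t. L (\<phi> \<epsilon> t))"
    using tempered_0[OF Suc.IH[OF tempered_SucD[OF Suc.prems]]] .
  then show ?case
    by (rule tempered_SucI[where \<phi>' = "\<lambda>\<epsilon> t. L (\<phi>' \<epsilon> t)"])
      (intro bounded_linear.has_vector_derivative[OF assms] \<phi>' Suc.IH; assumption)+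
qed

text \<open>The time derivative of \<open>\<psi>\<close> along a solution is a sum of products of directional derivatives of \<open>\<psi>\<close>
  with components of \<open>f\<close> and \<open>g / \<epsilon>\<close>. All these factors are smooth functions along the solution, up to
  \<open>1 / \<epsilon>\<close>, so an induction over the number of derivatives for all smooth \<open>\<psi>\<close> at once goes through.\<close>

lemma tempered_along_solution:
  fixes f g :: "'a::euclidean_space \<times> 'a \<Rightarrow> 'a" and x z :: "real \<Rightarrow> real \<Rightarrow> 'a"
    and \<psi> :: "'a \<times> 'a \<Rightarrow> 'a"
  assumes E: "E \<subseteq> {0<..1}" and fg: "smooth_on \<Omega> f" "smooth_on \<Omega> g"
    and K: "compact K" "K \<subseteq> \<Omega>" "\<And>\<epsilon> t. \<epsilon> \<in> E \<Longrightarrow> t \<in> S \<Longrightarrow> (x \<epsilon> t, z \<epsilon> t) \<in> K"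
    and x: "\<And>\<epsilon> t. \<epsilon> \<in> E \<Longrightarrow> t \<in> S \<Longrightarrow> (x \<epsilon> has_vector_derivative f (x \<epsilon> t, z \<epsilon> t)) (at t)"
    and z: "\<And>\<epsilon> t. \<epsilon> \<in> E \<Longrightarrow> t \<in> S \<Longrightarrow> (z \<epsilon> has_vector_derivative (1 / \<epsilon>) *\<^sub>R g (x \<epsilon> t, z \<epsilon> t)) (at t)"
    and \<psi>: "smooth_on \<Omega> \<psi>"
  shows "tempered E S n (\<lambda>\<epsilon> t. \<psi> (x \<epsilon> t, z \<epsilon> t))"
proof -
  have base: "tempered E S 0 (\<lambda>\<epsilon> t. \<kappa> (x \<epsilon> t, z \<epsilon> t))" if "smooth_on \<Omega> \<kappa>"
    for \<kappa> :: "'a \<times> 'a \<Rightarrow> 'a"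
  proof -
    have "compact (\<kappa> ` K)"
      using smooth_on_continuous[OF that] K by (meson compact_continuous_image continuous_on_subset)
    then obtain C where "\<And>w. w \<in> \<kappa> ` K \<Longrightarrow> norm w \<le> C" using compact_imp_bounded bounded_iff by metis
    then show ?thesis using K(3) by (intro tempered_bounded) blast
  qed
  let ?der = "\<lambda>\<kappa>. \<lambda>\<epsilon> t. \<Sum>b\<in>Basis.
      (f (x \<epsilon> t, z \<epsilon> t) \<bullet> fst b + (1 / \<epsilon>) *\<^sub>R (g (x \<epsilon> t, z \<epsilon> t) \<bullet> snd b))
         *\<^sub>R frechet_derivative \<kappa> (at (x \<epsilon> t, z \<epsilon> t)) b"
  have der: "((\<lambda>t. \<kappa> (x \<epsilon> t, z \<epsilon> t)) has_vector_derivative ?der \<kappa> \<epsilon> t) (at t)"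
    if \<kappa>: "smooth_on \<Omega> \<kappa>" and t: "\<epsilon> \<in> E" "t \<in> S"
    for \<kappa> :: "'a \<times> 'a \<Rightarrow> 'a" and \<epsilon> t
  proof -
    let ?u = "(x \<epsilon> t, z \<epsilon> t)" let ?v = "(f ?u, (1 / \<epsilon>) *\<^sub>R g ?u)"
    let ?L = "frechet_derivative \<kappa> (at ?u)"
    have L: "(\<kappa> has_derivative ?L) (at ?u)"
      using smooth_on_differentiable[OF \<kappa>] K t by (meson frechet_derivative_works subsetD)
    have lin: "linear ?L" using L has_derivative_linear by blast
    have "((\<lambda>t. (x \<epsilon> t, z \<epsilon> t)) has_vector_derivative ?v) (at t)"
      by (rule has_vector_derivative_Pair[OF x[OF t] z[OF t]])
    then have "((\<lambda>t. \<kappa> (x \<epsilon> t, z \<epsilon> t)) has_vector_derivative ?L ?v) (at t)"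
      using vector_derivative_diff_chain_within[of "\<lambda>t. (x \<epsilon> t, z \<epsilon> t)" ?v t UNIV \<kappa> ?L]
        has_derivative_at_withinI[OF L]
      by (simp add: o_def)
    also have "?L ?v = ?L (\<Sum>b\<in>Basis. (?v \<bullet> b) *\<^sub>R b)" by (simp only: euclidean_representation)
    also have "\<dots> = ?der \<kappa> \<epsilon> t"
      by (simp add: linear_sum[OF lin] linear_scale[OF lin] inner_prod_def del: sum_Basis_prod_eq)
    finally show ?thesis .
  qed
  have "\<forall>\<kappa>::'a \<times> 'a \<Rightarrow> 'a. smooth_on \<Omega> \<kappa> \<longrightarrow> tempered E S n (\<lambda>\<epsilon> t. \<kappa> (x \<epsilon> t, z \<epsilon> t))" for n
  proof (induction n)
    case (Suc n)
    show ?case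
    proof (intro allI impI)
      fix \<kappa> :: "'a \<times> 'a \<Rightarrow> 'a" assume \<kappa>: "smooth_on \<Omega> \<kappa>"
      have inner: "tempered E S n (\<lambda>\<epsilon> t. h (x \<epsilon> t, z \<epsilon> t) \<bullet> b)" if "smooth_on \<Omega> h" for h :: "'a \<times> 'a \<Rightarrow> 'a" and b
        using tempered_linear[OF bounded_linear_inner_left] Suc that by blast
      show "tempered E S (Suc n) (\<lambda>\<epsilon> t. \<kappa> (x \<epsilon> t, z \<epsilon> t))"
        by (rule tempered_SucI[OF base[OF \<kappa>] der[OF \<kappa>]], assumption, assumption)
          (intro tempered_sum tempered_scaleR tempered_add tempered_inverse E finite_Basis
            inner fg Suc[rule_format] smooth_on_directional \<kappa>)
    qed
  qed (use base in blast)
  then show ?thesis using \<psi> by blast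
qed

lemma tempered_nderiv:
  assumes S: "open S" and \<phi>: "\<And>n. tempered E S n \<phi>"
  shows "tempered E S n (\<lambda>\<epsilon>. nderiv k (\<phi> \<epsilon>))"
    "\<epsilon> \<in> E \<Longrightarrow> t \<in> S \<Longrightarrow> (nderiv k (\<phi> \<epsilon>) has_vector_derivative nderiv (Suc k) (\<phi> \<epsilon>) t) (at t)"
proof -
  have *: "(\<forall>\<epsilon>\<in>E. \<forall>t\<in>S. (\<psi> \<epsilon> has_vector_derivative vector_derivative (\<psi> \<epsilon>) (at t)) (at t)) \<and>
      (\<forall>n. tempered E S n (\<lambda>\<epsilon> t. vector_derivative (\<psi> \<epsilon>) (at t)))"
    if \<psi>: "\<And>n. tempered E S n \<psi>" for \<psi> :: "real \<Rightarrow> real \<Rightarrow> 'a"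
  proof (intro conjI ballI allI)
    fix n
    obtain \<psi>' where \<psi>': "\<And>\<epsilon> t. \<epsilon> \<in> E \<Longrightarrow> t \<in> S \<Longrightarrow> (\<psi> \<epsilon> has_vector_derivative \<psi>' \<epsilon> t) (at t)"
      "tempered E S n \<psi>'" by (rule tempered_SucE[OF \<psi>]) blast
    show "tempered E S n (\<lambda>\<epsilon> t. vector_derivative (\<psi> \<epsilon>) (at t))"
      by (rule tempered_cong[OF S _ \<psi>'(2)]) (simp add: vector_derivative_at[OF \<psi>'(1)])
    show "(\<psi> \<epsilon> has_vector_derivative vector_derivative (\<psi> \<epsilon>) (at t)) (at t)"
      if "\<epsilon> \<in> E" "t \<in> S" for \<epsilon> t
      using \<psi>'(1)[OF that] by (simp add: vector_derivative_at)
  qed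
  have t: "\<forall>n. tempered E S n (\<lambda>\<epsilon>. nderiv k (\<phi> \<epsilon>))" for k
  proof (induction k)
    case (Suc k)
    have "nderiv (Suc k) (\<phi> \<epsilon>) = (\<lambda>t. vector_derivative (nderiv k (\<phi> \<epsilon>)) (at t))" for \<epsilon>
      by (simp add: fun_eq_iff nderiv_Suc)
    then show ?case using *[of "\<lambda>\<epsilon>. nderiv k (\<phi> \<epsilon>)"] Suc by presburger
  qed (simp add: \<phi> del: tempered.simps)
  then show "tempered E S n (\<lambda>\<epsilon>. nderiv k (\<phi> \<epsilon>))" by blast
  show "(nderiv k (\<phi> \<epsilon>) has_vector_derivative nderiv (Suc k) (\<phi> \<epsilon>) t) (at t)" if "\<epsilon> \<in> E" "t \<in> S"
    unfolding nderiv_Suc using *[of "\<lambda>\<epsilon>. nderiv k (\<phi> \<epsilon>)"] t that by blast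
qed

text \<open>The derivative of the remainder is the remainder of \<open>y'\<close> of one order less; the mean value
  inequality integrates its bound.\<close>

lemma taylor_remainder_bound:
  fixes y :: "nat \<Rightarrow> real \<Rightarrow> 'a::real_normed_vector"
  assumes S: "convex S"
    and "\<And>j t. j \<le> n \<Longrightarrow> t \<in> S \<Longrightarrow> (y j has_vector_derivative y (Suc j) t) (at t)"
    and "\<And>t. t \<in> S \<Longrightarrow> norm (y (Suc n) t) \<le> K"
    and t: "t \<in> S" "t + s \<in> S"
  shows "norm (y 0 (t + s) - (\<Sum>j\<le>n. (s ^ j / fact j) *\<^sub>R y j t)) \<le> K * \<bar>s\<bar> ^ Suc n"
  using assms(2,3) t(2)
proof (induction n arbitrary: y s)
  case 0
  have "norm (y 0 (t + s) - y 0 t) \<le> K * norm (t + s - t)"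
  proof (rule differentiable_bound[OF S])
    fix r assume r: "r \<in> S"
    show "(y 0 has_derivative (\<lambda>x. x *\<^sub>R y (Suc 0) r)) (at r within S)"
      using 0(1)[of 0 r] r by (auto simp: has_vector_derivative_def intro: has_derivative_at_withinI)
    show "onorm (\<lambda>x. x *\<^sub>R y (Suc 0) r) \<le> K"
      using 0(2)[OF r] by (intro onorm_le) (simp add: mult.commute[of K] mult_left_mono)
  qed (use t 0 in auto)
  then show ?case by simp
next
  case (Suc n)
  have K: "0 \<le> K" using Suc.prems(2)[OF t(1)] by (meson norm_ge_zero order_trans)
  let ?R = "\<lambda>r. y 0 (t + r) - (\<Sum>j\<le>Suc n. (r ^ j / fact j) *\<^sub>R y j t)"
  let ?R' = "\<lambda>r. y 1 (t + r) - (\<Sum>j\<le>n. (r ^ j / fact j) *\<^sub>R y (Suc j) t)"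
  have seg: "t + r \<in> S" if "r \<in> closed_segment 0 s" for r
  proof -
    have "closed_segment t (t + s) \<subseteq> S" using S t Suc.prems(3) by (meson convex_contains_segment)
    moreover have "t + r \<in> closed_segment t (t + s)" using that by (auto simp: in_segment algebra_simps)
    ultimately show ?thesis by blast
  qed
  have "norm (?R s - ?R 0) \<le> (K * \<bar>s\<bar> ^ Suc n) * norm (s - 0)"
  proof (rule differentiable_bound[of "closed_segment 0 s"])
    fix r assume r: "r \<in> closed_segment 0 s"
    have "((\<lambda>r. y 0 (t + r)) has_vector_derivative y 1 (t + r)) (at r)"
    proof -
      have "((\<lambda>r. t + r) has_vector_derivative 0 + 1) (at r)"
        by (intro has_vector_derivative_add has_vector_derivative_const has_vector_derivative_id)
      moreover have "(y 0 has_vector_derivative y 1 (t + r)) (at (t + r))"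
        using Suc.prems(1)[of 0] seg[OF r] by simp
      ultimately show ?thesis
        using vector_diff_chain_at[of "\<lambda>r. t + r" 1 r "y 0" "y 1 (t + r)"] by (simp add: o_def)
    qed
    moreover have "((\<lambda>r. \<Sum>j\<le>Suc n. (r ^ j / fact j) *\<^sub>R y j t)
        has_vector_derivative (\<Sum>j\<le>n. (r ^ j / fact j) *\<^sub>R y (Suc j) t)) (at r)"
    proof -
      have "((\<lambda>r. (r ^ Suc j / fact (Suc j)) *\<^sub>R y (Suc j) t)
          has_vector_derivative (r ^ j / fact j) *\<^sub>R y (Suc j) t) (at r)" for j
      proof -
        have "((\<lambda>r. r ^ Suc j / fact (Suc j)) has_real_derivative (real (Suc j) * r ^ j) / fact (Suc j)) (at r)"
          using DERIV_cdivide[OF DERIV_pow[of "Suc j" r UNIV], of "fact (Suc j)"] by simp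
        also have "(real (Suc j) * r ^ j) / fact (Suc j) = r ^ j / fact j"
          by (simp only: fact_Suc mult_divide_mult_cancel_left_if of_nat_eq_0_iff) simp
        finally show ?thesis
          by (rule has_vector_derivative_scaleR[where g' = 0, simplified, OF _ has_vector_derivative_const])
      qed
      then have "((\<lambda>r. y 0 t + (\<Sum>j\<le>n. (r ^ Suc j / fact (Suc j)) *\<^sub>R y (Suc j) t))
          has_vector_derivative 0 + (\<Sum>j\<le>n. (r ^ j / fact j) *\<^sub>R y (Suc j) t)) (at r)"
        by (intro has_vector_derivative_add has_vector_derivative_const has_vector_derivative_sum)
      then show ?thesis by (subst sum.atMost_Suc_shift) simp
    qed
    ultimately have "(?R has_vector_derivative ?R' r) (at r)" by (rule has_vector_derivative_diff)
    then show "(?R has_derivative (\<lambda>x. x *\<^sub>R ?R' r)) (at r within closed_segment 0 s)"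
      by (simp add: has_vector_derivative_def has_derivative_at_withinI)
    have "norm (?R' r) \<le> K * \<bar>r\<bar> ^ Suc n"
      using Suc.IH[of "\<lambda>j. y (Suc j)" r] Suc.prems(1,2) seg[OF r] by simp
    also have "\<dots> \<le> K * \<bar>s\<bar> ^ Suc n"
      using segment_bound(1)[OF r] K by (intro mult_left_mono power_mono) auto
    finally show "onorm (\<lambda>x. x *\<^sub>R ?R' r) \<le> K * \<bar>s\<bar> ^ Suc n"
      by (intro onorm_le) (simp add: mult.commute[of "K * _"] mult_left_mono)
  qed auto
  moreover have "?R 0 = 0" by (subst sum.atMost_Suc_shift) simp
  ultimately show ?case by (simp add: mult_ac)
qed

text \<open>Termwise differentiation of an asymptotic expansion. The difference \<open>r\<close> between \<open>y\<close> and a much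
  longer partial sum is \<open>O(\<epsilon>\<^sup>N\<^sup>'\<^sup>+\<^sup>1)\<close>, while its second derivative is only known to be \<open>O(\<epsilon>\<^sup>-\<^sup>m)\<close>. A difference
  quotient whose step is a suitable power of \<open>\<epsilon>\<close> balances the two and bounds \<open>r'\<close>. The step points
  to the middle of the interval, which therefore need not shrink.\<close>

lemma eps_expansion_derivative:
  fixes y y1 y2 :: "real \<Rightarrow> real \<Rightarrow> 'a::real_normed_vector" and yk yk1 yk2 :: "nat \<Rightarrow> real \<Rightarrow> 'a"
  assumes ab: "a < b" and e: "e \<le> 1"
    and expn: "eps_expansion e {a<..<b} y yk"
    and y: "\<And>\<epsilon> t. \<epsilon> \<in> {0<..e} \<Longrightarrow> t \<in> {a<..<b} \<Longrightarrow> (y \<epsilon> has_vector_derivative y1 \<epsilon> t) (at t)"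
      "\<And>\<epsilon> t. \<epsilon> \<in> {0<..e} \<Longrightarrow> t \<in> {a<..<b} \<Longrightarrow> (y1 \<epsilon> has_vector_derivative y2 \<epsilon> t) (at t)"
      "\<And>\<epsilon> t. \<epsilon> \<in> {0<..e} \<Longrightarrow> t \<in> {a<..<b} \<Longrightarrow> norm (y2 \<epsilon> t) \<le> C / \<epsilon> ^ m"
    and yk: "\<And>k t. t \<in> {a<..<b} \<Longrightarrow> (yk k has_vector_derivative yk1 k t) (at t)"
      "\<And>k t. t \<in> {a<..<b} \<Longrightarrow> (yk1 k has_vector_derivative yk2 k t) (at t)"
      "\<And>k t. t \<in> {a<..<b} \<Longrightarrow> norm (yk1 k t) \<le> D1 k"
      "\<And>k t. t \<in> {a<..<b} \<Longrightarrow> norm (yk2 k t) \<le> D2 k"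
  shows "eps_expansion e {a<..<b} y1 yk1"
  unfolding eps_expansion_def
proof
  fix N
  \<comment> \<open>The step of the difference quotient is of size \<open>\<epsilon>\<^sup>P\<close>. The exponents satisfy \<open>N' + 1 - P \<ge> N + 1\<close> for the
    difference of values and \<open>P - m = N + 1\<close> for the second derivative.\<close>
  define P where "P = N + 1 + m"
  define N' where "N' = 2 * N + 2 + m"
  define \<sigma> where "\<sigma> = (b - a) / 4"
  have \<sigma>: "0 < \<sigma>" using ab by (simp add: \<sigma>_def)
  obtain K where K: "\<And>\<epsilon> t. \<epsilon> \<in> {0<..e} \<Longrightarrow> t \<in> {a<..<b} \<Longrightarrow>
      norm (y \<epsilon> t - (\<Sum>k\<le>N'. \<epsilon> ^ k *\<^sub>R yk k t)) \<le> K * \<epsilon> ^ (N' + 1)"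
    using expn unfolding eps_expansion_def by blast
  have mid: "(a + b) / 2 \<in> {a<..<b}" using ab by simp
  have D1: "0 \<le> D1 k" and D2: "0 \<le> D2 k" for k
    using yk(3,4)[OF mid] norm_ge_zero order_trans by blast+
  define C2 where "C2 = \<bar>C\<bar> + (\<Sum>k\<le>N'. D2 k)"
  define K1 where "K1 = 2 * \<bar>K\<bar> / \<sigma> + C2 * \<sigma> + (\<Sum>k\<le>N'. D1 k)"
  have "norm (y1 \<epsilon> t - (\<Sum>k\<le>N. \<epsilon> ^ k *\<^sub>R yk1 k t)) \<le> K1 * \<epsilon> ^ (N + 1)"
    if \<epsilon>: "\<epsilon> \<in> {0<..e}" and t: "t \<in> {a<..<b}" for \<epsilon> t
  proof -
    have \<epsilon>01: "0 < \<epsilon>" "\<epsilon> \<le> 1" using \<epsilon> e by auto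
    define s where "s = (if t < (a + b) / 2 then \<sigma> * \<epsilon> ^ P else - (\<sigma> * \<epsilon> ^ P))"
    have abs_s: "\<bar>s\<bar> = \<sigma> * \<epsilon> ^ P" using \<sigma> \<epsilon>01 by (simp add: s_def abs_mult)
    have "\<bar>s\<bar> \<le> \<sigma>" unfolding abs_s using \<sigma> \<epsilon>01 by (simp add: mult_left_le power_le_one)
    moreover have "4 * \<sigma> = b - a" by (simp add: \<sigma>_def)
    moreover have "s = (if t < (a + b) / 2 then \<bar>s\<bar> else - \<bar>s\<bar>)" unfolding abs_s by (simp add: s_def)
    ultimately have ts: "t + s \<in> {a<..<b}"
      using t \<sigma> by (auto split: if_splits)
    define r where "r = (\<lambda>j t. (if j = 0 then y \<epsilon> t - (\<Sum>k\<le>N'. \<epsilon> ^ k *\<^sub>R yk k t)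
      else if j = (1::nat) then y1 \<epsilon> t - (\<Sum>k\<le>N'. \<epsilon> ^ k *\<^sub>R yk1 k t)
      else y2 \<epsilon> t - (\<Sum>k\<le>N'. \<epsilon> ^ k *\<^sub>R yk2 k t)))"
    have der: "((\<lambda>t. v t - (\<Sum>k\<le>N'. \<epsilon> ^ k *\<^sub>R vk k t)) has_vector_derivative
        v' - (\<Sum>k\<le>N'. \<epsilon> ^ k *\<^sub>R vk' k)) (at t)"
      if "(v has_vector_derivative v') (at t)" "\<And>k. (vk k has_vector_derivative vk' k) (at t)"
      for v :: "real \<Rightarrow> 'a" and v' vk vk' and t
      using that by (intro has_vector_derivative_diff has_vector_derivative_sum
          bounded_linear.has_vector_derivative[OF bounded_linear_scaleR_right])
    have "norm (r 0 (t + s) - (\<Sum>j\<le>1. (s ^ j / fact j) *\<^sub>R r j t)) \<le> (C2 / \<epsilon> ^ m) * \<bar>s\<bar> ^ Suc 1"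
    proof (rule taylor_remainder_bound)
      show "(r j has_vector_derivative r (Suc j) t) (at t)" if "j \<le> 1" "t \<in> {a<..<b}" for j t
        using that y(1,2)[OF \<epsilon> that(2)] yk(1,2)[OF that(2)]
        by (cases "j = 0") (auto simp: r_def intro!: der)
      show "norm (r (Suc 1) t) \<le> C2 / \<epsilon> ^ m" if t: "t \<in> {a<..<b}" for t
      proof -
        have "norm (\<Sum>k\<le>N'. \<epsilon> ^ k *\<^sub>R yk2 k t) \<le> (\<Sum>k\<le>N'. D2 k)"
        proof (rule sum_norm_le)
          fix k
          have "norm (\<epsilon> ^ k *\<^sub>R yk2 k t) = \<epsilon> ^ k * norm (yk2 k t)" using \<epsilon>01 by simp
          also have "\<dots> \<le> 1 * D2 k"
            using \<epsilon>01 yk(4)[OF t, of k] by (intro mult_mono power_le_one) auto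
          finally show "norm (\<epsilon> ^ k *\<^sub>R yk2 k t) \<le> D2 k" by simp
        qed
        moreover have "(\<Sum>k\<le>N'. D2 k) \<le> \<bar>\<Sum>k\<le>N'. D2 k\<bar> / \<epsilon> ^ m"
          using divide_power_weaken[OF \<epsilon>01, of 0 m "\<Sum>k\<le>N'. D2 k"] by simp
        moreover have "\<bar>\<Sum>k\<le>N'. D2 k\<bar> = (\<Sum>k\<le>N'. D2 k)" using D2 by (intro abs_of_nonneg sum_nonneg) auto
        moreover have "norm (y2 \<epsilon> t) \<le> \<bar>C\<bar> / \<epsilon> ^ m"
          using y(3)[OF \<epsilon> t] divide_power_weaken[OF \<epsilon>01, of m m C] by linarith
        ultimately show ?thesis
          using norm_triangle_ineq4[of "y2 \<epsilon> t" "\<Sum>k\<le>N'. \<epsilon> ^ k *\<^sub>R yk2 k t"]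
          by (simp add: r_def C2_def add_divide_distrib)
      qed
    qed (use t ts in auto)
    then have tay: "norm (r 0 (t + s) - r 0 t - s *\<^sub>R r 1 t) \<le> (C2 / \<epsilon> ^ m) * s\<^sup>2"
      by (simp add: numeral_2_eq_2 diff_diff_eq)
    have r0: "norm (r 0 t) \<le> \<bar>K\<bar> * \<epsilon> ^ (N' + 1)" if "t \<in> {a<..<b}" for t
      using order_trans[OF K[OF \<epsilon> that] mult_right_mono[of K "\<bar>K\<bar>"]] \<epsilon>01 by (simp add: r_def)
    have "norm (s *\<^sub>R r 1 t) \<le> norm (r 0 (t + s)) + norm (r 0 t) + norm (r 0 (t + s) - r 0 t - s *\<^sub>R r 1 t)"
      using norm_triangle_ineq4[of "r 0 (t + s) - r 0 t" "r 0 (t + s) - r 0 t - s *\<^sub>R r 1 t"]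
        norm_triangle_ineq4[of "r 0 (t + s)" "r 0 t"] by simp
    then have "\<bar>s\<bar> * norm (r 1 t) \<le> 2 * (\<bar>K\<bar> * \<epsilon> ^ (N' + 1)) + (C2 / \<epsilon> ^ m) * s\<^sup>2"
      using r0[OF t] r0[OF ts] tay by simp
    also have "\<dots> = \<bar>s\<bar> * (2 * \<bar>K\<bar> / \<sigma> * \<epsilon> ^ (N + 2) + C2 * \<sigma> * \<epsilon> ^ (N + 1))"
    proof -
      have "\<epsilon> ^ (N' + 1) = \<epsilon> ^ P * \<epsilon> ^ (N + 2)"
      proof -
        have "N' + 1 = P + (N + 2)" by (simp add: N'_def P_def)
        then show ?thesis by (simp only: power_add)
      qed
      moreover have "s\<^sup>2 = (\<sigma> * \<epsilon> ^ P)\<^sup>2" using abs_s by (metis power2_abs)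
      moreover have "\<epsilon> ^ P = \<epsilon> ^ (N + 1) * \<epsilon> ^ m" unfolding P_def by (simp flip: power_add)
      ultimately show ?thesis using \<sigma> \<epsilon>01 unfolding abs_s
        by (simp add: field_simps power2_eq_square)
    qed
    finally have "norm (r 1 t) \<le> 2 * \<bar>K\<bar> / \<sigma> * \<epsilon> ^ (N + 2) + C2 * \<sigma> * \<epsilon> ^ (N + 1)"
      using \<sigma> \<epsilon>01 unfolding abs_s by (subst (asm) mult_le_cancel_left_pos) auto
    also have "\<dots> \<le> 2 * \<bar>K\<bar> / \<sigma> * \<epsilon> ^ (N + 1) + C2 * \<sigma> * \<epsilon> ^ (N + 1)"
      using \<sigma> \<epsilon>01 by (intro add_right_mono mult_left_mono power_decreasing) auto
    finally have r1: "norm (r 1 t) \<le> (2 * \<bar>K\<bar> / \<sigma> + C2 * \<sigma>) * \<epsilon> ^ (N + 1)" by (simp add: algebra_simps)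
    have "(\<Sum>k\<le>N'. \<epsilon> ^ k *\<^sub>R yk1 k t) = (\<Sum>k\<le>N. \<epsilon> ^ k *\<^sub>R yk1 k t) + (\<Sum>k\<in>{N<..N'}. \<epsilon> ^ k *\<^sub>R yk1 k t)"
    proof -
      have "{..N'} = {..N} \<union> {N<..N'}" by (auto simp: N'_def)
      then show ?thesis by (simp add: sum.union_disjoint ivl_disj_int)
    qed
    then have "y1 \<epsilon> t - (\<Sum>k\<le>N. \<epsilon> ^ k *\<^sub>R yk1 k t) = r 1 t + (\<Sum>k\<in>{N<..N'}. \<epsilon> ^ k *\<^sub>R yk1 k t)"
      by (simp add: r_def)
    then have "norm (y1 \<epsilon> t - (\<Sum>k\<le>N. \<epsilon> ^ k *\<^sub>R yk1 k t))
        \<le> norm (r 1 t) + norm (\<Sum>k\<in>{N<..N'}. \<epsilon> ^ k *\<^sub>R yk1 k t)"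
      by (simp add: norm_triangle_ineq)
    moreover have "norm (\<Sum>k\<in>{N<..N'}. \<epsilon> ^ k *\<^sub>R yk1 k t) \<le> (\<Sum>k\<in>{N<..N'}. \<epsilon> ^ (N + 1) * D1 k)"
    proof (rule sum_norm_le)
      fix k assume k: "k \<in> {N<..N'}"
      have "norm (\<epsilon> ^ k *\<^sub>R yk1 k t) = \<epsilon> ^ k * norm (yk1 k t)" using \<epsilon>01 by simp
      also have "\<dots> \<le> \<epsilon> ^ (N + 1) * D1 k"
        using \<epsilon>01 yk(3)[OF t, of k] k by (intro mult_mono power_decreasing) auto
      finally show "norm (\<epsilon> ^ k *\<^sub>R yk1 k t) \<le> \<epsilon> ^ (N + 1) * D1 k" .
    qed
    moreover have "(\<Sum>k\<in>{N<..N'}. \<epsilon> ^ (N + 1) * D1 k) \<le> (\<Sum>k\<le>N'. \<epsilon> ^ (N + 1) * D1 k)"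
      using \<epsilon>01 D1 by (intro sum_mono2) auto
    ultimately show ?thesis using r1
      by (simp add: K1_def algebra_simps sum_distrib_left)
  qed
  then show "\<exists>K. \<forall>\<epsilon>\<in>{0<..e}. \<forall>t\<in>{a<..<b}. norm (y1 \<epsilon> t - (\<Sum>k\<le>N. \<epsilon> ^ k *\<^sub>R yk1 k t)) \<le> K * \<epsilon> ^ (N + 1)"
    by blast
qed

lemma nderiv_bounded:
  fixes y :: "real \<Rightarrow> 'a::real_normed_vector"
  assumes "open S" "smooth_on S y" "{a..b} \<subseteq> S"
  shows "\<exists>C. \<forall>t\<in>{a<..<b}. norm (nderiv k y t) \<le> C"
proof -
  have "compact (nderiv k y ` {a..b})"
    using smooth_on_continuous[OF smooth_on_nderiv[OF assms(1,2)]] assms(3)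
    by (intro compact_continuous_image) (auto intro: continuous_on_subset)
  then obtain C where "\<forall>w\<in>nderiv k y ` {a..b}. norm w \<le> C" using compact_imp_bounded bounded_iff by metis
  then show ?thesis by (intro exI[of _ C]) auto
qed

text \<open>By repeated termwise differentiation every derivative has an asymptotic expansion, and its
  leading term is bounded.\<close>

lemma nderiv_uniformly_bounded:
  fixes y :: "real \<Rightarrow> real \<Rightarrow> 'a::real_normed_vector" and yk :: "nat \<Rightarrow> real \<Rightarrow> 'a"
  assumes ab: "a < b" and e: "e \<le> 1"
    and J: "open J" "\<And>k. smooth_on J (yk k)" "{a..b} \<subseteq> J"
    and y: "\<And>n. tempered {0<..e} {a<..<b} n y"
    and expn: "eps_expansion e {a<..<b} y yk"
  shows "\<exists>C. \<forall>\<epsilon>\<in>{0<..e}. \<forall>t\<in>{a<..<b}. norm (nderiv j (y \<epsilon>) t) \<le> C"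
proof -
  note der = tempered_nderiv(2)[OF open_greaterThanLessThan y]
  have yk_der: "(nderiv j (yk k) has_vector_derivative nderiv (Suc j) (yk k) t) (at t)"
    if "t \<in> {a<..<b}" for j k t
    using that J(3) by (intro nderiv_has_vector_derivative[OF J(1,2)]) auto
  have yk_bd: "\<exists>D. \<forall>k. \<forall>t\<in>{a<..<b}. norm (nderiv j (yk k) t) \<le> D k" for j
  proof -
    have "\<exists>C. \<forall>t\<in>{a<..<b}. norm (nderiv j (yk k) t) \<le> C" for k
      by (rule nderiv_bounded[OF J])
    then show ?thesis by (rule choice[OF allI])
  qed
  have "eps_expansion e {a<..<b} (\<lambda>\<epsilon>. nderiv j (y \<epsilon>)) (\<lambda>k. nderiv j (yk k))" for j
  proof (induction j)
    case (Suc j)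
    obtain C m where C: "\<And>\<epsilon> t. \<epsilon> \<in> {0<..e} \<Longrightarrow> t \<in> {a<..<b} \<Longrightarrow> norm (nderiv (Suc (Suc j)) (y \<epsilon>) t) \<le> C / \<epsilon> ^ m"
    proof -
      have "tempered {0<..e} {a<..<b} 0 (\<lambda>\<epsilon>. nderiv (Suc (Suc j)) (y \<epsilon>))"
        by (rule tempered_nderiv(1)[OF open_greaterThanLessThan y])
      then obtain C m where "\<forall>\<epsilon>\<in>{0<..e}. \<forall>t\<in>{a<..<b}. norm (nderiv (Suc (Suc j)) (y \<epsilon>) t) \<le> C / \<epsilon> ^ m"
        unfolding tempered.simps by (elim exE)
      then show ?thesis by (intro that[of C m]) simp
    qed
    obtain D1 D2 where D: "\<And>k t. t \<in> {a<..<b} \<Longrightarrow> norm (nderiv (Suc j) (yk k) t) \<le> D1 k"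
      "\<And>k t. t \<in> {a<..<b} \<Longrightarrow> norm (nderiv (Suc (Suc j)) (yk k) t) \<le> D2 k"
      using yk_bd[of "Suc j"] yk_bd[of "Suc (Suc j)"] by blast
    show ?case
      by (rule eps_expansion_derivative[OF ab e Suc der der C yk_der yk_der D])
  qed (use expn in simp)
  then obtain K where K: "\<And>\<epsilon> t. \<epsilon> \<in> {0<..e} \<Longrightarrow> t \<in> {a<..<b} \<Longrightarrow>
      norm (nderiv j (y \<epsilon>) t - (\<Sum>k\<le>0. \<epsilon> ^ k *\<^sub>R nderiv j (yk k) t)) \<le> K * \<epsilon> ^ (0 + 1)"
    unfolding eps_expansion_def by blast
  obtain D where D: "\<And>k t. t \<in> {a<..<b} \<Longrightarrow> norm (nderiv j (yk k) t) \<le> D k"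
    using yk_bd by blast
  have "norm (nderiv j (y \<epsilon>) t) \<le> \<bar>K\<bar> + D 0" if "\<epsilon> \<in> {0<..e}" "t \<in> {a<..<b}" for \<epsilon> t
  proof -
    have "K * \<epsilon> \<le> \<bar>K\<bar> * 1" using that e by (intro mult_mono) auto
    then show ?thesis using K[OF that] D[OF that(2), of 0]
        norm_triangle_sub[of "nderiv j (y \<epsilon>) t" "nderiv j (yk 0) t"] by simp
  qed
  then show ?thesis by blast
qed

text \<open>For small \<open>\<epsilon>\<close> the solutions stay in a compact neighbourhood of the reduced solution, where
  smooth functions are bounded. The differential equation then gives derivatives that are bounded by powers
  of \<open>1 / \<epsilon>\<close>, and the expansion of the solution to all orders removes these powers.\<close>

lemma solution_derivatives_uniformly_bounded:
  fixes f g :: "(real^'m) \<times> (real^'m) \<Rightarrow> real^'m" and x z :: "real \<Rightarrow> real \<Rightarrow> real^'m"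
  assumes \<Omega>: "open \<Omega>" "smooth_on \<Omega> f" "smooth_on \<Omega> g"
    and ab: "ta < a" "a < b" "b < tb"
    and \<epsilon>\<^sub>0: "0 < \<epsilon>\<^sub>0"
    and smooth: "\<And>k. smooth_on {ta<..<tb} (xk k)" "\<And>k. smooth_on {ta<..<tb} (zk k)"
    and expansions: "eps_expansion \<epsilon>\<^sub>0 {ta<..<tb} x xk" "eps_expansion \<epsilon>\<^sub>0 {ta<..<tb} z zk"
    and solution: "\<And>\<epsilon>. \<epsilon> \<in> {0<..\<epsilon>\<^sub>0} \<Longrightarrow> spp_solution f g \<epsilon> {ta<..<tb} (x \<epsilon>) (z \<epsilon>)"
    and in_\<Omega>: "\<And>t. t \<in> {ta<..<tb} \<Longrightarrow> (xk 0 t, zk 0 t) \<in> \<Omega>"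
  shows "\<exists>e>0. e \<le> \<epsilon>\<^sub>0 \<and> (\<forall>k.
      (\<forall>\<epsilon>\<in>{0<..e}. \<forall>t\<in>{a<..<b}.
        (nderiv k (x \<epsilon>) has_vector_derivative nderiv (Suc k) (x \<epsilon>) t) (at t) \<and>
        (nderiv k (z \<epsilon>) has_vector_derivative nderiv (Suc k) (z \<epsilon>) t) (at t)) \<and>
      (\<exists>C. \<forall>\<epsilon>\<in>{0<..e}. \<forall>t\<in>{a<..<b}. norm (nderiv k (x \<epsilon>) t) \<le> C \<and> norm (nderiv k (z \<epsilon>) t) \<le> C))"
proof -
  have sub: "{a..b} \<subseteq> {ta<..<tb}" using ab by auto
  define u0 where "u0 t = (xk 0 t, zk 0 t)" for t
  have "continuous_on {a..b} u0"
    unfolding u0_def using smooth_on_continuous[OF smooth(1)] smooth_on_continuous[OF smooth(2)] sub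
    by (intro continuous_on_Pair) (auto intro: continuous_on_subset)
  then have cG: "compact (u0 ` {a..b})" by (intro compact_continuous_image) auto
  have "u0 ` {a..b} \<subseteq> \<Omega>" using in_\<Omega> sub by (auto simp: u0_def)
  then obtain r where r: "0 < r" "(\<Union>w\<in>u0 ` {a..b}. ball w r) \<subseteq> \<Omega>"
    using compact_subset_open_imp_ball_epsilon_subset[OF cG \<Omega>(1)] by blast
  define K where "K = {w + v | w v. w \<in> u0 ` {a..b} \<and> v \<in> cball 0 (r / 2)}"
  have cK: "compact K" unfolding K_def by (rule compact_sums[OF cG compact_cball])
  have K\<Omega>: "K \<subseteq> \<Omega>"
  proof
    fix w assume "w \<in> K"
    then obtain w0 v where w: "w = w0 + v" "w0 \<in> u0 ` {a..b}" "norm v \<le> r / 2" by (auto simp: K_def)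
    then have "w \<in> ball w0 r" using r by (simp add: dist_norm norm_minus_commute)
    then show "w \<in> \<Omega>" using r(2) w(2) by blast
  qed
  obtain Kx where Kx: "\<And>\<epsilon> t. \<epsilon> \<in> {0<..\<epsilon>\<^sub>0} \<Longrightarrow> t \<in> {ta<..<tb} \<Longrightarrow>
      norm (x \<epsilon> t - (\<Sum>k\<le>0. \<epsilon> ^ k *\<^sub>R xk k t)) \<le> Kx * \<epsilon> ^ (0 + 1)"
    using expansions(1) unfolding eps_expansion_def by blast
  obtain Kz where Kz: "\<And>\<epsilon> t. \<epsilon> \<in> {0<..\<epsilon>\<^sub>0} \<Longrightarrow> t \<in> {ta<..<tb} \<Longrightarrow>
      norm (z \<epsilon> t - (\<Sum>k\<le>0. \<epsilon> ^ k *\<^sub>R zk k t)) \<le> Kz * \<epsilon> ^ (0 + 1)"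
    using expansions(2) unfolding eps_expansion_def by blast
  define L where "L = \<bar>Kx\<bar> + \<bar>Kz\<bar> + 1"
  define e where "e = min (min \<epsilon>\<^sub>0 1) (r / (2 * L))"
  have L: "0 < L" by (simp add: L_def)
  have e: "0 < e" "e \<le> \<epsilon>\<^sub>0" "e \<le> 1" using \<epsilon>\<^sub>0 r L by (auto simp: e_def)
  have inK: "(x \<epsilon> t, z \<epsilon> t) \<in> K" if "\<epsilon> \<in> {0<..e}" "t \<in> {a<..<b}" for \<epsilon> t
  proof -
    have *: "\<epsilon> \<in> {0<..\<epsilon>\<^sub>0}" "t \<in> {ta<..<tb}" using that e ab by auto
    have "norm ((x \<epsilon> t, z \<epsilon> t) - u0 t) \<le> norm (x \<epsilon> t - xk 0 t) + norm (z \<epsilon> t - zk 0 t)"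
      unfolding u0_def by (simp add: norm_Pair_le)
    also have "\<dots> \<le> L * \<epsilon>"
    proof -
      have "Kx * \<epsilon> \<le> \<bar>Kx\<bar> * \<epsilon>" "Kz * \<epsilon> \<le> \<bar>Kz\<bar> * \<epsilon>" using * by (auto intro!: mult_right_mono)
      moreover have "norm (x \<epsilon> t - xk 0 t) \<le> Kx * \<epsilon>" "norm (z \<epsilon> t - zk 0 t) \<le> Kz * \<epsilon>"
        using Kx[OF *] Kz[OF *] by simp_all
      moreover have "L * \<epsilon> = \<bar>Kx\<bar> * \<epsilon> + \<bar>Kz\<bar> * \<epsilon> + \<epsilon>" by (simp add: L_def algebra_simps)
      moreover have "0 < \<epsilon>" using * by simp
      ultimately show ?thesis by linarith
    qed
    also have "\<dots> \<le> L * (r / (2 * L))" using that L by (intro mult_left_mono) (auto simp: e_def)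
    also have "\<dots> = r / 2" using L by simp
    finally have "(x \<epsilon> t, z \<epsilon> t) - u0 t \<in> cball 0 (r / 2)" by simp
    moreover have "(x \<epsilon> t, z \<epsilon> t) = u0 t + ((x \<epsilon> t, z \<epsilon> t) - u0 t)" by simp
    ultimately show ?thesis using that unfolding K_def by fastforce
  qed
  have sol: "(x \<epsilon> has_vector_derivative f (x \<epsilon> t, z \<epsilon> t)) (at t)"
    "(z \<epsilon> has_vector_derivative (1 / \<epsilon>) *\<^sub>R g (x \<epsilon> t, z \<epsilon> t)) (at t)"
    if "\<epsilon> \<in> {0<..e}" "t \<in> {a<..<b}" for \<epsilon> t
    using solution[of \<epsilon>] that e ab by (auto simp: spp_solution_def)
  have E: "{0<..e} \<subseteq> {0<..1}" using e by auto
  have along: "tempered {0<..e} {a<..<b} n (\<lambda>\<epsilon> t. \<psi> (x \<epsilon> t, z \<epsilon> t))" if "smooth_on \<Omega> \<psi>"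
    for n and \<psi> :: "(real^'m) \<times> (real^'m) \<Rightarrow> real^'m"
    by (rule tempered_along_solution[OF E \<Omega>(2,3) cK K\<Omega> inK sol that])
  obtain R where R: "\<And>w. w \<in> K \<Longrightarrow> norm w \<le> R" using compact_imp_bounded[OF cK] bounded_iff by metis
  have bx: "tempered {0<..e} {a<..<b} 0 x"
    by (rule tempered_bounded[of _ _ _ R]) (rule order_trans[OF norm_fst_le R[OF inK]])
  have bz: "tempered {0<..e} {a<..<b} 0 z"
    by (rule tempered_bounded[of _ _ _ R]) (rule order_trans[OF norm_snd_le R[OF inK]])
  have tx: "tempered {0<..e} {a<..<b} n x" for n
    by (rule tempered_SucD[OF tempered_SucI[OF bx sol(1) along[OF \<Omega>(2)]]])
  have tg: "tempered {0<..e} {a<..<b} n (\<lambda>\<epsilon> t. (1 / \<epsilon>) *\<^sub>R g (x \<epsilon> t, z \<epsilon> t))" for n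
    by (intro tempered_scaleR[OF E] tempered_inverse[OF E] along \<Omega>(3))
  have tz: "tempered {0<..e} {a<..<b} n z" for n
    by (rule tempered_SucD[OF tempered_SucI[OF bz sol(2) tg]])
  have restrict: "eps_expansion e {a<..<b} y yk" if "eps_expansion \<epsilon>\<^sub>0 {ta<..<tb} y yk"
    for y :: "real \<Rightarrow> real \<Rightarrow> real^'m" and yk
  proof -
    have "{0<..e} \<subseteq> {0<..\<epsilon>\<^sub>0}" "{a<..<b} \<subseteq> {ta<..<tb}" using e ab by auto
    then show ?thesis using that unfolding eps_expansion_def by blast
  qed
  have bound: "\<exists>C. \<forall>\<epsilon>\<in>{0<..e}. \<forall>t\<in>{a<..<b}. norm (nderiv k (x \<epsilon>) t) \<le> C \<and> norm (nderiv k (z \<epsilon>) t) \<le> C" for k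
  proof -
    obtain C1 where C1: "\<forall>\<epsilon>\<in>{0<..e}. \<forall>t\<in>{a<..<b}. norm (nderiv k (x \<epsilon>) t) \<le> C1"
      using nderiv_uniformly_bounded[OF ab(2) e(3) open_greaterThanLessThan smooth(1) sub tx restrict[OF expansions(1)]]
      by blast
    obtain C2 where C2: "\<forall>\<epsilon>\<in>{0<..e}. \<forall>t\<in>{a<..<b}. norm (nderiv k (z \<epsilon>) t) \<le> C2"
      using nderiv_uniformly_bounded[OF ab(2) e(3) open_greaterThanLessThan smooth(2) sub tz restrict[OF expansions(2)]]
      by blast
    show ?thesis using C1 C2 by (intro exI[of _ "max C1 C2"]) (simp add: le_max_iff_disj)
  qed
  note dx = tempered_nderiv(2)[OF open_greaterThanLessThan tx]
    and dz = tempered_nderiv(2)[OF open_greaterThanLessThan tz]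
  show ?thesis
    by (intro exI[of _ e] conjI allI ballI e dx dz bound)
qed

section \<open>Residuals of a method of given order\<close>

text \<open>The block vector \<open>v \<otimes> u\<close>.\<close>

definition outer :: "real^'n \<Rightarrow> real^'m \<Rightarrow> real^'m^'n" where
  "outer v u = (\<chi> i. (v $ i) *\<^sub>R u)"

lemma outer_simps:
  "outer (v + w) u = outer v u + outer w u" "outer (v - w) u = outer v u - outer w u"
  "outer (r *\<^sub>R v) u = r *\<^sub>R outer v u" "outer v (r *\<^sub>R u) = r *\<^sub>R outer v u"
  "outer v (u + u') = outer v u + outer v u'" "outer 0 u = 0" "outer v 0 = 0"
  by (simp_all add: outer_def vec_eq_iff algebra_simps)

lemma outer_sum: "outer (\<Sum>i\<in>I. v i) u = (\<Sum>i\<in>I. outer (v i) u)"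
  "outer w (\<Sum>i\<in>I. u' i) = (\<Sum>i\<in>I. outer w (u' i))"
  by (induction I rule: infinite_finite_induct) (simp_all add: outer_simps)

lemma matrix_mult_outer: "A ** outer v u = outer (A *v v) u" for A :: "real^'n^'k"
  by (simp add: vec_eq_iff outer_def matrix_matrix_mult_def matrix_vector_mult_def sum_distrib_right mult.assoc)

lemma norm_outer: "norm (outer v u) = norm v * norm u"
proof -
  have "norm (outer v u) = L2_set (\<lambda>i. norm u * norm (v $ i)) UNIV"
    unfolding norm_vec_def[of "outer v u"] by (simp add: outer_def mult.commute)
  also have "\<dots> = norm u * norm v"
    unfolding norm_vec_def[of v] by (rule L2_set_right_distrib[symmetric]) simp
  finally show ?thesis by simp
qed

lemma norm_le_sum_rows: "norm (Y :: real^'m^'n) \<le> (\<Sum>i\<in>UNIV. norm (Y $ i))"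
  unfolding norm_vec_def[of Y] by (rule L2_set_le_sum) simp

lemma norm_le_rows: 
  assumes "\<And>i. norm (Y $ i) \<le> r"
  shows "norm (Y :: real^'m^'n) \<le> real CARD('n) * r"
proof -
  have "(\<Sum>i\<in>UNIV. norm (Y $ i)) \<le> (\<Sum>i\<in>(UNIV :: 'n set). r)" by (rule sum_mono) (rule assms)
  then show ?thesis using norm_le_sum_rows[of Y] by simp
qed

lemma exact_ext_outer: "exact_ext p w h y t = (\<Sum>k\<le>p. outer (w k) (nordsieck h y t k))"
  by (simp add: exact_ext_def outer_def vec_eq_iff)

definition sampled :: "real^'s \<Rightarrow> real \<Rightarrow> real \<Rightarrow> (real \<Rightarrow> real^'m) \<Rightarrow> real^'m^'s" where
  "sampled c h t y = (\<chi> i. y (t + c $ i * h))"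

text \<open>The function \<open>y k\<close> is the \<open>k\<close>-th derivative of \<open>y 0\<close>. One derivative more than the order \<open>p\<close> is
  bounded, to control the Taylor remainders.\<close>

definition bounded_derivatives :: "nat \<Rightarrow> real \<Rightarrow> real set \<Rightarrow> (nat \<Rightarrow> real \<Rightarrow> 'a::real_normed_vector) \<Rightarrow> bool" where
  "bounded_derivatives p K S y \<longleftrightarrow> convex S \<and>
     (\<forall>k\<le>p. \<forall>t\<in>S. (y k has_vector_derivative y (Suc k) t) (at t)) \<and>
     (\<forall>k\<le>Suc p. \<forall>t\<in>S. norm (y k t) \<le> K)"

text \<open>Defects of the exact solution in the stage equations and in the update; \<open>y 1\<close> takes the place of
  the right-hand side of the differential equation.\<close>

definition stage_residual ::
    "real^'s \<Rightarrow> real^'s^'s \<Rightarrow> real^'r^'s \<Rightarrow> (nat \<Rightarrow> real^'r) \<Rightarrow> nat \<Rightarrow> real \<Rightarrow> (nat \<Rightarrow> real \<Rightarrow> real^'m) \<Rightarrow> real \<Rightarrow> real^'m^'s" where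
  "stage_residual c A U w p h y t =
     h *\<^sub>R (A ** sampled c h t (y 1)) + U ** (\<Sum>k\<le>p. outer (w k) (h ^ k *\<^sub>R y k t)) - sampled c h t (y 0)"

definition output_residual ::
    "real^'s \<Rightarrow> real^'s^'r \<Rightarrow> real^'r^'r \<Rightarrow> (nat \<Rightarrow> real^'r) \<Rightarrow> nat \<Rightarrow> real \<Rightarrow> (nat \<Rightarrow> real \<Rightarrow> real^'m) \<Rightarrow> real \<Rightarrow> real^'m^'r" where
  "output_residual c B V w p h y t =
     h *\<^sub>R (B ** sampled c h t (y 1)) + V ** (\<Sum>k\<le>p. outer (w k) (h ^ k *\<^sub>R y k t))
       - (\<Sum>k\<le>p. outer (w k) (h ^ k *\<^sub>R y k (t + h)))"

text \<open>The Taylor polynomials of degree \<open>p - 1\<close> at all abscissae, with \<open>\<eta> k\<close> for \<open>h\<^sup>k\<close> times the \<open>k\<close>-th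
  derivative.\<close>

definition taylor_stages :: "nat \<Rightarrow> real^'s \<Rightarrow> (nat \<Rightarrow> real^'m) \<Rightarrow> real^'m^'s" where
  "taylor_stages p c \<eta> = (\<Sum>k<p. outer ((1 / fact k) *\<^sub>R cpower c k) (\<eta> k))"

lemma sampled_taylor:
  fixes y :: "nat \<Rightarrow> real \<Rightarrow> real^'m" and c :: "real^'s"
  assumes S: "convex S" and p: "1 \<le> p"
    and y: "\<And>k t. k < p \<Longrightarrow> t \<in> S \<Longrightarrow> (y k has_vector_derivative y (Suc k) t) (at t)"
    and K: "\<And>t. t \<in> S \<Longrightarrow> norm (y p t) \<le> K"
    and t: "t \<in> S" "\<And>i. t + c $ i * h \<in> S" and h: "0 < h"
  shows "norm (sampled c h t (y 0) - taylor_stages p c (\<lambda>k. h ^ k *\<^sub>R y k t))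
    \<le> real CARD('s) * (\<Sum>i\<in>UNIV. \<bar>c $ i\<bar> ^ p) * K * h ^ p"
proof -
  have K0: "0 \<le> K" using K[OF t(1)] norm_ge_zero order_trans by blast
  have "norm ((sampled c h t (y 0) - taylor_stages p c (\<lambda>k. h ^ k *\<^sub>R y k t)) $ i)
      \<le> (\<Sum>i\<in>UNIV. \<bar>c $ i\<bar> ^ p) * K * h ^ p" for i
  proof -
    obtain n where n: "p = Suc n" using p by (metis Suc_le_D One_nat_def)
    have "norm (y 0 (t + c $ i * h) - (\<Sum>j\<le>n. ((c $ i * h) ^ j / fact j) *\<^sub>R y j t)) \<le> K * \<bar>c $ i * h\<bar> ^ Suc n"
      by (rule taylor_remainder_bound[OF S]) (use y K t n in auto)
    moreover have "(\<Sum>j\<le>n. ((c $ i * h) ^ j / fact j) *\<^sub>R y j t) = taylor_stages p c (\<lambda>k. h ^ k *\<^sub>R y k t) $ i"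
      by (simp add: taylor_stages_def n lessThan_Suc_atMost outer_def cpower_def power_mult_distrib)
    moreover have "K * \<bar>c $ i * h\<bar> ^ Suc n = \<bar>c $ i\<bar> ^ p * (K * h ^ p)"
      using h by (simp add: n abs_mult power_mult_distrib)
    moreover have "\<bar>c $ i\<bar> ^ p * (K * h ^ p) \<le> (\<Sum>i\<in>UNIV. \<bar>c $ i\<bar> ^ p) * (K * h ^ p)"
      using K0 h by (intro mult_right_mono member_le_sum) auto
    ultimately have "norm (y 0 (t + c $ i * h) - taylor_stages p c (\<lambda>k. h ^ k *\<^sub>R y k t) $ i)
        \<le> (\<Sum>i\<in>UNIV. \<bar>c $ i\<bar> ^ p) * (K * h ^ p)" by (simp only:)
    then show ?thesis by (simp add: sampled_def mult.assoc)
  qed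
  from norm_le_rows[OF this] show ?thesis by (simp add: mult.assoc)
qed

text \<open>Expand all samples up to order \<open>p - 1\<close>. As \<open>q \<ge> p - 1\<close>, the stage order conditions cancel the coefficients
  of \<open>h\<^sup>k y\<^sup>(\<^sup>k\<^sup>)\<close> for \<open>k < p\<close>. The coefficient \<open>\<kappa>\<close> of the \<open>p\<close>-th term and the remainders are left.\<close>

lemma glm_stage_residual:
  fixes c :: "real^'s" and A :: "real^'s^'s" and U :: "real^'r^'s"
  assumes ord: "glm_order p q c A U B V w" and p: "1 \<le> p"
  shows "\<exists>C\<ge>0. \<forall>(y :: nat \<Rightarrow> real \<Rightarrow> real^'m) S t h.
     bounded_derivatives p K S y \<longrightarrow> t \<in> S \<longrightarrow> (\<forall>i. t + c $ i * h \<in> S) \<longrightarrow>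
     0 < h \<longrightarrow> h \<le> 1 \<longrightarrow>
     norm (stage_residual c A U w p h y t) \<le> C * h ^ p"
proof -
  obtain KA where KA: "KA > 0" "\<And>Y::real^'m^'s. norm (A ** Y) \<le> KA * norm Y"
    using matrix_mult_bound[of A] by blast
  define \<Gamma> where "\<Gamma> = real CARD('s) * (\<Sum>i\<in>UNIV. \<bar>c $ i\<bar> ^ p) * \<bar>K\<bar>"
  define \<kappa> where "\<kappa> = (1 / fact (p - 1)) *\<^sub>R (A *v cpower c (p - 1)) + U *v w p"
  have \<Gamma>: "0 \<le> \<Gamma>" by (simp add: \<Gamma>_def sum_nonneg)
  show ?thesis
  proof (rule exI[of _ "norm \<kappa> * \<bar>K\<bar> + KA * \<Gamma> + \<Gamma>"], intro conjI allI impI)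
    show "0 \<le> norm \<kappa> * \<bar>K\<bar> + KA * \<Gamma> + \<Gamma>" using \<Gamma> KA(1) by simp
    fix y :: "nat \<Rightarrow> real \<Rightarrow> real^'m" and S t h
    assume bd: "bounded_derivatives p K S y" and t: "t \<in> S" "\<forall>i. t + c $ i * h \<in> S"
      and h: "0 < h" "h \<le> 1"
    define \<eta> where "\<eta> k = h ^ k *\<^sub>R y k t" for k
    let ?\<rho>0 = "sampled c h t (y 0) - taylor_stages p c \<eta>"
    let ?\<rho>1 = "sampled c h t (y 1) - taylor_stages p c (\<lambda>k. h ^ k *\<^sub>R y (Suc k) t)"
    from bd have S: "convex S" and y: "\<forall>k\<le>p. \<forall>t\<in>S. (y k has_vector_derivative y (Suc k) t) (at t)"
      and K: "\<forall>k\<le>Suc p. \<forall>t\<in>S. norm (y k t) \<le> K" by (auto simp: bounded_derivatives_def)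
    have K': "norm (y k t) \<le> \<bar>K\<bar>" if "k \<le> Suc p" "t \<in> S" for k t
      using K that abs_ge_self[of K] order_trans by blast
    have \<rho>0: "norm ?\<rho>0 \<le> \<Gamma> * h ^ p"
      unfolding \<Gamma>_def \<eta>_def by (rule sampled_taylor[OF S p]) (use y K' t h in auto)
    have \<rho>1: "norm ?\<rho>1 \<le> \<Gamma> * h ^ p"
    proof -
      have "norm (sampled c h t (y (Suc 0)) - taylor_stages p c (\<lambda>k. h ^ k *\<^sub>R y (Suc k) t)) \<le> \<Gamma> * h ^ p"
        unfolding \<Gamma>_def by (rule sampled_taylor[OF S p, of "\<lambda>k. y (Suc k)"]) (use y K' t h in auto)
      then show ?thesis by simp
    qed
    have hF: "h *\<^sub>R taylor_stages p c (\<lambda>k. h ^ k *\<^sub>R y (Suc k) t)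
        = (\<Sum>k<p. outer ((1 / fact k) *\<^sub>R cpower c k) (\<eta> (Suc k)))"
      by (simp add: taylor_stages_def scaleR_sum_right \<eta>_def flip: outer_simps(4))
    define a where "a k = (if k = 0 then 0 else (1 / fact (k - 1)) *\<^sub>R (A *v cpower c (k - 1)))" for k
    define b where "b k = (if k < p then (1 / fact k) *\<^sub>R cpower c k else 0)" for k
    have coef: "a k + U *v w k - b k = (if k = p then \<kappa> else 0)" if "k \<le> p" for k
    proof (cases "k = 0")
      case True
      then show ?thesis using ord p by (simp add: a_def b_def glm_order_def cpower_def vec_eq_iff)
    next
      case False
      show ?thesis
      proof (cases "k = p")
        case False
        then have "k \<in> {1..q}" using ord that \<open>k \<noteq> 0\<close> by (auto simp: glm_order_def)
        then have "(1 / fact k) *\<^sub>R cpower c k - (1 / fact (k - 1)) *\<^sub>R (A *v cpower c (k - 1)) - U *v w k = 0"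
          using ord unfolding glm_order_def by blast
        then show ?thesis using False that \<open>k \<noteq> 0\<close> by (simp add: a_def b_def algebra_simps)
      qed (use \<open>k \<noteq> 0\<close> in \<open>simp add: a_def b_def \<kappa>_def\<close>)
    qed
    have s1: "A ** (\<Sum>k<p. outer ((1 / fact k) *\<^sub>R cpower c k) (\<eta> (Suc k))) = (\<Sum>k\<le>p. outer (a k) (\<eta> k))"
    proof -
      obtain n where n: "p = Suc n" using p by (metis Suc_le_D One_nat_def)
      show ?thesis
        unfolding n sum.atMost_Suc_shift
        by (simp add: linear_sum[OF linear_matrix_mult] linear_scale[OF linear_matrix_mult]
            matrix_mult_outer a_def outer_simps lessThan_Suc_atMost)
    qed
    have s2: "U ** (\<Sum>k\<le>p. outer (w k) (\<eta> k)) = (\<Sum>k\<le>p. outer (U *v w k) (\<eta> k))"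
      by (simp add: linear_sum[OF linear_matrix_mult] matrix_mult_outer)
    have s3: "taylor_stages p c \<eta> = (\<Sum>k\<le>p. outer (b k) (\<eta> k))"
    proof -
      have "{..p} = insert p {..<p}" by auto
      then show ?thesis by (simp add: taylor_stages_def b_def outer_simps)
    qed
    have "h *\<^sub>R (A ** sampled c h t (y 1)) + U ** (\<Sum>k\<le>p. outer (w k) (\<eta> k)) - sampled c h t (y 0)
        = (A ** (h *\<^sub>R taylor_stages p c (\<lambda>k. h ^ k *\<^sub>R y (Suc k) t)) + U ** (\<Sum>k\<le>p. outer (w k) (\<eta> k))
           - taylor_stages p c \<eta>) + h *\<^sub>R (A ** ?\<rho>1) - ?\<rho>0"
      by (simp add: linear_diff[OF linear_matrix_mult] linear_scale[OF linear_matrix_mult] algebra_simps)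
    also have "A ** (h *\<^sub>R taylor_stages p c (\<lambda>k. h ^ k *\<^sub>R y (Suc k) t)) + U ** (\<Sum>k\<le>p. outer (w k) (\<eta> k))
           - taylor_stages p c \<eta> = (\<Sum>k\<le>p. outer (a k + U *v w k - b k) (\<eta> k))"
      unfolding hF s1 s2 s3 by (simp add: outer_simps sum.distrib sum_subtractf)
    also have "\<dots> = (\<Sum>k\<le>p. if k = p then outer \<kappa> (\<eta> p) else 0)"
      by (rule sum.cong) (auto simp: coef outer_simps)
    also have "\<dots> = outer \<kappa> (\<eta> p)" by simp
    finally have eq: "h *\<^sub>R (A ** sampled c h t (y 1)) + U ** (\<Sum>k\<le>p. outer (w k) (\<eta> k)) - sampled c h t (y 0)
        = outer \<kappa> (\<eta> p) + h *\<^sub>R (A ** ?\<rho>1) - ?\<rho>0" .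
    have "norm (outer \<kappa> (\<eta> p) + h *\<^sub>R (A ** ?\<rho>1) - ?\<rho>0)
        \<le> norm (outer \<kappa> (\<eta> p)) + norm (h *\<^sub>R (A ** ?\<rho>1)) + norm ?\<rho>0"
      by (meson norm_triangle_le norm_triangle_ineq4 order_trans add_right_mono norm_triangle_ineq)
    moreover have "norm (outer \<kappa> (\<eta> p)) \<le> norm \<kappa> * (\<bar>K\<bar> * h ^ p)"
      using K'[of p t] t h
      by (auto simp: norm_outer \<eta>_def mult.commute intro!: mult_left_mono)
    moreover have "norm (h *\<^sub>R (A ** ?\<rho>1)) \<le> 1 * (KA * (\<Gamma> * h ^ p))"
      unfolding norm_scaleR using h KA \<rho>1
      by (intro mult_mono) (auto intro: order_trans[OF KA(2)] mult_left_mono)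
    ultimately show "norm (stage_residual c A U w p h y t) \<le> (norm \<kappa> * \<bar>K\<bar> + KA * \<Gamma> + \<Gamma>) * h ^ p"
      using \<rho>0 eq unfolding stage_residual_def \<eta>_def by (simp add: algebra_simps)
  qed
qed

text \<open>Here the order conditions cancel all terms up to \<open>p\<close>. The external stages at \<open>t + h\<close> contain
  Taylor polynomials of the derivatives, a double sum that is sorted by the total order.\<close>

lemma glm_output_residual:
  fixes c :: "real^'s" and B :: "real^'s^'r" and V :: "real^'r^'r"
  assumes ord: "glm_order p q c A U B V w" and p: "1 \<le> p"
  shows "\<exists>C\<ge>0. \<forall>(y :: nat \<Rightarrow> real \<Rightarrow> real^'m) S t h.
     bounded_derivatives p K S y \<longrightarrow> t \<in> S \<longrightarrow> t + h \<in> S \<longrightarrow> (\<forall>i. t + c $ i * h \<in> S) \<longrightarrow>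
     0 < h \<longrightarrow> h \<le> 1 \<longrightarrow>
     norm (output_residual c B V w p h y t) \<le> C * h ^ Suc p"
proof -
  obtain KB where KB: "KB > 0" "\<And>Y::real^'m^'s. norm (B ** Y) \<le> KB * norm Y"
    using matrix_mult_bound[of B] by blast
  define \<Gamma> where "\<Gamma> = real CARD('s) * (\<Sum>i\<in>UNIV. \<bar>c $ i\<bar> ^ p) * \<bar>K\<bar>"
  define W where "W = (\<Sum>k\<le>p. norm (w k)) * \<bar>K\<bar>"
  have \<Gamma>: "0 \<le> \<Gamma>" by (simp add: \<Gamma>_def sum_nonneg)
  show ?thesis
  proof (rule exI[of _ "KB * \<Gamma> + W"], intro conjI allI impI)
    show "0 \<le> KB * \<Gamma> + W" using \<Gamma> KB(1) by (simp add: W_def sum_nonneg)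
    fix y :: "nat \<Rightarrow> real \<Rightarrow> real^'m" and S t h
    assume bd: "bounded_derivatives p K S y" and t: "t \<in> S" "t + h \<in> S" "\<forall>i. t + c $ i * h \<in> S"
      and h: "0 < h" "h \<le> 1"
    from bd have S: "convex S" and y: "\<forall>k\<le>p. \<forall>t\<in>S. (y k has_vector_derivative y (Suc k) t) (at t)"
      and K: "\<forall>k\<le>Suc p. \<forall>t\<in>S. norm (y k t) \<le> K" by (auto simp: bounded_derivatives_def)
    have K': "norm (y k t) \<le> \<bar>K\<bar>" if "k \<le> Suc p" "t \<in> S" for k t
      using K that abs_ge_self[of K] order_trans by blast
    define \<eta> where "\<eta> k = h ^ k *\<^sub>R y k t" for k
    let ?\<rho>1 = "sampled c h t (y 1) - taylor_stages p c (\<lambda>k. h ^ k *\<^sub>R y (Suc k) t)"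
    have \<rho>1: "norm ?\<rho>1 \<le> \<Gamma> * h ^ p"
    proof -
      have "norm (sampled c h t (y (Suc 0)) - taylor_stages p c (\<lambda>k. h ^ k *\<^sub>R y (Suc k) t)) \<le> \<Gamma> * h ^ p"
        unfolding \<Gamma>_def by (rule sampled_taylor[OF S p, of "\<lambda>k. y (Suc k)"]) (use y K' t h in auto)
      then show ?thesis by simp
    qed
    have hF: "h *\<^sub>R taylor_stages p c (\<lambda>k. h ^ k *\<^sub>R y (Suc k) t)
        = (\<Sum>k<p. outer ((1 / fact k) *\<^sub>R cpower c k) (\<eta> (Suc k)))"
      by (simp add: taylor_stages_def scaleR_sum_right \<eta>_def flip: outer_simps(4))
    define a where "a k = (if k = 0 then 0 else (1 / fact (k - 1)) *\<^sub>R (B *v cpower c (k - 1)))" for k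
    define b where "b k = (\<Sum>l\<le>k. (1 / fact l) *\<^sub>R w (k - l))" for k
    have coef: "a k + V *v w k - b k = 0" if "k \<le> p" for k
    proof (cases "k = 0")
      case True
      then show ?thesis using ord by (simp add: a_def b_def glm_order_def)
    next
      case False
      then have "(\<Sum>l\<le>k. (1 / fact l) *\<^sub>R w (k - l))
         - (1 / fact (k - 1)) *\<^sub>R (B *v cpower c (k - 1)) - V *v w k = 0"
        using ord that unfolding glm_order_def by auto
      then show ?thesis using False by (simp add: a_def b_def algebra_simps)
    qed
    have s1: "B ** (\<Sum>k<p. outer ((1 / fact k) *\<^sub>R cpower c k) (\<eta> (Suc k))) = (\<Sum>k\<le>p. outer (a k) (\<eta> k))"
    proof -
      obtain n where n: "p = Suc n" using p by (metis Suc_le_D One_nat_def)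
      show ?thesis
        unfolding n sum.atMost_Suc_shift
        by (simp add: linear_sum[OF linear_matrix_mult] linear_scale[OF linear_matrix_mult]
            matrix_mult_outer a_def outer_simps lessThan_Suc_atMost)
    qed
    have s2: "V ** (\<Sum>k\<le>p. outer (w k) (\<eta> k)) = (\<Sum>k\<le>p. outer (V *v w k) (\<eta> k))"
      by (simp add: linear_sum[OF linear_matrix_mult] matrix_mult_outer)
    define \<tau> where "\<tau> k = y k (t + h) - (\<Sum>l\<le>p - k. (h ^ l / fact l) *\<^sub>R y (k + l) t)" for k
    have \<tau>: "norm (\<tau> k) \<le> \<bar>K\<bar> * h ^ Suc (p - k)" if "k \<le> p" for k
      using taylor_remainder_bound[OF S, of "p - k" "\<lambda>l. y (k + l)" "\<bar>K\<bar>" t h] y K' t h that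
      unfolding \<tau>_def by simp
    have s3: "(\<Sum>k\<le>p. outer (w k) (h ^ k *\<^sub>R y k (t + h)))
        = (\<Sum>k\<le>p. outer (b k) (\<eta> k)) + (\<Sum>k\<le>p. outer (w k) (h ^ k *\<^sub>R \<tau> k))"
    proof -
      have "(\<Sum>k\<le>p. outer (b k) (\<eta> k)) = (\<Sum>k\<le>p. \<Sum>l\<le>k. outer ((1 / fact l) *\<^sub>R w (k - l)) (\<eta> (l + (k - l))))"
        unfolding b_def outer_sum by (intro sum.cong) auto
      also have "\<dots> = (\<Sum>(l, k)\<in>{(l, k). l + k \<le> p}. outer ((1 / fact l) *\<^sub>R w k) (\<eta> (l + k)))"
        by (rule sum.triangle_reindex_eq[symmetric])
      also have "\<dots> = (\<Sum>(k, l)\<in>{(k, l). k + l \<le> p}. outer ((1 / fact l) *\<^sub>R w k) (\<eta> (l + k)))"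
        by (rule sum.reindex_bij_witness[of _ prod.swap prod.swap]) auto
      also have "{(k, l). k + l \<le> p} = (SIGMA k:{..p}. {..p - k})" by auto
      also have "(\<Sum>(k, l)\<in>(SIGMA k:{..p}. {..p - k}). outer ((1 / fact l) *\<^sub>R w k) (\<eta> (l + k)))
          = (\<Sum>k\<le>p. \<Sum>l\<le>p - k. outer ((1 / fact l) *\<^sub>R w k) (\<eta> (l + k)))"
        by (rule sum.Sigma[symmetric]) auto
      also have "\<dots> = (\<Sum>k\<le>p. outer (w k) (h ^ k *\<^sub>R (\<Sum>l\<le>p - k. (h ^ l / fact l) *\<^sub>R y (k + l) t)))"
        unfolding scaleR_sum_right outer_sum
        by (intro sum.cong refl) (simp add: \<eta>_def outer_simps power_add add.commute mult.commute)
      finally show ?thesis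
        by (simp add: \<tau>_def scaleR_diff_right flip: sum.distrib outer_simps(5))
    qed
    have eq: "h *\<^sub>R (B ** sampled c h t (y 1)) + V ** (\<Sum>k\<le>p. outer (w k) (\<eta> k))
         - (\<Sum>k\<le>p. outer (w k) (h ^ k *\<^sub>R y k (t + h)))
        = h *\<^sub>R (B ** ?\<rho>1) - (\<Sum>k\<le>p. outer (w k) (h ^ k *\<^sub>R \<tau> k))"
    proof -
      have "h *\<^sub>R (B ** sampled c h t (y 1))
          = B ** (h *\<^sub>R taylor_stages p c (\<lambda>k. h ^ k *\<^sub>R y (Suc k) t)) + h *\<^sub>R (B ** ?\<rho>1)"
        by (simp add: linear_diff[OF linear_matrix_mult] linear_scale[OF linear_matrix_mult] algebra_simps)
      moreover have "(\<Sum>k\<le>p. outer (a k) (\<eta> k)) + (\<Sum>k\<le>p. outer (V *v w k) (\<eta> k)) - (\<Sum>k\<le>p. outer (b k) (\<eta> k))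
          = (\<Sum>k\<le>p. outer (a k + V *v w k - b k) (\<eta> k))"
        by (simp add: outer_simps sum.distrib sum_subtractf)
      moreover have "(\<Sum>k\<le>p. outer (a k + V *v w k - b k) (\<eta> k)) = 0"
        by (rule sum.neutral) (auto simp: coef outer_simps)
      ultimately show ?thesis unfolding hF s1 s2 s3 by (simp add: algebra_simps)
    qed
    have n1: "norm (h *\<^sub>R (B ** ?\<rho>1)) \<le> KB * \<Gamma> * h ^ Suc p"
    proof -
      have "norm (B ** ?\<rho>1) \<le> KB * (\<Gamma> * h ^ p)"
        by (rule order_trans[OF KB(2)]) (use KB(1) \<rho>1 in \<open>auto intro: mult_left_mono\<close>)
      then have "h * norm (B ** ?\<rho>1) \<le> h * (KB * (\<Gamma> * h ^ p))" using h by (intro mult_left_mono) auto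
      then show ?thesis using h by (simp add: mult_ac)
    qed
    have n2: "norm (\<Sum>k\<le>p. outer (w k) (h ^ k *\<^sub>R \<tau> k)) \<le> W * h ^ Suc p"
    proof -
      have "norm (\<Sum>k\<le>p. outer (w k) (h ^ k *\<^sub>R \<tau> k)) \<le> (\<Sum>k\<le>p. norm (w k) * (\<bar>K\<bar> * h ^ Suc p))"
      proof (rule sum_norm_le)
        fix k assume k: "k \<in> {..p}"
        have "norm (h ^ k *\<^sub>R \<tau> k) \<le> h ^ k * (\<bar>K\<bar> * h ^ Suc (p - k))"
          using \<tau>[of k] k h by (simp add: mult_left_mono)
        also have "\<dots> = \<bar>K\<bar> * (h ^ (k + Suc (p - k)))" by (simp only: power_add mult_ac)
        also have "k + Suc (p - k) = Suc p" using k by simp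
        finally show "norm (outer (w k) (h ^ k *\<^sub>R \<tau> k)) \<le> norm (w k) * (\<bar>K\<bar> * h ^ Suc p)"
          unfolding norm_outer by (rule mult_left_mono) simp
      qed
      then show ?thesis by (simp add: W_def sum_distrib_right mult.assoc)
    qed
    show "norm (output_residual c B V w p h y t) \<le> (KB * \<Gamma> + W) * h ^ Suc p"
      unfolding output_residual_def eq[unfolded \<eta>_def] distrib_right
      by (rule order_trans[OF norm_triangle_ineq4 add_mono[OF n1 n2]])
  qed
qed

lemma glm_residuals:
  fixes c :: "real^'s"
  assumes ord: "glm_order p q c A U B V w" and p: "1 \<le> p"
  shows "\<exists>C\<ge>0. \<forall>(y :: nat \<Rightarrow> real \<Rightarrow> real^'m) S t h.
     bounded_derivatives p K S y \<longrightarrow> t \<in> S \<longrightarrow> t + h \<in> S \<longrightarrow> (\<forall>i. t + c $ i * h \<in> S) \<longrightarrow> 0 < h \<longrightarrow> h \<le> 1 \<longrightarrow>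
     norm (stage_residual c A U w p h y t) \<le> C * h ^ p \<and> norm (output_residual c B V w p h y t) \<le> h * (C * h ^ p)"
proof -
  obtain C1 where C1: "0 \<le> C1" "\<forall>(y :: nat \<Rightarrow> real \<Rightarrow> real^'m) S t h.
     bounded_derivatives p K S y \<longrightarrow> t \<in> S \<longrightarrow> (\<forall>i. t + c $ i * h \<in> S) \<longrightarrow> 0 < h \<longrightarrow> h \<le> 1 \<longrightarrow>
     norm (stage_residual c A U w p h y t) \<le> C1 * h ^ p"
    using glm_stage_residual[OF ord p, where K = K] by (elim exE conjE)
  obtain C2 where C2: "0 \<le> C2" "\<forall>(y :: nat \<Rightarrow> real \<Rightarrow> real^'m) S t h.
     bounded_derivatives p K S y \<longrightarrow> t \<in> S \<longrightarrow> t + h \<in> S \<longrightarrow> (\<forall>i. t + c $ i * h \<in> S) \<longrightarrow> 0 < h \<longrightarrow> h \<le> 1 \<longrightarrow>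
     norm (output_residual c B V w p h y t) \<le> C2 * h ^ Suc p"
    using glm_output_residual[OF ord p, where K = K] by (elim exE conjE)
  show ?thesis
  proof (rule exI[of _ "C1 + C2"], intro conjI allI impI)
    show "0 \<le> C1 + C2" using C1 C2 by simp
    fix y :: "nat \<Rightarrow> real \<Rightarrow> real^'m" and S t h
    assume *: "bounded_derivatives p K S y" "t \<in> S" and **: "t + h \<in> S"
      and h: "\<forall>i. t + c $ i * h \<in> S" "0 < h" "h \<le> 1"
    have "C1 * h ^ p \<le> (C1 + C2) * h ^ p" using C2 h by (intro mult_right_mono) auto
    then show "norm (stage_residual c A U w p h y t) \<le> (C1 + C2) * h ^ p"
      using C1(2)[rule_format, OF * h(1)[rule_format] h(2,3)] by linarith
    have "C2 * h ^ Suc p \<le> (C1 + C2) * h ^ Suc p" using C1 h by (intro mult_right_mono) auto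
    also have "\<dots> = h * ((C1 + C2) * h ^ p)" by simp
    finally show "norm (output_residual c B V w p h y t) \<le> h * ((C1 + C2) * h ^ p)"
      using C2(2)[rule_format, OF * ** h(1)[rule_format] h(2,3)] by linarith
  qed
qed

section \<open>Linearization at the stages\<close>

lemma linear_norm_le_basis:
  fixes L :: "'a::euclidean_space \<Rightarrow> 'b::real_normed_vector"
  assumes "linear L"
  shows "norm (L v) \<le> (\<Sum>b\<in>Basis. norm (L b)) * norm v"
proof -
  have "L v = (\<Sum>b\<in>Basis. (v \<bullet> b) *\<^sub>R L b)"
    using linear_sum[OF assms, of "\<lambda>b. (v \<bullet> b) *\<^sub>R b" Basis]
    by (simp add: euclidean_representation linear_scale[OF assms])
  also have "norm \<dots> \<le> (\<Sum>b\<in>Basis. norm (L b) * norm v)"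
    by (rule sum_norm_le) (simp add: mult.commute[of "norm (L _)"] mult_right_mono Basis_le_norm)
  finally show ?thesis by (simp add: sum_distrib_right)
qed

text \<open>The directional derivatives along the finitely many basis vectors are continuous, hence the
  derivative is continuous in the operator norm.\<close>

lemma smooth_linearization:
  fixes F :: "'a::euclidean_space \<Rightarrow> 'b::real_normed_vector"
  assumes \<Omega>: "open \<Omega>" and F: "smooth_on \<Omega> F" and w: "w \<in> \<Omega>" and \<eta>: "0 < \<eta>"
  shows "\<exists>\<rho>>0. ball w \<rho> \<subseteq> \<Omega> \<and> (\<forall>u\<in>ball w \<rho>. \<forall>v\<in>ball w \<rho>.
    norm (F u - F v - frechet_derivative F (at w) (u - v)) \<le> \<eta> * norm (u - v))"
proof -
  let ?D = "\<lambda>u. frechet_derivative F (at u)"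
  define \<eta>' where "\<eta>' = \<eta> / DIM('a)"
  have \<eta>': "0 < \<eta>'" using \<eta> by (simp add: \<eta>'_def)
  have "\<forall>b\<in>Basis. \<forall>\<^sub>F u in nhds w. dist (?D u b) (?D w b) < \<eta>'"
  proof
    fix b :: 'a
    have "continuous_on \<Omega> (\<lambda>u. ?D u b)" by (rule smooth_on_continuous[OF smooth_on_directional[OF F]])
    then have "continuous (at w) (\<lambda>u. ?D u b)" using \<Omega> w continuous_on_eq_continuous_at by blast
    then have "((\<lambda>u. ?D u b) \<longlongrightarrow> ?D w b) (nhds w)"
      by (simp add: continuous_at_imp_continuous_at_within isCont_def tendsto_nhds_iff)
    then show "\<forall>\<^sub>F u in nhds w. dist (?D u b) (?D w b) < \<eta>'" using tendstoD \<eta>' by blast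
  qed
  then have "\<forall>\<^sub>F u in nhds w. \<forall>b\<in>Basis. dist (?D u b) (?D w b) < \<eta>'"
    by (simp add: eventually_ball_finite_distrib)
  moreover have "\<forall>\<^sub>F u in nhds w. u \<in> \<Omega>" using \<Omega> w by (rule eventually_nhds_in_open)
  ultimately have "\<forall>\<^sub>F u in nhds w. u \<in> \<Omega> \<and> (\<forall>b\<in>Basis. dist (?D u b) (?D w b) < \<eta>')"
    by eventually_elim simp
  then obtain \<rho> where \<rho>: "0 < \<rho>" "\<And>u. dist u w < \<rho> \<Longrightarrow> u \<in> \<Omega> \<and> (\<forall>b\<in>Basis. dist (?D u b) (?D w b) < \<eta>')"
    unfolding eventually_nhds_metric by blast
  have D: "(F has_derivative ?D u) (at u)" if "u \<in> \<Omega>" for u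
    using smooth_on_differentiable[OF F that] frechet_derivative_works by blast
  have on: "onorm (?D u - ?D w) \<le> \<eta>" if "u \<in> ball w \<rho>" for u
  proof -
    have u: "u \<in> \<Omega>" "\<forall>b\<in>Basis. dist (?D u b) (?D w b) < \<eta>'"
      using \<rho>(2)[of u] that by (auto simp: dist_commute)
    have lin: "linear (\<lambda>v. ?D u v - ?D w v)"
      using D[OF u(1)] D[OF w] by (intro linear_compose_sub has_derivative_linear)
    have "(\<Sum>b\<in>Basis. norm (?D u b - ?D w b)) \<le> (\<Sum>b\<in>(Basis :: 'a set). \<eta>')"
      using u(2) by (intro sum_mono) (auto simp: dist_norm less_imp_le)
    also have "\<dots> = \<eta>" by (simp add: \<eta>'_def)
    finally have s: "(\<Sum>b\<in>Basis. norm (?D u b - ?D w b)) \<le> \<eta>" .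
    have "norm (?D u v - ?D w v) \<le> \<eta> * norm v" for v
      by (rule order_trans[OF linear_norm_le_basis[OF lin] mult_right_mono[OF s]]) simp
    then show ?thesis by (intro onorm_le) simp
  qed
  have "norm (F u - F v - ?D w (u - v)) \<le> \<eta> * norm (u - v)" if "u \<in> ball w \<rho>" "v \<in> ball w \<rho>" for u v
  proof -
    have "norm (F u - F v - ?D w (u - v)) \<le> norm (u - v) * \<eta>"
    proof (rule differentiable_bound_linearization[where S = "ball w \<rho>" and f' = ?D and ?x0.0 = w])
      show "v + t *\<^sub>R (u - v) \<in> ball w \<rho>" if "t \<in> {0..1}" for t
      proof -
        have "(1 - t) *\<^sub>R v + t *\<^sub>R u \<in> ball w \<rho>"
          using convexD_alt[OF convex_ball \<open>v \<in> ball w \<rho>\<close> \<open>u \<in> ball w \<rho>\<close>] that by auto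
        then show ?thesis by (simp add: algebra_simps)
      qed
      show "(F has_derivative ?D x) (at x within ball w \<rho>)" if "x \<in> ball w \<rho>" for x
        using D[of x] \<rho>(2)[of x] that by (auto simp: dist_commute intro: has_derivative_at_withinI)
    qed (use on \<rho>(1) in auto)
    then show ?thesis by (simp add: mult.commute)
  qed
  moreover have "ball w \<rho> \<subseteq> \<Omega>" using \<rho>(2) by (auto simp: dist_commute)
  ultimately show ?thesis using \<rho>(1) by blast
qed

text \<open>This resolves the coupled inequalities between the norms in one step: \<open>s\<close> stands for the error of the
  scaled slopes, \<open>r\<close> for its deviation from the linear response to \<open>\<zeta>\<close>, and \<open>X\<close>, \<open>Z\<close> for the errors of the
  stages. The feedback into \<open>s\<close> and \<open>X\<close> carries the small factor
  \<open>\<sigma>\<close>, except for the influence of \<open>X\<close> on \<open>s\<close>; and \<open>X\<close> depends on \<open>Z\<close> through \<open>\<sigma>\<close> alone.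
  Consequently \<open>r\<close> feels \<open>\<zeta>\<close> only with an arbitrarily small factor \<open>\<eta>\<close>.\<close>

lemma stage_error_arithmetic:
  fixes c \<eta> :: real
  assumes c: "1 \<le> c" and \<eta>: "0 < \<eta>"
  shows "\<exists>\<sigma>>0. \<exists>C\<ge>0. \<forall>s r X Z e \<zeta> dX dZ :: real.
    0 \<le> s \<longrightarrow> 0 \<le> X \<longrightarrow> 0 \<le> Z \<longrightarrow> 0 \<le> e \<longrightarrow> 0 \<le> \<zeta> \<longrightarrow> 0 \<le> dX \<longrightarrow> 0 \<le> dZ \<longrightarrow>
    s \<le> \<sigma> * s + c * (\<zeta> + dZ) + c * X + \<sigma> * Z \<longrightarrow> r \<le> \<sigma> * s + c * dZ + c * X + \<sigma> * Z \<longrightarrow>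
    Z \<le> c * (s + \<zeta> + dZ) \<longrightarrow> X \<le> \<sigma> * (X + Z) + c * (e + dX) \<longrightarrow>
    X \<le> C * (e + \<zeta> + dX + dZ) \<and> Z \<le> C * (e + \<zeta> + dX + dZ) \<and> r \<le> \<eta> * \<zeta> + C * (e + dX + dZ)"
proof -
  define \<sigma> where "\<sigma> = min (1 / (2 * (1 + (2 * c + 1) * c))) (\<eta> / (35 * c ^ 4))"
  define C where "C = 11 * c ^ 3 + \<eta> + 2 * c ^ 2"
  have pos: "0 < 1 + (2 * c + 1) * c" using c by (intro add_pos_nonneg mult_nonneg_nonneg) auto
  have \<sigma>: "0 < \<sigma>" using c \<eta> pos by (simp add: \<sigma>_def)
  have \<sigma>1: "\<sigma> * (1 + (2 * c + 1) * c) \<le> 1 / 2"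
  proof -
    have "\<sigma> \<le> 1 / (2 * (1 + (2 * c + 1) * c))" by (simp add: \<sigma>_def)
    then show ?thesis using pos by (simp add: field_simps)
  qed
  have \<sigma>2: "\<sigma> * (35 * c ^ 4) \<le> \<eta>"
  proof -
    have "\<sigma> \<le> \<eta> / (35 * c ^ 4)" by (simp add: \<sigma>_def)
    then show ?thesis using c by (simp add: field_simps)
  qed
  have \<sigma>h: "\<sigma> \<le> 1 / 2"
  proof -
    have "\<sigma> * 1 \<le> \<sigma> * (1 + (2 * c + 1) * c)" using \<sigma> c by (intro mult_left_mono) auto
    then show ?thesis using \<sigma>1 by simp
  qed
  have C: "0 \<le> C" using c \<eta> by (simp add: C_def)
  have pw: "1 \<le> c ^ k" "c ^ k \<le> c ^ l" if "k \<le> l" for k l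
    using c that by (auto intro: one_le_power power_increasing)
  show ?thesis
  proof (rule exI[of _ \<sigma>], intro conjI \<sigma>, rule exI[of _ C], intro conjI C allI impI)
    fix s r X Z e \<zeta> dX dZ :: real
    assume nn: "0 \<le> s" "0 \<le> X" "0 \<le> Z" "0 \<le> e" "0 \<le> \<zeta>" "0 \<le> dX" "0 \<le> dZ"
      and s: "s \<le> \<sigma> * s + c * (\<zeta> + dZ) + c * X + \<sigma> * Z"
      and r: "r \<le> \<sigma> * s + c * dZ + c * X + \<sigma> * Z"
      and Z: "Z \<le> c * (s + \<zeta> + dZ)" and X: "X \<le> \<sigma> * (X + Z) + c * (e + dX)"
    define S where "S = e + \<zeta> + dX + dZ"
    have S: "0 \<le> S" using nn by (simp add: S_def)
    have "\<sigma> * X \<le> 1 / 2 * X" using \<sigma>h nn by (intro mult_right_mono) auto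
    then have X2: "X \<le> 2 * (\<sigma> * Z) + 2 * (c * (e + dX))" using X by (simp add: distrib_left)
    then have cX: "c * X \<le> 2 * c * (\<sigma> * Z) + 2 * c ^ 2 * (e + dX)"
      using mult_left_mono[OF X2, of c] c by (simp add: algebra_simps power2_eq_square)
    have \<sigma>Z: "\<sigma> * Z \<le> \<sigma> * c * s + c * (\<zeta> + dZ)"
    proof -
      have "\<sigma> * Z \<le> \<sigma> * (c * (s + \<zeta> + dZ))" using Z \<sigma> by (intro mult_left_mono) auto
      moreover have "\<sigma> * (c * (\<zeta> + dZ)) \<le> 1 * (c * (\<zeta> + dZ))"
        using \<sigma>h nn c by (intro mult_right_mono) auto
      ultimately show ?thesis by (simp add: algebra_simps)
    qed
    have "s \<le> \<sigma> * s + c * (\<zeta> + dZ) + (2 * c + 1) * (\<sigma> * Z) + 2 * c ^ 2 * (e + dX)"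
      using s cX by (simp add: algebra_simps)
    also have "(2 * c + 1) * (\<sigma> * Z) \<le> (2 * c + 1) * (\<sigma> * c * s + c * (\<zeta> + dZ))"
      using \<sigma>Z c by (intro mult_left_mono) auto
    finally have "s \<le> \<sigma> * (1 + (2 * c + 1) * c) * s + (2 * c ^ 2 + 2 * c) * (\<zeta> + dZ) + 2 * c ^ 2 * (e + dX)"
      by (simp add: algebra_simps power2_eq_square)
    moreover have "\<sigma> * (1 + (2 * c + 1) * c) * s \<le> 1 / 2 * s" using \<sigma>1 nn by (intro mult_right_mono) auto
    ultimately have "s \<le> 2 * ((2 * c ^ 2 + 2 * c) * (\<zeta> + dZ)) + 4 * c ^ 2 * (e + dX)" by simp
    also have "\<dots> \<le> 8 * c ^ 2 * S"
    proof -
      have "c * (\<zeta> + dZ) \<le> c ^ 2 * (\<zeta> + dZ)" using pw(2)[of 1 2] nn by (intro mult_right_mono) auto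
      moreover have "0 \<le> c ^ 2 * (e + dX)" using nn by simp
      ultimately show ?thesis by (simp add: S_def algebra_simps)
    qed
    finally have sS: "s \<le> 8 * c ^ 2 * S" .
    have "Z \<le> c * (8 * c ^ 2 * S + S)"
      by (rule order_trans[OF Z mult_left_mono]) (use sS nn c in \<open>auto simp: S_def\<close>)
    also have "\<dots> \<le> 9 * c ^ 3 * S"
    proof -
      have "c * S \<le> c ^ 3 * S" using pw(2)[of 1 3] S by (intro mult_right_mono) auto
      then show ?thesis by (simp add: algebra_simps power3_eq_cube power2_eq_square)
    qed
    finally have ZS: "Z \<le> 9 * c ^ 3 * S" .
    have eS: "c * (e + dX) \<le> c ^ 3 * S"
      using pw(2)[of 1 3] nn c by (intro mult_mono) (auto simp: S_def)
    have "\<sigma> * Z \<le> 1 / 2 * Z" using \<sigma>h nn by (intro mult_right_mono) auto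
    then have XS: "X \<le> 11 * c ^ 3 * S" using X2 ZS eS by simp
    have CS: "11 * c ^ 3 * S \<le> C * S" using \<eta> c S by (intro mult_right_mono) (auto simp: C_def)
    have "r \<le> \<sigma> * s + c * dZ + 2 * c ^ 2 * (e + dX) + (2 * c + 1) * (\<sigma> * Z)"
      using r cX by (simp add: algebra_simps)
    moreover have "\<sigma> * s \<le> \<sigma> * (8 * c ^ 4 * S)"
    proof -
      have "8 * c ^ 2 * S \<le> 8 * c ^ 4 * S" using pw(2)[of 2 4] S by (intro mult_right_mono) auto
      then show ?thesis using sS \<sigma> by (intro mult_left_mono) auto
    qed
    moreover have "(2 * c + 1) * (\<sigma> * Z) \<le> \<sigma> * (27 * c ^ 4 * S)"
    proof -
      have "(2 * c + 1) * Z \<le> (3 * c) * (9 * c ^ 3 * S)" using c ZS nn by (intro mult_mono) auto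
      also have "\<dots> = 27 * c ^ 4 * S" by (simp add: power4_eq_xxxx power3_eq_cube)
      finally show ?thesis using \<sigma> mult_left_mono[of "(2 * c + 1) * Z" "27 * c ^ 4 * S" \<sigma>]
        by (simp add: mult_ac)
    qed
    moreover have "\<sigma> * (8 * c ^ 4 * S) + \<sigma> * (27 * c ^ 4 * S) \<le> \<eta> * S"
      using mult_right_mono[OF \<sigma>2 S] by (simp add: algebra_simps)
    moreover have "c * dZ \<le> 2 * c ^ 2 * dZ"
      using pw(2)[of 1 2] nn c by (intro mult_right_mono) auto
    moreover have "2 * c ^ 2 * (e + dX + dZ) = 2 * c ^ 2 * (e + dX) + 2 * c ^ 2 * dZ"
      by (simp add: distrib_left)
    ultimately have "r \<le> \<eta> * S + 2 * c ^ 2 * (e + dX + dZ)" by linarith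
    also have "\<dots> \<le> \<eta> * \<zeta> + C * (e + dX + dZ)"
    proof -
      have "0 \<le> 11 * c ^ 3 * (e + dX + dZ)" using c nn by simp
      then show ?thesis by (simp add: S_def C_def algebra_simps)
    qed
    finally show "r \<le> \<eta> * \<zeta> + C * (e + dX + dZ)" .
    show "X \<le> C * (e + \<zeta> + dX + dZ)" "Z \<le> C * (e + \<zeta> + dX + dZ)"
    proof -
      show "X \<le> C * (e + \<zeta> + dX + dZ)" using XS CS unfolding S_def by linarith
      have "9 * c ^ 3 * S \<le> 11 * c ^ 3 * S" using c S by (intro mult_right_mono) auto
      then show "Z \<le> C * (e + \<zeta> + dX + dZ)" using ZS CS unfolding S_def by linarith
    qed
  qed
qed

text \<open>All stages lie in one ball, so that a single linearization serves for them.\<close>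

definition near :: "'a::metric_space \<times> 'a \<Rightarrow> real \<Rightarrow> 'a^'s \<Rightarrow> 'a^'s \<Rightarrow> bool" where
  "near w \<rho> X Z \<longleftrightarrow> (\<forall>i. (X $ i, Z $ i) \<in> ball w \<rho>)"

lemma near_mono: "near w \<rho> X Z \<Longrightarrow> dist w w' + \<rho> \<le> \<rho>' \<Longrightarrow> near w' \<rho>' X Z"
  unfolding near_def mem_ball
proof
  fix i assume "\<forall>i. dist w (X $ i, Z $ i) < \<rho>" "dist w w' + \<rho> \<le> \<rho>'"
  then show "dist w' (X $ i, Z $ i) < \<rho>'"
    using dist_triangle3[of w' "(X $ i, Z $ i)" w] by (smt (verit))
qed

lemma norm_le_rows_norm:
  fixes Y :: "real^'m^'n" and P Q :: "real^'m^'n"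
  assumes "\<And>i. norm (Y $ i) \<le> a * norm (P $ i) + b * norm (Q $ i)" "0 \<le> a" "0 \<le> b"
  shows "norm Y \<le> real CARD('n) * (a * norm P + b * norm Q)"
proof -
  have "norm (Y $ i) \<le> a * norm P + b * norm Q" for i
    by (rule order_trans[OF assms(1) add_mono[OF mult_left_mono mult_left_mono]])
      (use assms in \<open>auto intro: Finite_Cartesian_Product.norm_nth_le\<close>)
  then have "(\<Sum>i\<in>UNIV. norm (Y $ i)) \<le> (\<Sum>i\<in>(UNIV :: 'n set). a * norm P + b * norm Q)"
    by (intro sum_mono)
  moreover have "norm Y \<le> (\<Sum>i\<in>UNIV. norm (Y $ i))"
    unfolding norm_vec_def[of Y] by (rule L2_set_le_sum) simp
  ultimately show ?thesis by simp
qed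

lemma stagewise_lipschitz:
  fixes F :: "(real^'m) \<times> (real^'m) \<Rightarrow> real^'m"
  assumes "open \<Omega>" "smooth_on \<Omega> F" "w \<in> \<Omega>"
  shows "\<exists>L\<ge>0. \<exists>\<rho>>0. \<forall>(X::real^'m^'s) Z X' Z'. near w \<rho> X Z \<longrightarrow> near w \<rho> X' Z' \<longrightarrow>
    norm (stagewise F X Z - stagewise F X' Z') \<le> L * (norm (X - X') + norm (Z - Z'))"
proof -
  let ?D = "frechet_derivative F (at w)"
  have lin: "linear ?D"
    using smooth_on_differentiable[OF assms(2,3)] linear_frechet_derivative by blast
  obtain B where B: "0 < B" "\<And>v. norm (?D v) \<le> B * norm v" using linear_bounded_pos[OF lin] by blast
  obtain \<rho> where \<rho>: "0 < \<rho>" "\<And>u v. u \<in> ball w \<rho> \<Longrightarrow> v \<in> ball w \<rho> \<Longrightarrow>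
      norm (F u - F v - ?D (u - v)) \<le> 1 * norm (u - v)"
    using smooth_linearization[OF assms zero_less_one] by blast
  have "norm (stagewise F X Z - stagewise F X' Z') \<le> (real CARD('s) * (B + 1)) * (norm (X - X') + norm (Z - Z'))"
    if "near w \<rho> X Z" "near w \<rho> X' Z'" for X Z X' Z' :: "real^'m^'s"
  proof -
    have "norm ((stagewise F X Z - stagewise F X' Z') $ i)
        \<le> (B + 1) * norm ((X - X') $ i) + (B + 1) * norm ((Z - Z') $ i)" for i
    proof -
      let ?u = "(X $ i, Z $ i)" and ?v = "(X' $ i, Z' $ i)"
      have uv: "?u \<in> ball w \<rho>" "?v \<in> ball w \<rho>" using that by (simp_all add: near_def)
      have "norm (F ?u - F ?v) \<le> norm (?D (?u - ?v)) + 1 * norm (?u - ?v)"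
        using \<rho>(2)[OF uv] norm_triangle_sub[of "F ?u - F ?v" "?D (?u - ?v)"] by linarith
      also have "\<dots> \<le> (B + 1) * norm (?u - ?v)" using B(2)[of "?u - ?v"] by (simp add: distrib_right)
      also have "\<dots> \<le> (B + 1) * (norm ((X - X') $ i) + norm ((Z - Z') $ i))"
        using B(1) norm_Pair_le[of "X $ i - X' $ i" "Z $ i - Z' $ i"] by (intro mult_left_mono) auto
      finally show ?thesis by (simp add: stagewise_def distrib_left)
    qed
    from norm_le_rows_norm[OF this] B(1) show ?thesis by (simp add: algebra_simps)
  qed
  then show ?thesis using B(1) \<rho>(1) by (intro exI[of _ "real CARD('s) * (B + 1)"] conjI exI[of _ \<rho>]) auto
qed

lemma partial_z_derivative:
  fixes g :: "(real^'m) \<times> (real^'m) \<Rightarrow> real^'m"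
  assumes "g differentiable (at w)"
  shows "partial_z g w *v v = frechet_derivative g (at w) (0, v)"
proof -
  have g: "(g has_derivative frechet_derivative g (at w)) (at w)"
    using assms frechet_derivative_works by blast
  have "((\<lambda>v. (fst w, v)) has_derivative (\<lambda>v. (0, v))) (at (snd w))"
    by (auto intro!: derivative_eq_intros)
  from diff_chain_at[OF this, of g "frechet_derivative g (at w)"] g
  have d: "((\<lambda>v. g (fst w, v)) has_derivative (\<lambda>v. frechet_derivative g (at w) (0, v))) (at (snd w))"
    by (simp add: o_def)
  then have "(\<lambda>v. g (fst w, v)) differentiable (at (snd w))" by (auto simp: differentiable_def)
  from this[unfolded jacobian_works]
  have "((\<lambda>v. g (fst w, v)) has_derivative (*v) (partial_z g w)) (at (snd w))"
    unfolding partial_z_def by simp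
  from has_derivative_unique[OF this d] show ?thesis by metis
qed

text \<open>The constant \<open>L\<close> does not depend on \<open>\<eta>\<close>: only the nonlinearity in the stiff variable has to be small,
  the coupling to \<open>X\<close> may be of order one.\<close>

lemma stagewise_linearization:
  fixes g :: "(real^'m) \<times> (real^'m) \<Rightarrow> real^'m"
  assumes "open \<Omega>" "smooth_on \<Omega> g" "w \<in> \<Omega>"
  shows "\<exists>L\<ge>0. \<forall>\<eta>>0. \<eta> \<le> 1 \<longrightarrow> (\<exists>\<rho>>0. \<forall>(X::real^'m^'s) Z X' Z'. near w \<rho> X Z \<longrightarrow> near w \<rho> X' Z' \<longrightarrow>
    norm (stagewise g X Z - stagewise g X' Z' - stage_map (partial_z g w) (Z - Z'))
      \<le> L * norm (X - X') + \<eta> * norm (Z - Z'))"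
proof -
  let ?D = "frechet_derivative g (at w)"
  have diff: "g differentiable (at w)" using smooth_on_differentiable[OF assms(2,3)] .
  have lin: "linear ?D" using diff linear_frechet_derivative by blast
  obtain B where B: "0 < B" "\<And>v. norm (?D v) \<le> B * norm v" using linear_bounded_pos[OF lin] by blast
  let ?L = "real CARD('s) * (B + 1)"
  show ?thesis
  proof (rule exI[of _ ?L], intro conjI allI impI)
    show "0 \<le> ?L" using B by simp
    fix \<eta> :: real assume \<eta>: "0 < \<eta>" "\<eta> \<le> 1"
    define \<eta>' where "\<eta>' = \<eta> / real CARD('s)"
    have card: "1 \<le> real CARD('s)" using zero_less_card_finite[where 'a = 's] by linarith
    have \<eta>': "0 < \<eta>'" "\<eta>' \<le> 1" using \<eta> card order_trans[OF \<eta>(2) card] by (simp_all add: \<eta>'_def divide_le_eq)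
    obtain \<rho> where \<rho>: "0 < \<rho>" "\<And>u v. u \<in> ball w \<rho> \<Longrightarrow> v \<in> ball w \<rho> \<Longrightarrow>
        norm (g u - g v - ?D (u - v)) \<le> \<eta>' * norm (u - v)"
      using smooth_linearization[OF assms \<eta>'(1)] by blast
    have "norm (stagewise g X Z - stagewise g X' Z' - stage_map (partial_z g w) (Z - Z'))
      \<le> ?L * norm (X - X') + \<eta> * norm (Z - Z')"
      if "near w \<rho> X Z" "near w \<rho> X' Z'" for X Z X' Z' :: "real^'m^'s"
    proof -
      have "norm ((stagewise g X Z - stagewise g X' Z' - stage_map (partial_z g w) (Z - Z')) $ i)
          \<le> (B + 1) * norm ((X - X') $ i) + \<eta>' * norm ((Z - Z') $ i)" for i
      proof -
        let ?u = "(X $ i, Z $ i)" and ?v = "(X' $ i, Z' $ i)"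
        let ?a = "(X - X') $ i" and ?b = "(Z - Z') $ i"
        have uv: "?u \<in> ball w \<rho>" "?v \<in> ball w \<rho>" using that by (simp_all add: near_def)
        have "?u - ?v = (?a, 0) + (0, ?b)" by simp
        then have "?D (?u - ?v) = ?D (?a, 0) + partial_z g w *v ?b"
          by (simp only: linear_add[OF lin] partial_z_derivative[OF diff])
        then have "(stagewise g X Z - stagewise g X' Z' - stage_map (partial_z g w) (Z - Z')) $ i
            = (g ?u - g ?v - ?D (?u - ?v)) + ?D (?a, 0)"
          by (simp add: stagewise_def stage_map_def)
        also have "norm \<dots> \<le> \<eta>' * norm (?u - ?v) + B * norm (?a, 0 :: real^'m)"
          by (rule norm_triangle_le[OF add_mono[OF \<rho>(2)[OF uv] B(2)]])
        also have "\<dots> \<le> \<eta>' * (norm ?a + norm ?b) + B * norm ?a"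
          using \<eta>'(1) B(1) norm_Pair_le[of "X $ i - X' $ i" "Z $ i - Z' $ i"]
          by (intro add_mono mult_left_mono) (auto simp: norm_Pair)
        also have "\<dots> \<le> (B + 1) * norm ?a + \<eta>' * norm ?b"
          using mult_right_mono[OF \<eta>'(2) norm_ge_zero[of ?a]] by (simp add: algebra_simps)
        finally show ?thesis .
      qed
      from norm_le_rows_norm[OF this] B(1) \<eta>'(1) show ?thesis
        by (simp add: algebra_simps \<eta>'_def)
    qed
    then show "\<exists>\<rho>>0. \<forall>(X::real^'m^'s) Z X' Z'. near w \<rho> X Z \<longrightarrow> near w \<rho> X' Z' \<longrightarrow>
      norm (stagewise g X Z - stagewise g X' Z' - stage_map (partial_z g w) (Z - Z'))
        \<le> ?L * norm (X - X') + \<eta> * norm (Z - Z')"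
      using \<rho>(1) by blast
  qed
qed

lemma norm_Pair_row_le: "dist (X $ i, Z $ i) (X' $ i, Z' $ i) \<le> norm (X - X') + norm (Z - Z')"
  for X X' Z Z' :: "real^'m^'s"
proof -
  have "dist (X $ i, Z $ i) (X' $ i, Z' $ i) \<le> norm ((X - X') $ i) + norm ((Z - Z') $ i)"
    unfolding dist_norm using norm_Pair_le[of "X $ i - X' $ i" "Z $ i - Z' $ i"] by simp
  also have "\<dots> \<le> norm (X - X') + norm (Z - Z')"
    by (intro add_mono Finite_Cartesian_Product.norm_nth_le)
  finally show ?thesis .
qed

lemma near_perturb:
  fixes X X' Z Z' :: "real^'m^'s"
  assumes "near w \<rho> X' Z'" "\<rho> + norm (X - X') + norm (Z - Z') \<le> \<rho>'"
  shows "near w \<rho>' X Z"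
  unfolding near_def mem_ball
proof
  fix i
  have "dist w (X' $ i, Z' $ i) < \<rho>" using assms(1) by (simp add: near_def)
  then show "dist w (X $ i, Z $ i) < \<rho>'"
    using dist_triangle2[of w "(X $ i, Z $ i)" "(X' $ i, Z' $ i)"] norm_Pair_row_le[of X i Z X' Z'] assms(2)
    by linarith
qed

lemma continuous_on_stagewise:
  fixes F :: "(real^'m) \<times> (real^'m) \<Rightarrow> real^'m" and X Z :: "'a::topological_space \<Rightarrow> real^'m^'s"
  assumes "continuous_on \<Omega> F" "continuous_on S X" "continuous_on S Z"
    and "\<And>y i. y \<in> S \<Longrightarrow> (X y $ i, Z y $ i) \<in> \<Omega>"
  shows "continuous_on S (\<lambda>y. stagewise F (X y) (Z y))"
  unfolding stagewise_def
  by (intro continuous_on_vec_lambda continuous_on_compose2[OF assms(1)] continuous_intros assms(2,3))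
    (use assms(4) in auto)

section \<open>Recursions and compactness\<close>

text \<open>After \<open>k\<close> steps the perturbations have contributed a multiple of \<open>\<eta>\<close> and of \<open>R\<close>; if \<open>\<eta>\<close> is small enough, the
  factor \<open>1 / 4\<close> of the unperturbed power deteriorates to \<open>1 / 2\<close> at most.\<close>

lemma perturbed_power_contraction:
  fixes M :: "'a::euclidean_space \<Rightarrow> 'a"
  assumes M: "linear M" and k: "\<And>y. norm ((M ^^ k) y) \<le> 1 / 4 * norm y"
  shows "\<exists>\<eta>>0. \<eta> \<le> 1 \<and> (\<exists>C\<ge>0. \<forall>y R j. 0 \<le> R \<longrightarrow> j \<le> k \<longrightarrow>
    (\<forall>i<j. norm (y (Suc i) - M (y i)) \<le> \<eta> * norm (y i) + R) \<longrightarrow>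
    norm (y j) \<le> C * (norm (y 0) + R) \<and> (j = k \<longrightarrow> norm (y j) \<le> 1 / 2 * norm (y 0) + C * R))"
proof -
  obtain \<mu> where \<mu>: "0 < \<mu>" "\<And>y. norm (M y) \<le> \<mu> * norm y" using linear_bounded_pos[OF M] by blast
  define G where "G = (\<mu> + 2) ^ k"
  have G: "1 \<le> G" unfolding G_def using \<mu>(1) by (intro one_le_power) simp
  define \<eta> where "\<eta> = 1 / (4 * G\<^sup>2)"
  have G2: "1 \<le> G\<^sup>2" using G by (rule one_le_power)
  have \<eta>: "0 < \<eta>" "\<eta> \<le> 1" using G2 by (auto simp: \<eta>_def divide_le_eq)
  have \<eta>G: "\<eta> * G * G = 1 / 4" using G by (simp add: \<eta>_def power2_eq_square)
  show ?thesis
  proof (rule exI[of _ \<eta>], intro conjI \<eta>, rule exI[of _ "G + 1"], rule conjI, use G in simp, intro allI impI)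
    fix y :: "nat \<Rightarrow> 'a" and R j
    assume R: "0 \<le> R" and j: "j \<le> k"
      and step: "\<forall>i<j. norm (y (Suc i) - M (y i)) \<le> \<eta> * norm (y i) + R"
    let ?Q = "norm (y 0) + R"
    have Q: "0 \<le> ?Q" using R by simp
    have growth: "norm (y i) \<le> (\<mu> + 2) ^ i * ?Q" if "i \<le> j" for i
      using that
    proof (induction i)
      case (Suc i)
      have "norm (y (Suc i)) \<le> norm (M (y i)) + norm (y (Suc i) - M (y i))"
        using norm_triangle_sub[of "y (Suc i)" "M (y i)"] by simp
      also have "\<dots> \<le> \<mu> * norm (y i) + (1 * norm (y i) + R)"
        using \<mu>(2)[of "y i"] step Suc.prems \<eta>(2) by (intro add_mono order_trans[OF step[rule_format]] mult_right_mono) auto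
      also have "\<dots> \<le> (\<mu> + 1) * ((\<mu> + 2) ^ i * ?Q) + (\<mu> + 2) ^ i * ?Q"
      proof -
        have "(\<mu> + 1) * norm (y i) \<le> (\<mu> + 1) * ((\<mu> + 2) ^ i * ?Q)"
          using Suc \<mu>(1) by (intro mult_left_mono) auto
        moreover have "1 * R \<le> (\<mu> + 2) ^ i * ?Q"
          using \<mu>(1) R by (intro mult_mono one_le_power) auto
        moreover have "(\<mu> + 1) * norm (y i) = \<mu> * norm (y i) + 1 * norm (y i)"
          by (rule distrib_right)
        ultimately show ?thesis by linarith
      qed
      finally show ?case by (simp add: algebra_simps)
    qed (use R in simp)
    have pw: "(\<mu> + 2) ^ i \<le> G" if "i \<le> j" for i
      unfolding G_def using \<mu>(1) that j by (intro power_increasing) auto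
    have yG: "norm (y i) \<le> G * ?Q" if "i \<le> j" for i
      by (rule order_trans[OF growth[OF that] mult_right_mono[OF pw[OF that] Q]])
    define q where "q = \<eta> * (G * ?Q) + R"
    have q: "0 \<le> q" using \<eta>(1) G Q R by (simp add: q_def)
    have dev: "norm (y i - (M ^^ i) (y 0)) \<le> (\<mu> + 2) ^ i * q" if "i \<le> j" for i
      using that
    proof (induction i)
      case (Suc i)
      have "y (Suc i) - (M ^^ Suc i) (y 0) = M (y i - (M ^^ i) (y 0)) + (y (Suc i) - M (y i))"
        by (simp add: linear_diff[OF M])
      also have "norm \<dots> \<le> \<mu> * ((\<mu> + 2) ^ i * q) + q"
      proof (intro norm_triangle_le add_mono)
        show "norm (M (y i - (M ^^ i) (y 0))) \<le> \<mu> * ((\<mu> + 2) ^ i * q)"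
          using Suc \<mu>(1) by (intro order_trans[OF \<mu>(2)] mult_left_mono) auto
        have "norm (y (Suc i) - M (y i)) \<le> \<eta> * norm (y i) + R" using step Suc.prems by simp
        also have "\<dots> \<le> q" unfolding q_def using yG[of i] Suc.prems \<eta>(1) by (intro add_mono mult_left_mono) auto
        finally show "norm (y (Suc i) - M (y i)) \<le> q" .
      qed
      also have "\<dots> \<le> \<mu> * ((\<mu> + 2) ^ i * q) + 2 * ((\<mu> + 2) ^ i * q)"
      proof -
        have "1 * q \<le> (\<mu> + 2) ^ i * q" using \<mu>(1) q by (intro mult_right_mono one_le_power) auto
        then show ?thesis using q \<mu>(1) by simp
      qed
      finally show ?case by (simp add: algebra_simps)
    qed (use q in simp)
    have "norm (y j) \<le> (G + 1) * ?Q"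
      using yG[of j] Q by (simp add: distrib_right)
    moreover have "norm (y j) \<le> 1 / 2 * norm (y 0) + (G + 1) * R" if jk: "j = k"
    proof -
      have "norm (y j) \<le> norm ((M ^^ k) (y 0)) + norm (y j - (M ^^ j) (y 0))"
        using norm_triangle_sub[of "y j" "(M ^^ k) (y 0)"] jk by simp
      also have "\<dots> \<le> 1 / 4 * norm (y 0) + G * q"
        using k[of "y 0"] dev[of j] by (intro add_mono) (auto simp: jk G_def)
      also have "G * q = (\<eta> * G * G) * ?Q + G * R" by (simp add: q_def algebra_simps)
      also have "1 / 4 * norm (y 0) + ((\<eta> * G * G) * ?Q + G * R) \<le> 1 / 2 * norm (y 0) + (G + 1) * R"
        unfolding \<eta>G using R by (simp add: algebra_simps add_divide_distrib)
      finally show ?thesis .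
    qed
    ultimately show "norm (y j) \<le> (G + 1) * ?Q \<and> (j = k \<longrightarrow> norm (y j) \<le> 1 / 2 * norm (y 0) + (G + 1) * R)"
      by blast
  qed
qed

text \<open>Monotonicity in the constant lets the maximum over a finite subcover serve everywhere.\<close>

lemma compact_uniform_constant:
  fixes P :: "'a::metric_space set"
  assumes P: "compact P"
    and loc: "\<And>p. p \<in> P \<Longrightarrow> \<exists>\<rho>>0. \<exists>C. \<forall>q\<in>P. dist p q < \<rho> \<longrightarrow> Q q C"
    and mono: "\<And>q C C'. Q q C \<Longrightarrow> C \<le> (C'::real) \<Longrightarrow> Q q C'"
  shows "\<exists>C. \<forall>q\<in>P. Q q C"
proof -
  have "\<forall>p\<in>P. \<exists>\<rho> C. 0 < \<rho> \<and> (\<forall>q\<in>P. dist p q < \<rho> \<longrightarrow> Q q C)" using loc by blast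
  then obtain \<rho> C where \<rho>: "\<And>p. p \<in> P \<Longrightarrow> 0 < \<rho> p" "\<And>p q. p \<in> P \<Longrightarrow> q \<in> P \<Longrightarrow> dist p q < \<rho> p \<Longrightarrow> Q q (C p)"
    by metis
  have "P \<subseteq> (\<Union>p\<in>P. ball p (\<rho> p))" using \<rho>(1) by force
  then obtain F where F: "F \<subseteq> P" "finite F" "P \<subseteq> (\<Union>p\<in>F. ball p (\<rho> p))"
    using compactE_image[OF P, of P "\<lambda>p. ball p (\<rho> p)"] by auto
  have "Q q (Max (C ` F))" if "q \<in> P" for q
  proof -
    obtain p where p: "p \<in> F" "dist p q < \<rho> p" using F(3) \<open>q \<in> P\<close> by auto
    have "Q q (C p)" using \<rho>(2)[of p q] p F(1) that by blast
    then show ?thesis by (rule mono) (use F(2) p(1) in simp)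
  qed
  then show ?thesis by blast
qed

text \<open>Values at block ends stay below \<open>Y\<close>, and inside a block they grow by at most the factor \<open>C\<close>. The length
  \<open>k\<close> may vary from block to block; the last block may be incomplete.\<close>

lemma bounded_by_contracting_blocks:
  fixes y :: "nat \<Rightarrow> real"
  assumes block: "\<And>n. n \<le> N \<Longrightarrow> \<exists>k\<ge>1. \<forall>j\<le>k. n + j \<le> N \<longrightarrow>
      y (n + j) \<le> C * (y n + R) \<and> (j = k \<longrightarrow> y (n + j) \<le> 1 / 2 * y n + C * R)"
    and C: "0 \<le> C" and R: "0 \<le> R" and Y: "2 * (C * R) \<le> Y" "y 0 \<le> Y" and n: "n \<le> N"
  shows "y n \<le> C * (Y + R)"
proof -
  have "y m \<le> Y \<longrightarrow> (\<forall>n. m \<le> n \<longrightarrow> n \<le> N \<longrightarrow> y n \<le> C * (Y + R))" if "m \<le> N" for m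
    using that
  proof (induction "N - m" arbitrary: m rule: less_induct)
    case less
    show ?case
    proof (intro impI allI)
      fix n assume m: "y m \<le> Y" and n: "m \<le> n" "n \<le> N"
      obtain k where k: "1 \<le> k" "\<And>j. j \<le> k \<Longrightarrow> m + j \<le> N \<Longrightarrow>
          y (m + j) \<le> C * (y m + R) \<and> (j = k \<longrightarrow> y (m + j) \<le> 1 / 2 * y m + C * R)"
        using block[OF less.prems] by blast
      show "y n \<le> C * (Y + R)"
      proof (cases "n \<le> m + k")
        case True
        then have "y n \<le> C * (y m + R)" using k(2)[of "n - m"] n by simp
        also have "\<dots> \<le> C * (Y + R)" using m C by (intro mult_left_mono) auto
        finally show ?thesis .
      next
        case False
        have "y (m + k) \<le> 1 / 2 * y m + C * R" using k(2)[of k] False n by simp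
        then have "y (m + k) \<le> Y" using m Y(1) by simp
        then show ?thesis using less.hyps[of "m + k"] k(1) False n by auto
      qed
    qed
  qed
  from this[of 0] show ?thesis using Y(2) n by simp
qed

text \<open>The right-hand side is the summed form of the recursion solved by \<open>a (1 + b h)\<^sup>n\<close>.\<close>

lemma discrete_gronwall:
  fixes e :: "nat \<Rightarrow> real"
  assumes step: "\<And>n. n \<le> N \<Longrightarrow> (\<And>i. i < n \<Longrightarrow> e i \<le> a * (1 + b * h) ^ i) \<Longrightarrow>
      e n \<le> a + b * h * (\<Sum>j<n. a * (1 + b * h) ^ j)"
    and n: "n \<le> N"
  shows "e n \<le> a * (1 + b * h) ^ n"
  using n
proof (induction n rule: less_induct)
  case (less n)
  have "e n \<le> a + b * h * (\<Sum>j<n. a * (1 + b * h) ^ j)" using step less by simp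
  also have "\<dots> = a + a * (b * h * (\<Sum>j<n. (1 + b * h) ^ j))"
    by (simp add: sum_distrib_left mult_ac)
  also have "b * h * (\<Sum>j<n. (1 + b * h) ^ j) = (1 + b * h) ^ n - 1"
    using power_diff_1_eq[of "1 + b * h" n] by simp
  finally show ?case by (simp add: algebra_simps)
qed

lemma uniform_over_parameters:
  fixes Q :: "real \<Rightarrow> real \<Rightarrow> real \<Rightarrow> bool"
  assumes loc: "\<And>\<theta>\<^sub>0 \<tau>\<^sub>0. \<theta>\<^sub>0 \<in> {0..\<theta>m} \<Longrightarrow> \<tau>\<^sub>0 \<in> {t0..t1} \<Longrightarrow>
      \<exists>\<rho>>0. \<exists>C. \<forall>\<theta>\<in>{0..\<theta>m}. \<forall>\<tau>\<in>{t0..t1}. \<bar>\<theta> - \<theta>\<^sub>0\<bar> \<le> \<rho> \<longrightarrow> \<bar>\<tau> - \<tau>\<^sub>0\<bar> \<le> \<rho> \<longrightarrow> Q \<theta> \<tau> C"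
    and mono: "\<And>\<theta> \<tau> C C'. Q \<theta> \<tau> C \<Longrightarrow> C \<le> (C'::real) \<Longrightarrow> Q \<theta> \<tau> C'"
  shows "\<exists>C. \<forall>\<theta>\<in>{0..\<theta>m}. \<forall>\<tau>\<in>{t0..t1}. Q \<theta> \<tau> C"
proof -
  have "\<exists>C. \<forall>q\<in>{0..\<theta>m} \<times> {t0..t1}. Q (fst q) (snd q) C"
  proof (rule compact_uniform_constant[where Q = "\<lambda>q. Q (fst q) (snd q)"])
    show "compact ({0..\<theta>m} \<times> {t0..t1})" by (intro compact_Times) auto
    fix p :: "real \<times> real" assume p: "p \<in> {0..\<theta>m} \<times> {t0..t1}"
    obtain \<rho> C where \<rho>: "0 < \<rho>" "\<And>\<theta> \<tau>. \<theta> \<in> {0..\<theta>m} \<Longrightarrow> \<tau> \<in> {t0..t1} \<Longrightarrow>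
        \<bar>\<theta> - fst p\<bar> \<le> \<rho> \<Longrightarrow> \<bar>\<tau> - snd p\<bar> \<le> \<rho> \<Longrightarrow> Q \<theta> \<tau> C"
  proof -
    have "fst p \<in> {0..\<theta>m}" "snd p \<in> {t0..t1}" using p by (auto simp: mem_Times_iff)
    from loc[OF this] obtain \<rho> C where "0 < \<rho>" "\<forall>\<theta>\<in>{0..\<theta>m}. \<forall>\<tau>\<in>{t0..t1}.
        \<bar>\<theta> - fst p\<bar> \<le> \<rho> \<longrightarrow> \<bar>\<tau> - snd p\<bar> \<le> \<rho> \<longrightarrow> Q \<theta> \<tau> C" by blast
    then show ?thesis by (intro that[of \<rho> C]) auto
  qed
    have "Q (fst q) (snd q) C" if "q \<in> {0..\<theta>m} \<times> {t0..t1}" "dist p q < \<rho>" for q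
      using that dist_fst_le[of q p] dist_snd_le[of q p]
      by (intro \<rho>(2)) (auto simp: dist_real_def dist_commute)
    then show "\<exists>\<rho>>0. \<exists>C. \<forall>q\<in>{0..\<theta>m} \<times> {t0..t1}. dist p q < \<rho> \<longrightarrow> Q (fst q) (snd q) C"
      using \<rho>(1) by blast
  qed (rule mono)
  then show ?thesis by auto
qed

lemma reciprocal_antimono: "0 < C \<Longrightarrow> C \<le> C' \<Longrightarrow> 1 / C' \<le> 1 / (C::real)"
  by (simp add: frac_le)

lemma near_weaken: "near w \<rho> X Z \<Longrightarrow> \<rho> \<le> \<rho>' \<Longrightarrow> near w \<rho>' X Z"
  by (rule near_mono[of w \<rho> X Z w]) simp_all

lemma norm_matrix_mult_le: "norm (W ** Y) \<le> real CARD('k) * (real CARD('n) * (norm W * norm Y))"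
  for W :: "real^'n^'k" and Y :: "real^'m^'n"
proof -
  have "norm ((W ** Y) $ i) \<le> real CARD('n) * (norm W * norm Y)" for i
  proof -
    have "norm ((W ** Y) $ i) \<le> (\<Sum>k\<in>(UNIV :: 'n set). norm W * norm Y)"
      unfolding matrix_mult_row
    proof (rule sum_norm_le)
      fix k
      have "\<bar>W $ i $ k\<bar> \<le> norm W"
        using component_le_norm_cart[of "W $ i" k] Finite_Cartesian_Product.norm_nth_le[of W i] by linarith
      then show "norm (W $ i $ k *\<^sub>R Y $ k) \<le> norm W * norm Y"
        unfolding norm_scaleR real_norm_def
        by (intro mult_mono Finite_Cartesian_Product.norm_nth_le) auto
    qed
    then show ?thesis by simp
  qed
  from norm_le_rows[OF this] show ?thesis .
qed

lemma power_bounded_uniform: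
  fixes V :: "real^'r^'r"
  assumes "power_bounded V"
  shows "\<exists>P\<ge>1. \<forall>k. \<forall>Y :: real^'m^'r. norm ((((**) V) ^^ k) Y) \<le> P * norm Y"
proof -
  obtain b where b: "\<And>k. norm ((((**) V) ^^ k) (mat 1)) \<le> b"
    using assms unfolding power_bounded_def bounded_iff by auto
  let ?c = "real CARD('r)"
  have eq: "(((**) V) ^^ k) Y = (((**) V) ^^ k) (mat 1) ** Y" for k and Y :: "real^'m^'r"
    by (induction k) (simp_all add: matrix_mul_assoc)
  have "norm ((((**) V) ^^ k) Y) \<le> max 1 (?c * (?c * \<bar>b\<bar>)) * norm Y" for k and Y :: "real^'m^'r"
  proof -
    have "norm ((((**) V) ^^ k) Y) \<le> ?c * (?c * (norm ((((**) V) ^^ k) (mat 1)) * norm Y))"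
      by (subst eq) (rule norm_matrix_mult_le)
    also have "\<dots> \<le> ?c * (?c * (\<bar>b\<bar> * norm Y))"
      using b[of k] by (intro mult_left_mono mult_right_mono) auto
    also have "\<dots> = (?c * (?c * \<bar>b\<bar>)) * norm Y" by simp
    also have "\<dots> \<le> max 1 (?c * (?c * \<bar>b\<bar>)) * norm Y" by (intro mult_right_mono) auto
    finally show ?thesis .
  qed
  then show ?thesis by (intro exI[of _ "max 1 (?c * (?c * \<bar>b\<bar>))"]) auto
qed

text \<open>Estimating all powers of \<open>V\<close> applied to \<open>x n\<close> at the same time makes the induction work without
  an explicit convolution.\<close>

lemma perturbed_power_bounded_recursion:
  fixes x :: "nat \<Rightarrow> real^'m^'r" and V :: "real^'r^'r"
  assumes P: "\<And>k (Y :: real^'m^'r). norm ((((**) V) ^^ k) Y) \<le> P * norm Y"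
    and x: "\<And>n. n < N \<Longrightarrow> x (Suc n) = V ** x n + q n" and n: "n \<le> N"
  shows "norm (x n) \<le> P * (norm (x 0) + (\<Sum>j<n. norm (q j)))"
proof -
  have "\<forall>k. norm ((((**) V) ^^ k) (x n)) \<le> P * (norm (x 0) + (\<Sum>j<n. norm (q j)))"
    using n
  proof (induction n)
    case 0
    then show ?case using P by simp
  next
    case (Suc n)
    show ?case
    proof
      fix k
      have lin: "linear (((**) V :: real^'m^'r \<Rightarrow> real^'m^'r) ^^ k)" by (rule funpow_linear[OF linear_matrix_mult])
      have "(((**) V) ^^ k) (x (Suc n)) = (((**) V) ^^ Suc k) (x n) + (((**) V) ^^ k) (q n)"
        using x[of n] Suc.prems by (simp add: linear_add[OF lin] funpow_swap1)
      also have "norm \<dots> \<le> P * (norm (x 0) + (\<Sum>j<n. norm (q j))) + P * norm (q n)"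
        using Suc P by (intro norm_triangle_le add_mono) (auto simp del: funpow.simps)
      finally show "norm ((((**) V) ^^ k) (x (Suc n))) \<le> P * (norm (x 0) + (\<Sum>j<Suc n. norm (q j)))"
        by (simp add: distrib_left add.assoc)
    qed
  qed
  from this[THEN spec, of 0] show ?thesis by simp
qed

section \<open>One step, uniformly in the parameters\<close>

text \<open>The data of the scheme, with the properties that the spectral arguments use. All estimates in this
  context are relative to reference stage values, which later are those of the exact solution.\<close>

locale imex_problem =
  fixes f g :: "(real^'m) \<times> (real^'m) \<Rightarrow> real^'m" and \<Omega> :: "((real^'m) \<times> (real^'m)) set"
    and A\<^sub>E A\<^sub>I :: "real^'s^'s" and U\<^sub>E U\<^sub>I :: "real^'r^'s"
    and B\<^sub>E B\<^sub>I :: "real^'s^'r" and V\<^sub>E V\<^sub>I :: "real^'r^'r"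
  assumes \<Omega>: "open \<Omega>" "smooth_on \<Omega> f" "smooth_on \<Omega> g"
    and A: "positive_spectrum A\<^sub>I"
    and J: "\<And>w. w \<in> \<Omega> \<Longrightarrow> dissipative (partial_z g w)"
begin

text \<open>The stage equations minus those of the reference values \<open>X'\<close>, \<open>Z'\<close>: \<open>\<Delta>\<xi>\<close>, \<open>\<Delta>\<zeta>\<close> are incoming errors, \<open>dX\<close>, \<open>dZ\<close>
  are residuals, and \<open>\<gamma>\<close> is \<open>h / \<epsilon>\<close> times the error of \<open>g\<close>. Nothing is divided by \<open>\<epsilon>\<close>, so the estimates
  are uniform up to \<open>\<theta> = 0\<close>.\<close>

definition stage_errors where
  "stage_errors \<theta> h X' Z' X Z \<gamma> \<Delta>\<xi> \<Delta>\<zeta> dX dZ \<longleftrightarrow>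
     X - X' = h *\<^sub>R (A\<^sub>E ** (stagewise f X Z - stagewise f X' Z')) + U\<^sub>E ** \<Delta>\<xi> + dX \<and>
     Z - Z' = A\<^sub>I ** \<gamma> + U\<^sub>I ** \<Delta>\<zeta> + dZ \<and>
     \<theta> *\<^sub>R \<gamma> = stagewise g X Z - stagewise g X' Z'"

text \<open>With \<open>\<theta>\<close> and \<open>g\<^sub>z\<close> frozen at \<open>\<theta>\<^sub>0\<close> and \<open>w\<close>, the slopes \<open>\<gamma>\<close> solve a linear equation for the stage operator,
  whose right-hand side consists of the data and of feedback terms. Those caused by freezing and by the
  nonlinearity are small multiples of \<open>\<gamma>\<close> and of the error of \<open>Z\<close>; the feedback into \<open>X\<close> is small because of the factor \<open>h\<close>.\<close>

lemma stage_error_bounds: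
  assumes w: "w \<in> \<Omega>" and \<theta>: "0 \<le> \<theta>\<^sub>0" and \<eta>: "0 < \<eta>"
  shows "\<exists>\<rho>>0. \<exists>C\<ge>0. \<forall>\<theta> h X' Z' X Z \<gamma> \<Delta>\<xi> \<Delta>\<zeta> dX dZ.
    \<bar>\<theta> - \<theta>\<^sub>0\<bar> \<le> \<rho> \<longrightarrow> 0 < h \<longrightarrow> h \<le> \<rho> \<longrightarrow> near w \<rho> X Z \<longrightarrow> near w \<rho> X' Z' \<longrightarrow>
    stage_errors \<theta> h X' Z' X Z \<gamma> \<Delta>\<xi> \<Delta>\<zeta> dX dZ \<longrightarrow>
    norm (stagewise f X Z - stagewise f X' Z') \<le> C * (norm \<Delta>\<xi> + norm \<Delta>\<zeta> + norm dX + norm dZ) \<and>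
    norm (\<gamma> - stage_response \<theta>\<^sub>0 (partial_z g w) A\<^sub>I U\<^sub>I \<Delta>\<zeta>)
      \<le> \<eta> * norm \<Delta>\<zeta> + C * (norm \<Delta>\<xi> + norm dX + norm dZ)"
proof -
  let ?J = "partial_z g w"
  let ?K = "inv (stage_operator \<theta>\<^sub>0 ?J A\<^sub>I) :: real^'m^'s \<Rightarrow> real^'m^'s"
  note linK = inv_stage_operator(1)[OF A J[OF w] \<theta>] and linT = linear_stage_map[of ?J]
  obtain \<kappa> where \<kappa>: "0 < \<kappa>" "\<And>Y. norm (?K Y) \<le> \<kappa> * norm Y" using linear_bounded_pos[OF linK] by blast
  obtain \<tau> where \<tau>: "0 < \<tau>" "\<And>Y::real^'m^'s. norm (stage_map ?J Y) \<le> \<tau> * norm Y"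
    using linear_bounded_pos[OF linT] by blast
  obtain aE where aE: "0 < aE" "\<And>Y::real^'m^'s. norm (A\<^sub>E ** Y) \<le> aE * norm Y" using matrix_mult_bound by blast
  obtain aI where aI: "0 < aI" "\<And>Y::real^'m^'s. norm (A\<^sub>I ** Y) \<le> aI * norm Y" using matrix_mult_bound by blast
  obtain uE where uE: "0 < uE" "\<And>Y::real^'m^'r. norm (U\<^sub>E ** Y) \<le> uE * norm Y" using matrix_mult_bound by blast
  obtain uI where uI: "0 < uI" "\<And>Y::real^'m^'r. norm (U\<^sub>I ** Y) \<le> uI * norm Y" using matrix_mult_bound by blast
  obtain Lf \<rho>f where Lf: "0 \<le> Lf" "0 < \<rho>f" "\<And>(X::real^'m^'s) Z X' Z'. near w \<rho>f X Z \<Longrightarrow> near w \<rho>f X' Z' \<Longrightarrow>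
    norm (stagewise f X Z - stagewise f X' Z') \<le> Lf * (norm (X - X') + norm (Z - Z'))"
    using stagewise_lipschitz[OF \<Omega>(1,2) w, where 's = 's] by metis
  obtain Lg where Lg: "0 \<le> Lg" "\<forall>\<eta>>0. \<eta> \<le> 1 \<longrightarrow> (\<exists>\<rho>>0. \<forall>(X::real^'m^'s) Z X' Z'. near w \<rho> X Z \<longrightarrow> near w \<rho> X' Z' \<longrightarrow>
    norm (stagewise g X Z - stagewise g X' Z' - stage_map ?J (Z - Z')) \<le> Lg * norm (X - X') + \<eta> * norm (Z - Z'))"
    using stagewise_linearization[OF \<Omega>(1,3) w, where 's = 's] by metis
  define c where "c = 1 + aI + uI + uE + \<kappa> * \<tau> * uI + \<kappa> * \<tau> + \<kappa> * Lg"
  have nn: "0 \<le> \<kappa> * \<tau> * uI" "0 \<le> \<kappa> * \<tau>" "0 \<le> \<kappa> * Lg" using \<kappa> \<tau> uI Lg by auto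
  have c: "1 \<le> c" "aI \<le> c" "uI \<le> c" "uE \<le> c" "\<kappa> * \<tau> * uI \<le> c" "\<kappa> * \<tau> \<le> c" "\<kappa> * Lg \<le> c"
    using nn aI(1) uI(1) uE(1) by (simp_all add: c_def)
  obtain \<sigma> C where \<sigma>: "0 < \<sigma>" and C: "0 \<le> C" and arith: "\<And>s r X Z e \<zeta> dX dZ :: real.
    0 \<le> s \<Longrightarrow> 0 \<le> X \<Longrightarrow> 0 \<le> Z \<Longrightarrow> 0 \<le> e \<Longrightarrow> 0 \<le> \<zeta> \<Longrightarrow> 0 \<le> dX \<Longrightarrow> 0 \<le> dZ \<Longrightarrow>
    s \<le> \<sigma> * s + c * (\<zeta> + dZ) + c * X + \<sigma> * Z \<Longrightarrow> r \<le> \<sigma> * s + c * dZ + c * X + \<sigma> * Z \<Longrightarrow>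
    Z \<le> c * (s + \<zeta> + dZ) \<Longrightarrow> X \<le> \<sigma> * (X + Z) + c * (e + dX) \<Longrightarrow>
    X \<le> C * (e + \<zeta> + dX + dZ) \<and> Z \<le> C * (e + \<zeta> + dX + dZ) \<and> r \<le> \<eta> * \<zeta> + C * (e + dX + dZ)"
    using stage_error_arithmetic[OF c(1) \<eta>] by auto
  define \<eta>' where "\<eta>' = min 1 (\<sigma> / \<kappa>)"
  have \<eta>': "0 < \<eta>'" "\<eta>' \<le> 1" using \<sigma> \<kappa>(1) by (auto simp: \<eta>'_def)
  have "\<eta>' \<le> \<sigma> / \<kappa>" by (simp add: \<eta>'_def)
  then have \<kappa>\<eta>: "\<kappa> * \<eta>' \<le> \<sigma>" using \<kappa>(1) by (simp add: field_simps)
  obtain \<rho>g where \<rho>g: "0 < \<rho>g" "\<And>(X::real^'m^'s) Z X' Z'. near w \<rho>g X Z \<Longrightarrow> near w \<rho>g X' Z' \<Longrightarrow>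
    norm (stagewise g X Z - stagewise g X' Z' - stage_map ?J (Z - Z')) \<le> Lg * norm (X - X') + \<eta>' * norm (Z - Z')"
    using Lg(2)[rule_format, OF \<eta>'] by blast
  define \<rho> where "\<rho> = min (min \<rho>f \<rho>g) (min (\<sigma> / \<kappa>) (\<sigma> / (aE * Lf + 1)))"
  have Lf1: "0 < aE * Lf + 1" using aE(1) Lf(1) by (intro add_nonneg_pos) auto
  have \<rho>: "0 < \<rho>" "\<rho> \<le> \<rho>f" "\<rho> \<le> \<rho>g" "\<rho> \<le> \<sigma> / \<kappa>" "\<rho> \<le> \<sigma> / (aE * Lf + 1)"
    using Lf(2) \<rho>g(1) \<sigma> \<kappa>(1) Lf1 by (auto simp: \<rho>_def)
  have \<kappa>\<rho>: "\<kappa> * \<rho> \<le> \<sigma>" using \<rho>(4) \<kappa>(1) by (simp add: field_simps)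
  have f\<rho>: "\<rho> * (aE * Lf) \<le> \<sigma>"
  proof -
    have "\<rho> * (aE * Lf + 1) \<le> \<sigma>" using \<rho>(5) Lf1 by (simp add: pos_le_divide_eq)
    then show ?thesis using \<rho>(1) by (simp add: distrib_left)
  qed
  show ?thesis
  proof (rule exI[of _ \<rho>], intro conjI \<rho>(1), rule exI[of _ "(1 + 2 * Lf) * C"], rule conjI, use C Lf(1) in simp, intro allI impI)
    fix \<theta> h X' Z' X Z \<gamma> \<Delta>\<xi> \<Delta>\<zeta> dX dZ
    assume th: "\<bar>\<theta> - \<theta>\<^sub>0\<bar> \<le> \<rho>" and h: "0 < h" "h \<le> \<rho>" and n: "near w \<rho> X Z" "near w \<rho> X' Z'"
      and se: "stage_errors \<theta> h X' Z' X Z \<gamma> \<Delta>\<xi> \<Delta>\<zeta> dX dZ"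
    have nf: "near w \<rho>f X Z" "near w \<rho>f X' Z'" and ng: "near w \<rho>g X Z" "near w \<rho>g X' Z'"
      using n \<rho>(2,3) near_mono[of w \<rho> _ _ w] by simp_all
    let ?R = "stagewise g X Z - stagewise g X' Z' - stage_map ?J (Z - Z')"
    have eqs: "X - X' = h *\<^sub>R (A\<^sub>E ** (stagewise f X Z - stagewise f X' Z')) + U\<^sub>E ** \<Delta>\<xi> + dX"
      "Z - Z' = A\<^sub>I ** \<gamma> + U\<^sub>I ** \<Delta>\<zeta> + dZ" "\<theta> *\<^sub>R \<gamma> = stagewise g X Z - stagewise g X' Z'"
      using se by (auto simp: stage_errors_def)
    have "stage_operator \<theta>\<^sub>0 ?J A\<^sub>I \<gamma>
        = (\<theta>\<^sub>0 - \<theta>) *\<^sub>R \<gamma> + stage_map ?J (U\<^sub>I ** \<Delta>\<zeta>) + stage_map ?J dZ + ?R"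
      unfolding eqs(2) eqs(3)[symmetric] linear_add[OF linT] stage_operator_def
      by (simp add: algebra_simps)
    then have "?K (stage_operator \<theta>\<^sub>0 ?J A\<^sub>I \<gamma>)
        = ?K ((\<theta>\<^sub>0 - \<theta>) *\<^sub>R \<gamma> + stage_map ?J (U\<^sub>I ** \<Delta>\<zeta>) + stage_map ?J dZ + ?R)"
      by (rule arg_cong)
    then have \<gamma>: "\<gamma> = ?K ((\<theta>\<^sub>0 - \<theta>) *\<^sub>R \<gamma> + stage_map ?J (U\<^sub>I ** \<Delta>\<zeta>) + stage_map ?J dZ + ?R)"
      unfolding inv_stage_operator(3)[OF A J[OF w] \<theta>] .
    have \<gamma>': "\<gamma> - stage_response \<theta>\<^sub>0 ?J A\<^sub>I U\<^sub>I \<Delta>\<zeta> = ?K ((\<theta>\<^sub>0 - \<theta>) *\<^sub>R \<gamma> + stage_map ?J dZ + ?R)"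
      using \<gamma> unfolding stage_response_def linear_add[OF linK] by (simp add: algebra_simps)
    have R: "norm ?R \<le> Lg * norm (X - X') + \<eta>' * norm (Z - Z')" by (rule \<rho>g(2)[OF ng])
    have kR: "\<kappa> * norm ?R \<le> c * norm (X - X') + \<sigma> * norm (Z - Z')"
    proof -
      have "\<kappa> * norm ?R \<le> \<kappa> * (Lg * norm (X - X') + \<eta>' * norm (Z - Z'))"
        using R \<kappa>(1) by (intro mult_left_mono) auto
      also have "\<dots> = (\<kappa> * Lg) * norm (X - X') + (\<kappa> * \<eta>') * norm (Z - Z')" by (simp add: algebra_simps)
      also have "\<dots> \<le> c * norm (X - X') + \<sigma> * norm (Z - Z')"
        using c(7) \<kappa>\<eta> by (intro add_mono mult_right_mono) auto
      finally show ?thesis .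
    qed
    have kth: "\<kappa> * norm ((\<theta>\<^sub>0 - \<theta>) *\<^sub>R \<gamma>) \<le> \<sigma> * norm \<gamma>"
    proof -
      have "\<kappa> * norm ((\<theta>\<^sub>0 - \<theta>) *\<^sub>R \<gamma>) = (\<kappa> * \<bar>\<theta> - \<theta>\<^sub>0\<bar>) * norm \<gamma>" by (simp add: abs_minus_commute)
      also have "\<dots> \<le> \<sigma> * norm \<gamma>"
        using \<kappa>(1) by (intro mult_right_mono order_trans[OF mult_left_mono[OF th] \<kappa>\<rho>]) auto
      finally show ?thesis .
    qed
    have kdZ: "\<kappa> * norm (stage_map ?J dZ) \<le> c * norm dZ"
    proof -
      have "\<kappa> * norm (stage_map ?J dZ) \<le> \<kappa> * (\<tau> * norm dZ)" using \<kappa>(1) \<tau>(2) by (intro mult_left_mono) auto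
      also have "\<dots> \<le> c * norm dZ" using mult_right_mono[OF c(6) norm_ge_zero[of dZ]] by (simp add: mult.assoc)
      finally show ?thesis .
    qed
    have k\<zeta>: "\<kappa> * norm (stage_map ?J (U\<^sub>I ** \<Delta>\<zeta>)) \<le> c * norm \<Delta>\<zeta>"
    proof -
      have "\<kappa> * norm (stage_map ?J (U\<^sub>I ** \<Delta>\<zeta>)) \<le> \<kappa> * (\<tau> * (uI * norm \<Delta>\<zeta>))"
        using \<kappa>(1) \<tau>(1) by (intro mult_left_mono order_trans[OF \<tau>(2)] uI(2)) auto
      also have "\<dots> \<le> c * norm \<Delta>\<zeta>" using mult_right_mono[OF c(5) norm_ge_zero[of \<Delta>\<zeta>]] by (simp add: mult.assoc)
      finally show ?thesis .
    qed
    have tri4: "\<kappa> * norm (a + b + d + e) \<le> \<kappa> * norm a + \<kappa> * norm b + \<kappa> * norm d + \<kappa> * norm e" for a b d e :: "real^'m^'s"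
      unfolding distrib_left[symmetric] using \<kappa>(1)
      by (intro mult_left_mono norm_triangle_le add_mono) auto
    have tri3: "\<kappa> * norm (a + b + d) \<le> \<kappa> * norm a + \<kappa> * norm b + \<kappa> * norm d" for a b d :: "real^'m^'s"
      using tri4[of a b d 0] by simp
    have s: "norm \<gamma> \<le> \<sigma> * norm \<gamma> + c * (norm \<Delta>\<zeta> + norm dZ) + c * norm (X - X') + \<sigma> * norm (Z - Z')"
    proof -
      have "norm \<gamma> \<le> \<kappa> * norm ((\<theta>\<^sub>0 - \<theta>) *\<^sub>R \<gamma> + stage_map ?J (U\<^sub>I ** \<Delta>\<zeta>) + stage_map ?J dZ + ?R)"
        by (subst \<gamma>) (rule \<kappa>(2))
      then show ?thesis
        using tri4[of "(\<theta>\<^sub>0 - \<theta>) *\<^sub>R \<gamma>" "stage_map ?J (U\<^sub>I ** \<Delta>\<zeta>)" "stage_map ?J dZ" ?R] kR kth kdZ k\<zeta>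
          distrib_left[of c "norm \<Delta>\<zeta>" "norm dZ"] by linarith
    qed
    have r: "norm (\<gamma> - stage_response \<theta>\<^sub>0 ?J A\<^sub>I U\<^sub>I \<Delta>\<zeta>)
        \<le> \<sigma> * norm \<gamma> + c * norm dZ + c * norm (X - X') + \<sigma> * norm (Z - Z')"
    proof -
      have "norm (\<gamma> - stage_response \<theta>\<^sub>0 ?J A\<^sub>I U\<^sub>I \<Delta>\<zeta>) \<le> \<kappa> * norm ((\<theta>\<^sub>0 - \<theta>) *\<^sub>R \<gamma> + stage_map ?J dZ + ?R)"
        unfolding \<gamma>' by (rule \<kappa>(2))
      then show ?thesis
        using tri3[of "(\<theta>\<^sub>0 - \<theta>) *\<^sub>R \<gamma>" "stage_map ?J dZ" ?R] kR kth kdZ by linarith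
    qed
    have Z: "norm (Z - Z') \<le> c * (norm \<gamma> + norm \<Delta>\<zeta> + norm dZ)"
    proof -
      have "norm (Z - Z') \<le> aI * norm \<gamma> + uI * norm \<Delta>\<zeta> + 1 * norm dZ"
        unfolding eqs(2) by (intro norm_triangle_le add_mono aI uI) simp
      also have "\<dots> \<le> c * norm \<gamma> + c * norm \<Delta>\<zeta> + c * norm dZ"
        using c by (intro add_mono mult_right_mono) auto
      finally show ?thesis by (simp add: distrib_left)
    qed
    have X: "norm (X - X') \<le> \<sigma> * (norm (X - X') + norm (Z - Z')) + c * (norm \<Delta>\<xi> + norm dX)"
    proof -
      have "norm (A\<^sub>E ** (stagewise f X Z - stagewise f X' Z')) \<le> aE * (Lf * (norm (X - X') + norm (Z - Z')))"
        by (rule order_trans[OF aE(2) mult_left_mono[OF Lf(3)[OF nf]]]) (use aE in simp)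
      then have "h * norm (A\<^sub>E ** (stagewise f X Z - stagewise f X' Z')) \<le> \<rho> * (aE * (Lf * (norm (X - X') + norm (Z - Z'))))"
        using h by (intro mult_mono) auto
      also have "\<dots> \<le> \<sigma> * (norm (X - X') + norm (Z - Z'))"
        using mult_right_mono[OF f\<rho>, of "norm (X - X') + norm (Z - Z')"] by (simp add: mult.assoc)
      finally have "norm (h *\<^sub>R (A\<^sub>E ** (stagewise f X Z - stagewise f X' Z'))) \<le> \<sigma> * (norm (X - X') + norm (Z - Z'))"
        using h by simp
      moreover have "norm (U\<^sub>E ** \<Delta>\<xi>) \<le> c * norm \<Delta>\<xi>"
        by (rule order_trans[OF uE(2) mult_right_mono[OF c(4)]]) simp
      moreover have "norm dX \<le> c * norm dX" using c(1) mult_right_mono[of 1 c "norm dX"] by simp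
      moreover have "norm (X - X') \<le> norm (h *\<^sub>R (A\<^sub>E ** (stagewise f X Z - stagewise f X' Z'))) + norm (U\<^sub>E ** \<Delta>\<xi>) + norm dX"
        by (subst eqs(1)) (intro norm_triangle_le add_mono order_refl)
      ultimately show ?thesis by (simp add: distrib_left)
    qed
    let ?S = "norm \<Delta>\<xi> + norm \<Delta>\<zeta> + norm dX + norm dZ"
    have res: "norm (X - X') \<le> C * ?S \<and> norm (Z - Z') \<le> C * ?S \<and>
      norm (\<gamma> - stage_response \<theta>\<^sub>0 ?J A\<^sub>I U\<^sub>I \<Delta>\<zeta>) \<le> \<eta> * norm \<Delta>\<zeta> + C * (norm \<Delta>\<xi> + norm dX + norm dZ)"
      by (rule arith[OF norm_ge_zero norm_ge_zero norm_ge_zero norm_ge_zero norm_ge_zero norm_ge_zero norm_ge_zero s r Z X])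
    have "norm (stagewise f X Z - stagewise f X' Z') \<le> Lf * (C * ?S + C * ?S)"
      by (rule order_trans[OF Lf(3)[OF nf]]) (use res Lf(1) in \<open>auto intro!: mult_left_mono add_mono\<close>)
    also have "\<dots> \<le> (1 + 2 * Lf) * C * ?S"
    proof -
      have "0 \<le> C * ?S" using C by simp
      then show ?thesis by (simp add: algebra_simps)
    qed
    finally have F: "norm (stagewise f X Z - stagewise f X' Z') \<le> (1 + 2 * Lf) * C * ?S" .
    have CC: "C \<le> (1 + 2 * Lf) * C" using mult_right_mono[of 1 "1 + 2 * Lf" C] C Lf(1) by simp
    have "C * (norm \<Delta>\<xi> + norm dX + norm dZ) \<le> (1 + 2 * Lf) * C * (norm \<Delta>\<xi> + norm dX + norm dZ)"
      by (rule mult_right_mono[OF CC]) simp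
    then show "norm (stagewise f X Z - stagewise f X' Z') \<le> (1 + 2 * Lf) * C * ?S \<and>
      norm (\<gamma> - stage_response \<theta>\<^sub>0 ?J A\<^sub>I U\<^sub>I \<Delta>\<zeta>) \<le> \<eta> * norm \<Delta>\<zeta> + (1 + 2 * Lf) * C * (norm \<Delta>\<xi> + norm dX + norm dZ)"
      using F res by linarith
  qed
qed

text \<open>The error equations are a fixed point problem for the pair \<open>(X - X', \<gamma>)\<close>, once the stage operator has
  been inverted. It maps a product of two balls into itself, and Brouwer's theorem applies.\<close>

lemma stage_values_exist:
  assumes w: "w \<in> \<Omega>" and \<theta>: "0 \<le> \<theta>\<^sub>0" and \<delta>: "0 < \<delta>"
  shows "\<exists>r>0. \<forall>\<theta> h X' Z' \<Delta>\<xi> \<Delta>\<zeta> dX dZ.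
    \<bar>\<theta> - \<theta>\<^sub>0\<bar> \<le> r \<longrightarrow> 0 < h \<longrightarrow> h \<le> r \<longrightarrow> near w r X' Z' \<longrightarrow>
    norm \<Delta>\<xi> \<le> r \<longrightarrow> norm \<Delta>\<zeta> \<le> r \<longrightarrow> norm dX \<le> r \<longrightarrow> norm dZ \<le> r \<longrightarrow>
    (\<exists>X Z \<gamma>. stage_errors \<theta> h X' Z' X Z \<gamma> \<Delta>\<xi> \<Delta>\<zeta> dX dZ \<and>
      norm (X - X') \<le> \<delta> \<and> norm (Z - Z') \<le> \<delta>)"
proof -
  let ?J = "partial_z g w"
  let ?K = "inv (stage_operator \<theta>\<^sub>0 ?J A\<^sub>I) :: real^'m^'s \<Rightarrow> real^'m^'s"
  note linK = inv_stage_operator(1)[OF A J[OF w] \<theta>] and linT = linear_stage_map[of ?J]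
  obtain \<kappa> where \<kappa>: "0 < \<kappa>" "\<And>Y. norm (?K Y) \<le> \<kappa> * norm Y" using linear_bounded_pos[OF linK] by blast
  obtain \<tau> where \<tau>: "0 < \<tau>" "\<And>Y::real^'m^'s. norm (stage_map ?J Y) \<le> \<tau> * norm Y"
    using linear_bounded_pos[OF linT] by blast
  obtain aE where aE: "0 < aE" "\<And>Y::real^'m^'s. norm (A\<^sub>E ** Y) \<le> aE * norm Y" using matrix_mult_bound by blast
  obtain aI where aI: "0 < aI" "\<And>Y::real^'m^'s. norm (A\<^sub>I ** Y) \<le> aI * norm Y" using matrix_mult_bound by blast
  obtain uE where uE: "0 < uE" "\<And>Y::real^'m^'r. norm (U\<^sub>E ** Y) \<le> uE * norm Y" using matrix_mult_bound by blast
  obtain uI where uI: "0 < uI" "\<And>Y::real^'m^'r. norm (U\<^sub>I ** Y) \<le> uI * norm Y" using matrix_mult_bound by blast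
  obtain Lf \<rho>f where Lf: "0 \<le> Lf" "0 < \<rho>f" "\<And>(X::real^'m^'s) Z X' Z'. near w \<rho>f X Z \<Longrightarrow> near w \<rho>f X' Z' \<Longrightarrow>
    norm (stagewise f X Z - stagewise f X' Z') \<le> Lf * (norm (X - X') + norm (Z - Z'))"
    using stagewise_lipschitz[OF \<Omega>(1,2) w, where 's = 's] by metis
  obtain Lg where Lg: "0 \<le> Lg" "\<forall>\<eta>>0. \<eta> \<le> 1 \<longrightarrow> (\<exists>\<rho>>0. \<forall>(X::real^'m^'s) Z X' Z'. near w \<rho> X Z \<longrightarrow> near w \<rho> X' Z' \<longrightarrow>
    norm (stagewise g X Z - stagewise g X' Z' - stage_map ?J (Z - Z')) \<le> Lg * norm (X - X') + \<eta> * norm (Z - Z'))"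
    using stagewise_linearization[OF \<Omega>(1,3) w, where 's = 's] by metis
  obtain \<rho>\<Omega> where \<rho>\<Omega>: "0 < \<rho>\<Omega>" "ball w \<rho>\<Omega> \<subseteq> \<Omega>" using \<Omega>(1) w openE by blast
  define c where "c = 1 + aI + uI + uE + aE * Lf + \<kappa> + \<kappa> * \<tau> * (uI + 1) + \<kappa> * Lg"
  have nn: "0 \<le> \<kappa> * \<tau> * (uI + 1)" "0 \<le> \<kappa> * Lg" "0 \<le> aE * Lf" using \<kappa> \<tau> uI aE Lg Lf by auto
  have c: "1 \<le> c" "aI \<le> c" "uI + 1 \<le> c" "uE + 1 \<le> c" "aE * Lf \<le> c" "\<kappa> \<le> c" "\<kappa> * \<tau> * (uI + 1) \<le> c" "\<kappa> * Lg \<le> c"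
    using nn aI(1) uI(1) uE(1) \<kappa>(1) by (simp_all add: c_def)
  define \<eta>' where "\<eta>' = 1 / (4 * c\<^sup>2)"
  have c2: "1 \<le> c\<^sup>2" using c(1) by (rule one_le_power)
  have \<eta>': "0 < \<eta>'" "\<eta>' \<le> 1" using c2 by (auto simp: \<eta>'_def divide_le_eq)
  obtain \<rho>g where \<rho>g: "0 < \<rho>g" "\<And>(X::real^'m^'s) Z X' Z'. near w \<rho>g X Z \<Longrightarrow> near w \<rho>g X' Z' \<Longrightarrow>
    norm (stagewise g X Z - stagewise g X' Z' - stage_map ?J (Z - Z')) \<le> Lg * norm (X - X') + \<eta>' * norm (Z - Z')"
    using Lg(2)[rule_format, OF \<eta>'] by blast
  define \<rho> where "\<rho> = min (min \<rho>f \<rho>g) (min \<rho>\<Omega> \<delta>)"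
  have \<rho>: "0 < \<rho>" "\<rho> \<le> \<rho>f" "\<rho> \<le> \<rho>g" "\<rho> \<le> \<rho>\<Omega>" "\<rho> \<le> \<delta>"
    using Lf(2) \<rho>g(1) \<rho>\<Omega>(1) \<delta> by (auto simp: \<rho>_def)
  \<comment> \<open>The radii of the balls for \<open>\<gamma>\<close> and for \<open>X - X'\<close>. The latter is smaller by the factor \<open>4 c\<^sup>2\<close>, because the
    error of \<open>X\<close> enters the equation for \<open>\<gamma>\<close> with a factor that is not small; the step size makes up for it.\<close>
  define \<beta> where "\<beta> = \<rho> / (4 * c)"
  define a where "a = \<beta> / (4 * c\<^sup>2)"
  have \<beta>: "0 < \<beta>" "c * \<beta> = \<rho> / 4" using \<rho>(1) c(1) by (auto simp: \<beta>_def)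
  have a: "0 < a" "c\<^sup>2 * a = \<beta> / 4" using \<beta>(1) c(1) by (auto simp: a_def)
  have cc: "c \<le> c\<^sup>2" using c(1) by (simp add: power2_eq_square)
  have ca: "c * a \<le> \<beta> / 4" using mult_right_mono[OF cc, of a] a by simp
  have a\<rho>: "a \<le> \<rho> / 16"
  proof -
    have "1 * a \<le> c * a" using c(1) a(1) by (intro mult_right_mono) auto
    moreover have "1 * \<beta> \<le> c * \<beta>" using c(1) \<beta>(1) by (intro mult_right_mono) auto
    ultimately show ?thesis using ca \<beta>(2) by simp
  qed
  define r where "r = min (min (\<rho> / (8 * c)) (a / (c * \<rho> + c))) (min 1 (\<beta> / (2 * (c * \<beta> + c + 1))))"
  have dpos: "0 < c * \<rho> + c" "0 < c * \<beta> + c + 1" using c(1) \<rho>(1) \<beta>(1) by (auto intro!: add_pos_pos mult_pos_pos)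
  have r: "0 < r" "r \<le> \<rho> / (8 * c)" "r \<le> a / (c * \<rho> + c)" "r \<le> \<beta> / (2 * (c * \<beta> + c + 1))"
    using \<rho>(1) c(1) a(1) \<beta>(1) dpos by (auto simp: r_def)
  have r1: "c * r \<le> \<rho> / 8" using r(2) c(1) by (simp add: field_simps)
  have r2: "r * (c * \<rho> + c) \<le> a" using r(3) dpos(1) by (simp add: pos_le_divide_eq)
  have r3: "r * (c * \<beta> + c + 1) \<le> \<beta> / 2" using r(4) dpos(2) by (simp add: field_simps)
  have r1': "r \<le> \<rho> / 8"
  proof -
    have "1 * r \<le> c * r" using c(1) r(1) by (intro mult_right_mono) auto
    then show ?thesis using r1 by simp
  qed
  show ?thesis
  proof (rule exI[of _ r], rule conjI[OF r(1)], intro allI impI)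
    fix \<theta> h :: real and X' Z' dX dZ :: "real^'m^'s" and \<Delta>\<xi> \<Delta>\<zeta> :: "real^'m^'r"
    assume th: "\<bar>\<theta> - \<theta>\<^sub>0\<bar> \<le> r" and h: "0 < h" "h \<le> r" and n: "near w r X' Z'"
      and small: "norm \<Delta>\<xi> \<le> r" "norm \<Delta>\<zeta> \<le> r" "norm dX \<le> r" "norm dZ \<le> r"
    define ZZ where "ZZ \<gamma> = Z' + (A\<^sub>I ** \<gamma> + U\<^sub>I ** \<Delta>\<zeta> + dZ)" for \<gamma>
    define R where "R P \<gamma> = stagewise g (X' + P) (ZZ \<gamma>) - stagewise g X' Z' - stage_map ?J (ZZ \<gamma> - Z')" for P \<gamma>
    define \<Phi> where "\<Phi> = (\<lambda>(P, \<gamma>). (h *\<^sub>R (A\<^sub>E ** (stagewise f (X' + P) (ZZ \<gamma>) - stagewise f X' Z')) + (U\<^sub>E ** \<Delta>\<xi> + dX),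
      ?K ((\<theta>\<^sub>0 - \<theta>) *\<^sub>R \<gamma> + stage_map ?J (U\<^sub>I ** \<Delta>\<zeta> + dZ) + R P \<gamma>)))"
    let ?S = "cball (0::real^'m^'s) a \<times> cball (0::real^'m^'s) \<beta>"
    have UdZ: "norm (U\<^sub>I ** \<Delta>\<zeta> + dZ) \<le> (uI + 1) * r"
    proof -
      have "norm (U\<^sub>I ** \<Delta>\<zeta> + dZ) \<le> uI * norm \<Delta>\<zeta> + norm dZ" by (intro norm_triangle_le add_mono uI) simp
      also have "\<dots> \<le> uI * r + r" using small uI(1) by (intro add_mono mult_left_mono) auto
      finally show ?thesis by (simp add: distrib_right)
    qed
    have ZZ: "norm (ZZ \<gamma> - Z') \<le> c * (\<beta> + r)" if "norm \<gamma> \<le> \<beta>" for \<gamma>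
    proof -
      have "norm (ZZ \<gamma> - Z') \<le> aI * norm \<gamma> + (uI + 1) * r"
        unfolding ZZ_def add.assoc[of "A\<^sub>I ** \<gamma>"] add_diff_cancel_left'
        by (intro norm_triangle_le add_mono aI UdZ)
      also have "\<dots> \<le> c * \<beta> + c * r" using c that r(1) aI(1) by (intro add_mono mult_mono) auto
      finally show ?thesis by (simp add: distrib_left)
    qed
    have ZZ\<rho>: "norm (ZZ \<gamma> - Z') \<le> 3 * \<rho> / 8" if "norm \<gamma> \<le> \<beta>" for \<gamma>
      using ZZ[OF that] \<beta>(2) r1 by (simp add: distrib_left)
    have nr: "near w \<rho> (X' + P) (ZZ \<gamma>)" if "norm P \<le> a" "norm \<gamma> \<le> \<beta>" for P \<gamma>
      by (rule near_perturb[OF n]) (use that ZZ\<rho>[OF that(2)] a\<rho> r1' \<rho>(1) in simp)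
    have n': "near w \<rho> X' Z'" by (rule near_mono[OF n]) (use r1' \<rho>(1) in simp)
    have nearD: "near w \<rho>' P Q" if "near w \<rho> P Q" "\<rho> \<le> \<rho>'" for \<rho>' and P Q :: "real^'m^'s"
      by (rule near_mono[OF that(1)]) (use that(2) in simp)
    have in\<Omega>: "((X' + P) $ i, ZZ \<gamma> $ i) \<in> \<Omega>" if "norm P \<le> a" "norm \<gamma> \<le> \<beta>" for P \<gamma> i
      using nearD[OF nr[OF that] \<rho>(4)] \<rho>\<Omega>(2) unfolding near_def by blast
    have contZZ: "continuous_on ?S (\<lambda>y. ZZ (snd y))"
      unfolding ZZ_def by (intro continuous_intros linear_continuous_on_compose[OF _ linear_matrix_mult])
    have contX: "continuous_on ?S (\<lambda>y. X' + fst y)" by (intro continuous_intros)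
    have contF: "continuous_on ?S (\<lambda>y. stagewise F (X' + fst y) (ZZ (snd y)))"
      if "smooth_on \<Omega> F" for F :: "(real^'m) \<times> (real^'m) \<Rightarrow> real^'m"
      by (rule continuous_on_stagewise[OF smooth_on_continuous[OF that] contX contZZ]) (use in\<Omega> in auto)
    have cont: "continuous_on ?S \<Phi>"
      unfolding \<Phi>_def R_def split_beta
      by (intro continuous_intros contF \<Omega> contZZ linear_continuous_on_compose[OF _ linear_matrix_mult]
          linear_continuous_on_compose[OF _ linear_stage_map] linear_continuous_on_compose[OF _ linK])
    have maps: "\<Phi> \<in> ?S \<rightarrow> ?S"
    proof (intro funcsetI)
      fix y assume "y \<in> ?S"
      then obtain P \<gamma> where y: "y = (P, \<gamma>)" and P: "norm P \<le> a" and \<gamma>: "norm \<gamma> \<le> \<beta>" by auto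
      have Xd: "X' + P - X' = P" by simp
      have "norm (h *\<^sub>R (A\<^sub>E ** (stagewise f (X' + P) (ZZ \<gamma>) - stagewise f X' Z'))) \<le> r * (c * \<rho>)"
      proof -
        have "norm (stagewise f (X' + P) (ZZ \<gamma>) - stagewise f X' Z') \<le> Lf * (norm P + norm (ZZ \<gamma> - Z'))"
          using Lf(3)[OF nearD[OF nr[OF P \<gamma>] \<rho>(2)] nearD[OF n' \<rho>(2)]] unfolding Xd .
        also have "\<dots> \<le> Lf * \<rho>" using ZZ\<rho>[OF \<gamma>] P a\<rho> \<rho>(1) Lf(1) by (intro mult_left_mono) auto
        finally have "norm (A\<^sub>E ** (stagewise f (X' + P) (ZZ \<gamma>) - stagewise f X' Z')) \<le> aE * (Lf * \<rho>)"
          using aE(1) by (intro order_trans[OF aE(2)] mult_left_mono) auto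
        also have "\<dots> \<le> c * \<rho>" using mult_right_mono[OF c(5), of \<rho>] \<rho>(1) by (simp add: mult.assoc)
        finally show ?thesis unfolding norm_scaleR using h by (intro mult_mono) auto
      qed
      moreover have "norm (U\<^sub>E ** \<Delta>\<xi> + dX) \<le> r * c"
      proof -
        have "norm (U\<^sub>E ** \<Delta>\<xi> + dX) \<le> uE * norm \<Delta>\<xi> + norm dX" by (intro norm_triangle_le add_mono uE) simp
        also have "\<dots> \<le> uE * r + r" using small uE(1) by (intro add_mono mult_left_mono) auto
        also have "\<dots> \<le> r * c" using mult_right_mono[OF c(4), of r] r(1) by (simp add: algebra_simps)
        finally show ?thesis .
      qed
      ultimately have 1: "norm (fst (\<Phi> y)) \<le> a"
        unfolding y \<Phi>_def using r2
        by (simp only: split fst_conv distrib_left) (rule norm_triangle_le, linarith)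
      have R: "norm (R P \<gamma>) \<le> Lg * a + \<eta>' * (c * (\<beta> + r))"
      proof -
        have "norm (R P \<gamma>) \<le> Lg * norm P + \<eta>' * norm (ZZ \<gamma> - Z')"
          using \<rho>g(2)[OF nearD[OF nr[OF P \<gamma>] \<rho>(3)] nearD[OF n' \<rho>(3)]] unfolding Xd R_def .
        also have "\<dots> \<le> Lg * a + \<eta>' * (c * (\<beta> + r))"
          using ZZ[OF \<gamma>] P Lg(1) \<eta>'(1) by (intro add_mono mult_left_mono) auto
        finally show ?thesis .
      qed
      have "norm (snd (\<Phi> y)) \<le> \<kappa> * norm ((\<theta>\<^sub>0 - \<theta>) *\<^sub>R \<gamma> + stage_map ?J (U\<^sub>I ** \<Delta>\<zeta> + dZ) + R P \<gamma>)"
        unfolding y \<Phi>_def by (simp add: \<kappa>(2))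
      also have "\<dots> \<le> \<kappa> * (r * \<beta> + \<tau> * ((uI + 1) * r) + (Lg * a + \<eta>' * (c * (\<beta> + r))))"
      proof (intro mult_left_mono norm_triangle_le add_mono R)
        show "norm ((\<theta>\<^sub>0 - \<theta>) *\<^sub>R \<gamma>) \<le> r * \<beta>"
          unfolding norm_scaleR using th \<gamma> by (intro mult_mono) auto
        show "norm (stage_map ?J (U\<^sub>I ** \<Delta>\<zeta> + dZ)) \<le> \<tau> * ((uI + 1) * r)"
          using \<tau>(1) UdZ by (intro order_trans[OF \<tau>(2)] mult_left_mono) auto
      qed (use \<kappa> in simp)
      also have "\<dots> = \<kappa> * (r * \<beta>) + (\<kappa> * \<tau> * (uI + 1)) * r + (\<kappa> * Lg) * a + \<kappa> * (\<eta>' * (c * (\<beta> + r)))"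
        by (simp add: algebra_simps)
      also have "\<dots> \<le> c * (r * \<beta>) + c * r + c * a + c * (\<eta>' * (c * (\<beta> + r)))"
        using c r(1) \<beta>(1) a(1) \<eta>'(1) by (intro add_mono mult_right_mono) auto
      also have "c * (\<eta>' * (c * (\<beta> + r))) = (\<beta> + r) / 4"
        using c(1) by (simp add: \<eta>'_def power2_eq_square)
      also have "c * (r * \<beta>) + c * r + c * a + (\<beta> + r) / 4 \<le> \<beta>"
      proof -
        have "c * (r * \<beta>) + c * r + r \<le> \<beta> / 2" using r3 by (simp add: algebra_simps)
        then show ?thesis using ca r(1) by (simp add: add_divide_distrib)
      qed
      finally have 2: "norm (snd (\<Phi> y)) \<le> \<beta>" .
      show "\<Phi> y \<in> ?S" using 1 2 by (simp add: mem_Times_iff)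
    qed
    have "compact ?S" "convex ?S" "?S \<noteq> {}"
      using a(1) \<beta>(1) by (auto intro!: compact_Times convex_Times)
    then obtain y where y: "y \<in> ?S" "\<Phi> y = y" using brouwer[OF _ _ _ cont maps] by metis
    then obtain P \<gamma> where y': "y = (P, \<gamma>)" and P: "norm P \<le> a" and \<gamma>: "norm \<gamma> \<le> \<beta>" by auto
    have fix1: "P = h *\<^sub>R (A\<^sub>E ** (stagewise f (X' + P) (ZZ \<gamma>) - stagewise f X' Z')) + (U\<^sub>E ** \<Delta>\<xi> + dX)"
      and fix2: "\<gamma> = ?K ((\<theta>\<^sub>0 - \<theta>) *\<^sub>R \<gamma> + stage_map ?J (U\<^sub>I ** \<Delta>\<zeta> + dZ) + R P \<gamma>)"
      using y(2) unfolding y' \<Phi>_def by simp_all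
    have "stage_operator \<theta>\<^sub>0 ?J A\<^sub>I \<gamma>
        = stage_operator \<theta>\<^sub>0 ?J A\<^sub>I (?K ((\<theta>\<^sub>0 - \<theta>) *\<^sub>R \<gamma> + stage_map ?J (U\<^sub>I ** \<Delta>\<zeta> + dZ) + R P \<gamma>))"
      using fix2 by (rule arg_cong)
    then have op: "stage_operator \<theta>\<^sub>0 ?J A\<^sub>I \<gamma> = (\<theta>\<^sub>0 - \<theta>) *\<^sub>R \<gamma> + stage_map ?J (U\<^sub>I ** \<Delta>\<zeta> + dZ) + R P \<gamma>"
      unfolding inv_stage_operator(2)[OF A J[OF w] \<theta>] .
    have "\<theta> *\<^sub>R \<gamma> = stagewise g (X' + P) (ZZ \<gamma>) - stagewise g X' Z'"
      using op unfolding stage_operator_def R_def ZZ_def add_diff_cancel_left' linear_add[OF linT]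
      by (simp add: algebra_simps)
    then have "stage_errors \<theta> h X' Z' (X' + P) (ZZ \<gamma>) \<gamma> \<Delta>\<xi> \<Delta>\<zeta> dX dZ"
      using fix1 unfolding stage_errors_def ZZ_def by (simp add: add.assoc)
    moreover have "norm (X' + P - X') \<le> \<delta>" "norm (ZZ \<gamma> - Z') \<le> \<delta>"
      using P a\<rho> \<rho>(1,5) ZZ\<rho>[OF \<gamma>] by simp_all
    ultimately show "\<exists>X Z \<gamma>. stage_errors \<theta> h X' Z' X Z \<gamma> \<Delta>\<xi> \<Delta>\<zeta> dX dZ \<and>
      norm (X - X') \<le> \<delta> \<and> norm (Z - Z') \<le> \<delta>" by blast
  qed
qed

text \<open>In the next predicates one constant \<open>C\<close> bounds the errors while \<open>1 / C\<close> bounds the step size and the radius of validity. Thus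
  they are monotone in \<open>C\<close>, as the compactness argument requires.\<close>

definition stage_bound where
  "stage_bound w \<theta> C \<longleftrightarrow> 0 < C \<and>
    (\<forall>h X' Z' X Z \<gamma> \<Delta>\<xi> \<Delta>\<zeta> dX dZ. 0 < h \<longrightarrow> h \<le> 1 / C \<longrightarrow> near w (1 / C) X Z \<longrightarrow> near w (1 / C) X' Z' \<longrightarrow>
      stage_errors \<theta> h X' Z' X Z \<gamma> \<Delta>\<xi> \<Delta>\<zeta> dX dZ \<longrightarrow>
      norm (stagewise f X Z - stagewise f X' Z') \<le> C * (norm \<Delta>\<xi> + norm \<Delta>\<zeta> + norm dX + norm dZ))"

definition stages_solvable where
  "stages_solvable \<delta> w \<theta> C \<longleftrightarrow> 0 < C \<and>
    (\<forall>h X' Z' \<Delta>\<xi> \<Delta>\<zeta> dX dZ. 0 < h \<longrightarrow> h \<le> 1 / C \<longrightarrow> near w (1 / C) X' Z' \<longrightarrow>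
      norm \<Delta>\<xi> \<le> 1 / C \<longrightarrow> norm \<Delta>\<zeta> \<le> 1 / C \<longrightarrow> norm dX \<le> 1 / C \<longrightarrow> norm dZ \<le> 1 / C \<longrightarrow>
      (\<exists>X Z \<gamma>. stage_errors \<theta> h X' Z' X Z \<gamma> \<Delta>\<xi> \<Delta>\<zeta> dX dZ \<and>
        norm (X - X') \<le> \<delta> \<and> norm (Z - Z') \<le> \<delta>))"

text \<open>One step of the stiff error with everything that is not \<open>\<Delta>\<zeta>\<close> itself treated as a perturbation of
  size \<open>R\<close>.\<close>

definition error_recursion where
  "error_recursion w \<rho> \<theta> h R \<Delta>\<zeta> \<Delta>\<zeta>' \<longleftrightarrow>
    (\<exists>X' Z' X Z \<gamma> \<Delta>\<xi> dX dZ d. near w \<rho> X Z \<and> near w \<rho> X' Z' \<and>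
      stage_errors \<theta> h X' Z' X Z \<gamma> \<Delta>\<xi> \<Delta>\<zeta> dX dZ \<and>
      \<Delta>\<zeta>' = V\<^sub>I ** \<Delta>\<zeta> + B\<^sub>I ** \<gamma> + d \<and>
      norm \<Delta>\<xi> \<le> R \<and> norm dX \<le> R \<and> norm dZ \<le> R \<and> norm d \<le> R)"

text \<open>The number \<open>k\<close> of steps that halves an error depends on the parameters. The reference point moves along
  \<open>u\<close> during these steps.\<close>

definition contracting_block where
  "contracting_block u \<theta> \<tau> C \<longleftrightarrow> 0 < C \<and>
    (\<exists>k\<ge>1. \<forall>h R \<Delta>\<zeta> j. 0 < h \<longrightarrow> h \<le> 1 / C \<longrightarrow> 0 \<le> R \<longrightarrow> j \<le> k \<longrightarrow>
      (\<forall>i<j. error_recursion (u (\<tau> + real i * h)) (1 / C) \<theta> h R (\<Delta>\<zeta> i) (\<Delta>\<zeta> (Suc i))) \<longrightarrow>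
      norm (\<Delta>\<zeta> j) \<le> C * (norm (\<Delta>\<zeta> 0) + R) \<and>
      (j = k \<longrightarrow> norm (\<Delta>\<zeta> j) \<le> 1 / 2 * norm (\<Delta>\<zeta> 0) + C * R))"

lemma uniform_stage_bound:
  fixes u :: "real \<Rightarrow> (real^'m) \<times> (real^'m)"
  assumes u: "\<And>\<tau>. \<tau> \<in> {t0..t1} \<Longrightarrow> u \<tau> \<in> \<Omega>" "\<And>\<tau>. \<tau> \<in> {t0..t1} \<Longrightarrow> isCont u \<tau>"
  shows "\<exists>C. \<forall>\<theta>\<in>{0..\<theta>m}. \<forall>\<tau>\<in>{t0..t1}. stage_bound (u \<tau>) \<theta> C"
proof (rule uniform_over_parameters[where Q = "\<lambda>\<theta> \<tau>. stage_bound (u \<tau>) \<theta>"])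
  fix \<theta>\<^sub>0 \<tau>\<^sub>0 assume \<theta>\<^sub>0: "\<theta>\<^sub>0 \<in> {0..\<theta>m}" and \<tau>\<^sub>0: "\<tau>\<^sub>0 \<in> {t0..t1}"
  have \<theta>0: "0 \<le> \<theta>\<^sub>0" using \<theta>\<^sub>0 by simp
  obtain \<rho> C where \<rho>: "0 < \<rho>" and C: "0 \<le> C" and bound: "\<And>\<theta> h X' Z' X Z \<gamma> \<Delta>\<xi> \<Delta>\<zeta> dX dZ.
    \<bar>\<theta> - \<theta>\<^sub>0\<bar> \<le> \<rho> \<Longrightarrow> 0 < h \<Longrightarrow> h \<le> \<rho> \<Longrightarrow> near (u \<tau>\<^sub>0) \<rho> X Z \<Longrightarrow> near (u \<tau>\<^sub>0) \<rho> X' Z' \<Longrightarrow>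
    stage_errors \<theta> h X' Z' X Z \<gamma> \<Delta>\<xi> \<Delta>\<zeta> dX dZ \<Longrightarrow>
    norm (stagewise f X Z - stagewise f X' Z') \<le> C * (norm \<Delta>\<xi> + norm \<Delta>\<zeta> + norm dX + norm dZ)"
    using stage_error_bounds[OF u(1)[OF \<tau>\<^sub>0] \<theta>0 zero_less_one]
    by (elim exE conjE) blast
  obtain d where d: "0 < d" "\<And>\<tau>. dist \<tau> \<tau>\<^sub>0 < d \<Longrightarrow> dist (u \<tau>) (u \<tau>\<^sub>0) < \<rho> / 2"
    using u(2)[OF \<tau>\<^sub>0] \<rho> unfolding isCont_def LIM_def
    by (metis dist_self half_gt_zero)
  define C' where "C' = max (C + 1) (2 / \<rho>)"
  have C': "0 < C'" "C \<le> C'" "1 / C' \<le> \<rho> / 2"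
  proof -
    show "0 < C'" "C \<le> C'" using C by (auto simp: C'_def)
    have "1 / C' \<le> 1 / (2 / \<rho>)" using \<rho> by (intro reciprocal_antimono) (auto simp: C'_def)
    then show "1 / C' \<le> \<rho> / 2" by simp
  qed
  have "stage_bound (u \<tau>) \<theta> C'"
    if "\<bar>\<theta> - \<theta>\<^sub>0\<bar> \<le> min \<rho> (d / 2)" "\<bar>\<tau> - \<tau>\<^sub>0\<bar> \<le> min \<rho> (d / 2)" for \<theta> \<tau>
    unfolding stage_bound_def
  proof (intro conjI[OF C'(1)] allI impI)
    fix h X' Z' X Z \<gamma> \<Delta>\<xi> \<Delta>\<zeta> dX dZ
    assume h: "0 < h" "h \<le> 1 / C'" and n: "near (u \<tau>) (1 / C') X Z" "near (u \<tau>) (1 / C') X' Z'"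
      and se: "stage_errors \<theta> h X' Z' X Z \<gamma> \<Delta>\<xi> \<Delta>\<zeta> dX dZ"
    have "dist (u \<tau>) (u \<tau>\<^sub>0) < \<rho> / 2" using that d(1) by (intro d(2)) (auto simp: dist_real_def)
    then have du: "dist (u \<tau>) (u \<tau>\<^sub>0) + 1 / C' \<le> \<rho>" using C'(3) by linarith
    let ?S = "norm \<Delta>\<xi> + norm \<Delta>\<zeta> + norm dX + norm dZ"
    have "norm (stagewise f X Z - stagewise f X' Z') \<le> C * ?S"
      by (rule bound[OF _ h(1) _ near_mono[OF n(1) du] near_mono[OF n(2) du] se])
        (use that h C'(3) \<rho> in auto)
    moreover have "C * ?S \<le> C' * ?S" using C'(2) by (intro mult_right_mono) auto
    ultimately show "norm (stagewise f X Z - stagewise f X' Z') \<le> C' * ?S" by linarith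
  qed
  then show "\<exists>\<rho>>0. \<exists>C. \<forall>\<theta>\<in>{0..\<theta>m}. \<forall>\<tau>\<in>{t0..t1}. \<bar>\<theta> - \<theta>\<^sub>0\<bar> \<le> \<rho> \<longrightarrow> \<bar>\<tau> - \<tau>\<^sub>0\<bar> \<le> \<rho> \<longrightarrow>
      stage_bound (u \<tau>) \<theta> C"
    using \<rho> d(1) by (intro exI[of _ "min \<rho> (d / 2)"] conjI exI[of _ C'] ballI impI) auto
next
  fix \<theta> \<tau> C C' assume sb: "stage_bound (u \<tau>) \<theta> C" and CC: "C \<le> (C'::real)"
  have C: "0 < C" using sb by (simp add: stage_bound_def)
  have inv: "1 / C' \<le> 1 / C" by (rule reciprocal_antimono[OF C CC])
  show "stage_bound (u \<tau>) \<theta> C'"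
    unfolding stage_bound_def
  proof (intro conjI allI impI)
    show "0 < C'" using C CC by simp
    fix h X' Z' X Z \<gamma> \<Delta>\<xi> \<Delta>\<zeta> dX dZ
    assume h: "0 < h" "h \<le> 1 / C'" and n: "near (u \<tau>) (1 / C') X Z" "near (u \<tau>) (1 / C') X' Z'"
      and se: "stage_errors \<theta> h X' Z' X Z \<gamma> \<Delta>\<xi> \<Delta>\<zeta> dX dZ"
    let ?S = "norm \<Delta>\<xi> + norm \<Delta>\<zeta> + norm dX + norm dZ"
    have "norm (stagewise f X Z - stagewise f X' Z') \<le> C * ?S"
      using sb[unfolded stage_bound_def, THEN conjunct2, rule_format,
          OF h(1) order_trans[OF h(2) inv] near_weaken[OF n(1) inv] near_weaken[OF n(2) inv] se] .
    moreover have "C * ?S \<le> C' * ?S" using CC by (intro mult_right_mono) auto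
    ultimately show "norm (stagewise f X Z - stagewise f X' Z') \<le> C' * ?S" by linarith
  qed
qed

lemma uniform_stages_solvable:
  fixes u :: "real \<Rightarrow> (real^'m) \<times> (real^'m)"
  assumes u: "\<And>\<tau>. \<tau> \<in> {t0..t1} \<Longrightarrow> u \<tau> \<in> \<Omega>" "\<And>\<tau>. \<tau> \<in> {t0..t1} \<Longrightarrow> isCont u \<tau>"
    and \<delta>: "0 < \<delta>"
  shows "\<exists>C. \<forall>\<theta>\<in>{0..\<theta>m}. \<forall>\<tau>\<in>{t0..t1}. stages_solvable \<delta> (u \<tau>) \<theta> C"
proof (rule uniform_over_parameters[where Q = "\<lambda>\<theta> \<tau>. stages_solvable \<delta> (u \<tau>) \<theta>"])
  fix \<theta>\<^sub>0 \<tau>\<^sub>0 assume \<theta>\<^sub>0: "\<theta>\<^sub>0 \<in> {0..\<theta>m}" and \<tau>\<^sub>0: "\<tau>\<^sub>0 \<in> {t0..t1}"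
  have \<theta>0: "0 \<le> \<theta>\<^sub>0" using \<theta>\<^sub>0 by simp
  obtain r where r: "0 < r" and solv: "\<And>\<theta> h X' Z' \<Delta>\<xi> \<Delta>\<zeta> dX dZ.
    \<bar>\<theta> - \<theta>\<^sub>0\<bar> \<le> r \<Longrightarrow> 0 < h \<Longrightarrow> h \<le> r \<Longrightarrow> near (u \<tau>\<^sub>0) r X' Z' \<Longrightarrow>
    norm \<Delta>\<xi> \<le> r \<Longrightarrow> norm \<Delta>\<zeta> \<le> r \<Longrightarrow> norm dX \<le> r \<Longrightarrow> norm dZ \<le> r \<Longrightarrow>
    (\<exists>X Z \<gamma>. stage_errors \<theta> h X' Z' X Z \<gamma> \<Delta>\<xi> \<Delta>\<zeta> dX dZ \<and>
      norm (X - X') \<le> \<delta> \<and> norm (Z - Z') \<le> \<delta>)"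
    using stage_values_exist[OF u(1)[OF \<tau>\<^sub>0] \<theta>0 \<delta>]
    by (elim exE conjE) blast
  obtain d where d: "0 < d" "\<And>\<tau>. dist \<tau> \<tau>\<^sub>0 < d \<Longrightarrow> dist (u \<tau>) (u \<tau>\<^sub>0) < r / 2"
    using u(2)[OF \<tau>\<^sub>0] r unfolding isCont_def LIM_def
    by (metis dist_self half_gt_zero)
  define C' where "C' = 2 / r"
  have C': "0 < C'" "1 / C' = r / 2" using r by (auto simp: C'_def)
  have "stages_solvable \<delta> (u \<tau>) \<theta> C'"
    if "\<bar>\<theta> - \<theta>\<^sub>0\<bar> \<le> min r (d / 2)" "\<bar>\<tau> - \<tau>\<^sub>0\<bar> \<le> min r (d / 2)" for \<theta> \<tau>
    unfolding stages_solvable_def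
  proof (intro conjI[OF C'(1)] allI impI)
    fix h and X' Z' dX dZ :: "real^'m^'s" and \<Delta>\<xi> \<Delta>\<zeta> :: "real^'m^'r"
    assume h: "0 < h" "h \<le> 1 / C'" and n: "near (u \<tau>) (1 / C') X' Z'"
      and s: "norm \<Delta>\<xi> \<le> 1 / C'" "norm \<Delta>\<zeta> \<le> 1 / C'" "norm dX \<le> 1 / C'" "norm dZ \<le> 1 / C'"
    have "dist (u \<tau>) (u \<tau>\<^sub>0) < r / 2" using that d(1) by (intro d(2)) (auto simp: dist_real_def)
    then have du: "dist (u \<tau>) (u \<tau>\<^sub>0) + 1 / C' \<le> r" using C'(2) by linarith
    show "\<exists>X Z \<gamma>. stage_errors \<theta> h X' Z' X Z \<gamma> \<Delta>\<xi> \<Delta>\<zeta> dX dZ \<and>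
        norm (X - X') \<le> \<delta> \<and> norm (Z - Z') \<le> \<delta>"
      by (rule solv[OF _ h(1) _ near_mono[OF n du]]) (use that h s C'(2) r in auto)
  qed
  then show "\<exists>\<rho>>0. \<exists>C. \<forall>\<theta>\<in>{0..\<theta>m}. \<forall>\<tau>\<in>{t0..t1}. \<bar>\<theta> - \<theta>\<^sub>0\<bar> \<le> \<rho> \<longrightarrow> \<bar>\<tau> - \<tau>\<^sub>0\<bar> \<le> \<rho> \<longrightarrow>
      stages_solvable \<delta> (u \<tau>) \<theta> C"
    using r d(1) by (intro exI[of _ "min r (d / 2)"] conjI exI[of _ C'] ballI impI) auto
next
  fix \<theta> \<tau> C C' assume ss: "stages_solvable \<delta> (u \<tau>) \<theta> C" and CC: "C \<le> (C'::real)"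
  have C: "0 < C" using ss by (simp add: stages_solvable_def)
  have inv: "1 / C' \<le> 1 / C" by (rule reciprocal_antimono[OF C CC])
  show "stages_solvable \<delta> (u \<tau>) \<theta> C'"
    unfolding stages_solvable_def
  proof (intro conjI allI impI)
    show "0 < C'" using C CC by simp
    fix h and X' Z' dX dZ :: "real^'m^'s" and \<Delta>\<xi> \<Delta>\<zeta> :: "real^'m^'r"
    assume h: "0 < h" "h \<le> 1 / C'" and n: "near (u \<tau>) (1 / C') X' Z'"
      and s: "norm \<Delta>\<xi> \<le> 1 / C'" "norm \<Delta>\<zeta> \<le> 1 / C'" "norm dX \<le> 1 / C'" "norm dZ \<le> 1 / C'"
    show "\<exists>X Z \<gamma>. stage_errors \<theta> h X' Z' X Z \<gamma> \<Delta>\<xi> \<Delta>\<zeta> dX dZ \<and>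
        norm (X - X') \<le> \<delta> \<and> norm (Z - Z') \<le> \<delta>"
      using ss[unfolded stages_solvable_def, THEN conjunct2, rule_format,
          OF h(1) order_trans[OF h(2) inv] near_weaken[OF n inv] order_trans[OF s(1) inv]
            order_trans[OF s(2) inv] order_trans[OF s(3) inv] order_trans[OF s(4) inv]] .
  qed
qed

lemma error_recursion_weaken:
  assumes "error_recursion w \<rho> \<theta> h R \<Delta>\<zeta> \<Delta>\<zeta>'" "dist w w' + \<rho> \<le> \<rho>'"
  shows "error_recursion w' \<rho>' \<theta> h R \<Delta>\<zeta> \<Delta>\<zeta>'"
proof -
  obtain X' Z' X Z \<gamma> \<Delta>\<xi> dX dZ d where *: "near w \<rho> X Z" "near w \<rho> X' Z'"
    and **: "stage_errors \<theta> h X' Z' X Z \<gamma> \<Delta>\<xi> \<Delta>\<zeta> dX dZ"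
      "\<Delta>\<zeta>' = V\<^sub>I ** \<Delta>\<zeta> + B\<^sub>I ** \<gamma> + d"
      "norm \<Delta>\<xi> \<le> R" "norm dX \<le> R" "norm dZ \<le> R" "norm d \<le> R"
    using assms(1) unfolding error_recursion_def by (elim exE conjE)
  show ?thesis
    unfolding error_recursion_def
    by (intro exI conjI) (rule near_mono[OF *(1) assms(2)] near_mono[OF *(2) assms(2)] **)+
qed

text \<open>For parameters close to \<open>(\<theta>\<^sub>0, \<tau>\<^sub>0)\<close> all steps of a block are perturbations of one and the same linear
  map, the propagation frozen there: along \<open>k\<close> steps of size at most \<open>1 / C\<close> the point \<open>u\<close> hardly moves.\<close>

lemma uniform_contracting_block:
  fixes u :: "real \<Rightarrow> (real^'m) \<times> (real^'m)"
  assumes u: "\<And>\<tau>. \<tau> \<in> {t0..t1} \<Longrightarrow> u \<tau> \<in> \<Omega>" "\<And>\<tau>. \<tau> \<in> {t0..t1} \<Longrightarrow> isCont u \<tau>"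
    and M: "\<And>\<theta> w. \<theta> \<in> {0..\<theta>m} \<Longrightarrow> w \<in> \<Omega> \<Longrightarrow>
      \<exists>k\<ge>1. \<forall>\<zeta>. norm ((propagation \<theta> (partial_z g w) A\<^sub>I U\<^sub>I B\<^sub>I V\<^sub>I ^^ k) \<zeta>) \<le> 1 / 4 * norm \<zeta>"
  shows "\<exists>C. \<forall>\<theta>\<in>{0..\<theta>m}. \<forall>\<tau>\<in>{t0..t1}. contracting_block u \<theta> \<tau> C"
proof (rule uniform_over_parameters[where Q = "\<lambda>\<theta> \<tau>. contracting_block u \<theta> \<tau>"])
  fix \<theta>\<^sub>0 \<tau>\<^sub>0 assume \<theta>\<^sub>0: "\<theta>\<^sub>0 \<in> {0..\<theta>m}" and \<tau>\<^sub>0: "\<tau>\<^sub>0 \<in> {t0..t1}"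
  have \<theta>0: "0 \<le> \<theta>\<^sub>0" using \<theta>\<^sub>0 by simp
  let ?J = "partial_z g (u \<tau>\<^sub>0)"
  let ?M = "propagation \<theta>\<^sub>0 ?J A\<^sub>I U\<^sub>I B\<^sub>I V\<^sub>I"
  note J0 = J[OF u(1)[OF \<tau>\<^sub>0]]
  obtain k where k: "1 \<le> k" "\<And>\<zeta>. norm ((?M ^^ k) \<zeta>) \<le> 1 / 4 * norm \<zeta>"
    using M[OF \<theta>\<^sub>0 u(1)[OF \<tau>\<^sub>0]] by blast
  obtain \<eta> C1 where \<eta>: "0 < \<eta>" "\<eta> \<le> 1" and C1: "0 \<le> C1" and block: "\<And>y R j. 0 \<le> R \<Longrightarrow> j \<le> k \<Longrightarrow>
    (\<And>i. i < j \<Longrightarrow> norm (y (Suc i) - ?M (y i)) \<le> \<eta> * norm (y i) + R) \<Longrightarrow>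
    norm (y j) \<le> C1 * (norm (y 0) + R) \<and> (j = k \<longrightarrow> norm (y j) \<le> 1 / 2 * norm (y 0) + C1 * R)"
    using perturbed_power_contraction[OF linear_propagation[OF A J0 \<theta>0] k(2)] by auto
  obtain b where b: "0 < b" "\<And>Y::real^'m^'s. norm (B\<^sub>I ** Y) \<le> b * norm Y" using matrix_mult_bound by blast
  have \<eta>b: "0 < \<eta> / b" using \<eta> b by simp
  obtain \<rho> C2 where \<rho>: "0 < \<rho>" and C2: "0 \<le> C2" and bound: "\<And>\<theta> h X' Z' X Z \<gamma> \<Delta>\<xi> \<Delta>\<zeta> dX dZ.
    \<bar>\<theta> - \<theta>\<^sub>0\<bar> \<le> \<rho> \<Longrightarrow> 0 < h \<Longrightarrow> h \<le> \<rho> \<Longrightarrow> near (u \<tau>\<^sub>0) \<rho> X Z \<Longrightarrow> near (u \<tau>\<^sub>0) \<rho> X' Z' \<Longrightarrow>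
    stage_errors \<theta> h X' Z' X Z \<gamma> \<Delta>\<xi> \<Delta>\<zeta> dX dZ \<Longrightarrow>
    norm (\<gamma> - stage_response \<theta>\<^sub>0 ?J A\<^sub>I U\<^sub>I \<Delta>\<zeta>) \<le> \<eta> / b * norm \<Delta>\<zeta> + C2 * (norm \<Delta>\<xi> + norm dX + norm dZ)"
    using stage_error_bounds[OF u(1)[OF \<tau>\<^sub>0] \<theta>0 \<eta>b]
    by (elim exE conjE) blast
  obtain d where d: "0 < d" "\<And>\<tau>. dist \<tau> \<tau>\<^sub>0 < d \<Longrightarrow> dist (u \<tau>) (u \<tau>\<^sub>0) < \<rho> / 2"
    using u(2)[OF \<tau>\<^sub>0] \<rho> unfolding isCont_def LIM_def
    by (metis dist_self half_gt_zero)
  define K where "K = 3 * b * C2 + 1"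
  have K: "0 < K" "1 \<le> K" using b C2 by (auto simp: K_def intro!: add_nonneg_pos)
  define C' where "C' = max (max (C1 * K + C1 + 1) (2 / \<rho>)) (4 * real k / d)"
  have C': "0 < C'" "C1 * K \<le> C'" "C1 \<le> C'" "1 / C' \<le> \<rho> / 2" "real k * (1 / C') \<le> d / 4"
  proof -
    have "0 \<le> C1 * K" using C1 K by simp
    then have "0 < C1 * K + C1 + 1" using C1 by linarith
    then show pos: "0 < C'" by (simp add: C'_def less_max_iff_disj)
    show "C1 * K \<le> C'" "C1 \<le> C'" using C1 \<open>0 \<le> C1 * K\<close> by (auto simp: C'_def le_max_iff_disj)
    have "1 / C' \<le> 1 / (2 / \<rho>)" using \<rho> by (intro reciprocal_antimono) (auto simp: C'_def)
    then show "1 / C' \<le> \<rho> / 2" by simp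
    have "4 * real k / d \<le> C'" by (simp add: C'_def)
    then show "real k * (1 / C') \<le> d / 4" using pos d(1) by (simp add: field_simps)
  qed
  have "contracting_block u \<theta> \<tau> C'"
    if th: "\<bar>\<theta> - \<theta>\<^sub>0\<bar> \<le> min \<rho> (d / 2)" "\<bar>\<tau> - \<tau>\<^sub>0\<bar> \<le> min \<rho> (d / 2)" for \<theta> \<tau>
    unfolding contracting_block_def
  proof (intro conjI[OF C'(1)] exI[of _ k] conjI[OF k(1)], intro allI impI)
    fix h R :: real and y :: "nat \<Rightarrow> real^'m^'r" and j
    assume h: "0 < h" "h \<le> 1 / C'" and R: "0 \<le> R" and j: "j \<le> k"
      and rec: "\<forall>i<j. error_recursion (u (\<tau> + real i * h)) (1 / C') \<theta> h R (y i) (y (Suc i))"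
    have step: "norm (y (Suc i) - ?M (y i)) \<le> \<eta> * norm (y i) + K * R" if i: "i < j" for i
    proof -
      have "real i * h \<le> real k * (1 / C')" using i j h by (intro mult_mono) auto
      then have "real i * h \<le> d / 4" using C'(5) by linarith
      moreover have "0 \<le> real i * h" using h(1) by simp
      moreover have "\<bar>\<tau> - \<tau>\<^sub>0\<bar> \<le> d / 2" using th(2) by simp
      ultimately have "\<bar>\<tau> + real i * h - \<tau>\<^sub>0\<bar> < d" using d(1) by linarith
      then have "dist (u (\<tau> + real i * h)) (u \<tau>\<^sub>0) < \<rho> / 2" by (intro d(2)) (simp add: dist_real_def)
      then have "error_recursion (u \<tau>\<^sub>0) \<rho> \<theta> h R (y i) (y (Suc i))"
        using C'(4) by (intro error_recursion_weaken[OF rec[rule_format, OF i]]) linarith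
      then obtain X' Z' X Z \<gamma> \<Delta>\<xi> dX dZ e where n: "near (u \<tau>\<^sub>0) \<rho> X Z" "near (u \<tau>\<^sub>0) \<rho> X' Z'"
        and se: "stage_errors \<theta> h X' Z' X Z \<gamma> \<Delta>\<xi> (y i) dX dZ"
        and y: "y (Suc i) = V\<^sub>I ** y i + B\<^sub>I ** \<gamma> + e"
        and small: "norm \<Delta>\<xi> \<le> R" "norm dX \<le> R" "norm dZ \<le> R" "norm e \<le> R"
        unfolding error_recursion_def by (elim exE conjE)
      have "norm (\<gamma> - stage_response \<theta>\<^sub>0 ?J A\<^sub>I U\<^sub>I (y i)) \<le> \<eta> / b * norm (y i) + C2 * (norm \<Delta>\<xi> + norm dX + norm dZ)"
        by (rule bound[OF _ h(1) _ n se]) (use th h C'(4) \<rho> in auto)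
      also have "\<dots> \<le> \<eta> / b * norm (y i) + C2 * (3 * R)"
        using small C2 by (intro add_left_mono mult_left_mono) auto
      finally have \<gamma>: "norm (\<gamma> - stage_response \<theta>\<^sub>0 ?J A\<^sub>I U\<^sub>I (y i)) \<le> \<eta> / b * norm (y i) + C2 * (3 * R)" .
      have "y (Suc i) - ?M (y i) = B\<^sub>I ** (\<gamma> - stage_response \<theta>\<^sub>0 ?J A\<^sub>I U\<^sub>I (y i)) + e"
        unfolding y propagation_def by (simp add: linear_diff[OF linear_matrix_mult])
      also have "norm \<dots> \<le> b * (\<eta> / b * norm (y i) + C2 * (3 * R)) + R"
        using b(1) by (intro norm_triangle_le add_mono order_trans[OF b(2)] mult_left_mono \<gamma> small) auto
      also have "\<dots> = \<eta> * norm (y i) + K * R" using b(1) by (simp add: K_def algebra_simps)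
      finally show ?thesis .
    qed
    have KR: "0 \<le> K * R" using K R by simp
    have res: "norm (y j) \<le> C1 * (norm (y 0) + K * R)" "j = k \<Longrightarrow> norm (y j) \<le> 1 / 2 * norm (y 0) + C1 * (K * R)"
      using block[OF KR j, of y] step by blast+
    have c1: "C1 * (K * R) \<le> C' * R" using mult_right_mono[OF C'(2) R] by (simp add: mult.assoc)
    have c2: "C1 * norm (y 0) \<le> C' * norm (y 0)" using C'(3) by (intro mult_right_mono) auto
    have "norm (y j) \<le> C' * (norm (y 0) + R)" using res(1) c1 c2 by (simp add: distrib_left)
    moreover have "j = k \<longrightarrow> norm (y j) \<le> 1 / 2 * norm (y 0) + C' * R" using res(2) c1 by auto
    ultimately show "norm (y j) \<le> C' * (norm (y 0) + R) \<and> (j = k \<longrightarrow> norm (y j) \<le> 1 / 2 * norm (y 0) + C' * R)"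
      by blast
  qed
  then show "\<exists>\<rho>>0. \<exists>C. \<forall>\<theta>\<in>{0..\<theta>m}. \<forall>\<tau>\<in>{t0..t1}. \<bar>\<theta> - \<theta>\<^sub>0\<bar> \<le> \<rho> \<longrightarrow> \<bar>\<tau> - \<tau>\<^sub>0\<bar> \<le> \<rho> \<longrightarrow>
      contracting_block u \<theta> \<tau> C"
    using \<rho> d(1) by (intro exI[of _ "min \<rho> (d / 2)"] conjI exI[of _ C'] ballI impI) auto
next
  fix \<theta> \<tau> C C' assume cb: "contracting_block u \<theta> \<tau> C" and CC: "C \<le> (C'::real)"
  have C: "0 < C" using cb by (simp add: contracting_block_def)
  have inv: "1 / C' \<le> 1 / C" by (rule reciprocal_antimono[OF C CC])
  obtain k where k: "1 \<le> k" and block: "\<And>h R y j. 0 < h \<Longrightarrow> h \<le> 1 / C \<Longrightarrow> 0 \<le> R \<Longrightarrow> j \<le> k \<Longrightarrow>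
      (\<forall>i<j. error_recursion (u (\<tau> + real i * h)) (1 / C) \<theta> h R (y i) (y (Suc i))) \<Longrightarrow>
      norm (y j) \<le> C * (norm (y 0) + R) \<and> (j = k \<longrightarrow> norm (y j) \<le> 1 / 2 * norm (y 0) + C * R)"
    using cb unfolding contracting_block_def by blast
  show "contracting_block u \<theta> \<tau> C'"
    unfolding contracting_block_def
  proof (rule conjI, use C CC in simp, intro exI[of _ k] conjI[OF k], intro allI impI)
    fix h R :: real and y :: "nat \<Rightarrow> real^'m^'r" and j
    assume h: "0 < h" "h \<le> 1 / C'" and R: "0 \<le> R" and j: "j \<le> k"
      and rec: "\<forall>i<j. error_recursion (u (\<tau> + real i * h)) (1 / C') \<theta> h R (y i) (y (Suc i))"
    have "\<forall>i<j. error_recursion (u (\<tau> + real i * h)) (1 / C) \<theta> h R (y i) (y (Suc i))"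
      using inv by (auto intro: error_recursion_weaken[OF rec[rule_format]])
    from block[OF h(1) order_trans[OF h(2) inv] R j this]
    have "norm (y j) \<le> C * (norm (y 0) + R)" "j = k \<Longrightarrow> norm (y j) \<le> 1 / 2 * norm (y 0) + C * R" by blast+
    moreover have "C * (norm (y 0) + R) \<le> C' * (norm (y 0) + R)" "C * R \<le> C' * R"
      using CC R by (auto intro!: mult_right_mono)
    ultimately show "norm (y j) \<le> C' * (norm (y 0) + R) \<and> (j = k \<longrightarrow> norm (y j) \<le> 1 / 2 * norm (y 0) + C' * R)"
      by fastforce
  qed
qed

section \<open>Accumulation of errors\<close>

text \<open>One step of both errors; \<open>d\<close> bounds the residuals, and the update of the nonstiff component has a
  residual that is smaller by the factor \<open>h\<close>.\<close>

definition perturbed_step where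
  "perturbed_step w \<rho> \<theta> h d \<Delta>\<xi> \<Delta>\<zeta> \<Delta>\<xi>' \<Delta>\<zeta>' \<longleftrightarrow> (\<exists>X' Z' X Z \<gamma> dX dZ d\<xi> d\<zeta>.
      near w \<rho> X Z \<and> near w \<rho> X' Z' \<and> stage_errors \<theta> h X' Z' X Z \<gamma> \<Delta>\<xi> \<Delta>\<zeta> dX dZ \<and>
      \<Delta>\<xi>' = V\<^sub>E ** \<Delta>\<xi> + h *\<^sub>R (B\<^sub>E ** (stagewise f X Z - stagewise f X' Z')) + d\<xi> \<and>
      \<Delta>\<zeta>' = V\<^sub>I ** \<Delta>\<zeta> + B\<^sub>I ** \<gamma> + d\<zeta> \<and>
      norm dX \<le> d \<and> norm dZ \<le> d \<and> norm d\<zeta> \<le> d \<and> norm d\<xi> \<le> h * d)"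

text \<open>By the contracting blocks the stiff error is bounded by the preceding nonstiff errors and the
  residuals; it does not accumulate. Inserting this into the recursion for \<open>\<Delta>\<xi>\<close> leaves a power bounded matrix
  perturbed by \<open>h\<close> times earlier errors, to which the discrete Gronwall inequality applies.\<close>

lemma global_error_bound:
  fixes u :: "real \<Rightarrow> (real^'m) \<times> (real^'m)"
  assumes V: "power_bounded V\<^sub>E" and C1: "0 < C1" and C2: "0 < C2" and Cr: "0 \<le> Cr" and T: "0 \<le> T"
  shows "\<exists>C\<ge>0. \<forall>\<theta> h N (\<Delta>\<xi> :: nat \<Rightarrow> real^'m^'r) (\<Delta>\<zeta> :: nat \<Rightarrow> real^'m^'r).
    0 < h \<longrightarrow> h \<le> 1 / C1 \<longrightarrow> h \<le> 1 / C2 \<longrightarrow> real N * h \<le> T \<longrightarrow>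
    norm (\<Delta>\<xi> 0) \<le> C\<^sub>0 * h ^ p \<longrightarrow> norm (\<Delta>\<zeta> 0) \<le> C\<^sub>0 * h ^ p \<longrightarrow>
    (\<forall>n\<le>N. stage_bound (u (t\<^sub>0 + real n * h)) \<theta> C1) \<longrightarrow>
    (\<forall>n\<le>N. contracting_block u \<theta> (t\<^sub>0 + real n * h) C2) \<longrightarrow>
    (\<forall>n<N. perturbed_step (u (t\<^sub>0 + real n * h)) (min (1 / C1) (1 / C2)) \<theta> h (Cr * h ^ p)
      (\<Delta>\<xi> n) (\<Delta>\<zeta> n) (\<Delta>\<xi> (Suc n)) (\<Delta>\<zeta> (Suc n))) \<longrightarrow>
    (\<forall>n\<le>N. norm (\<Delta>\<xi> n) \<le> C * h ^ p \<and> norm (\<Delta>\<zeta> n) \<le> C * h ^ p)"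
proof -
  obtain P where P: "1 \<le> P" "\<And>k (Y :: real^'m^'r). norm ((((**) V\<^sub>E) ^^ k) Y) \<le> P * norm Y"
    using power_bounded_uniform[OF V] by blast
  obtain bE where bE: "0 < bE" "\<And>Y::real^'m^'s. norm (B\<^sub>E ** Y) \<le> bE * norm Y" using matrix_mult_bound by blast
  define a where "a = max 1 (P * \<bar>C\<^sub>0\<bar>)"
  define Cy where "Cy = C2 * (\<bar>C\<^sub>0\<bar> + 2 * C2 * (1 + Cr) + (1 + Cr))"
  define Cq where "Cq = bE * C1 * (1 + Cy + 2 * Cr) + Cr"
  define b where "b = P * Cq"
  have a: "1 \<le> a" "P * \<bar>C\<^sub>0\<bar> \<le> a" by (auto simp: a_def)
  have Cy: "0 \<le> Cy" using C2 Cr by (simp add: Cy_def)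
  have Cq: "0 \<le> Cq" using bE(1) C1 Cy Cr by (simp add: Cq_def)
  have b: "0 \<le> b" using P(1) Cq by (simp add: b_def)
  define C where "C = (1 + Cy) * (a * exp (b * T))"
  have C: "0 \<le> C" using Cy a(1) by (simp add: C_def)
  show ?thesis
  proof (rule exI[of _ C], intro conjI[OF C] allI impI)
    fix \<theta> h N n and \<Delta>\<xi> \<Delta>\<zeta> :: "nat \<Rightarrow> real^'m^'r"
    assume h: "0 < h" "h \<le> 1 / C1" "h \<le> 1 / C2" and N: "real N * h \<le> T"
      and init: "norm (\<Delta>\<xi> 0) \<le> C\<^sub>0 * h ^ p" "norm (\<Delta>\<zeta> 0) \<le> C\<^sub>0 * h ^ p"
      and sb: "\<forall>n\<le>N. stage_bound (u (t\<^sub>0 + real n * h)) \<theta> C1"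
      and cb: "\<forall>n\<le>N. contracting_block u \<theta> (t\<^sub>0 + real n * h) C2"
      and steps: "\<forall>n<N. perturbed_step (u (t\<^sub>0 + real n * h)) (min (1 / C1) (1 / C2)) \<theta> h (Cr * h ^ p)
        (\<Delta>\<xi> n) (\<Delta>\<zeta> n) (\<Delta>\<xi> (Suc n)) (\<Delta>\<zeta> (Suc n))"
      and n: "n \<le> N"
    let ?r = "h ^ p"
    have r: "0 < ?r" using h by simp
    define q where "q n = \<Delta>\<xi> (Suc n) - V\<^sub>E ** \<Delta>\<xi> n" for n
    have q: "norm (q n) \<le> h * (bE * C1 * (norm (\<Delta>\<xi> n) + norm (\<Delta>\<zeta> n) + 2 * Cr * ?r) + Cr * ?r)" if n: "n < N" for n
    proof -
      obtain X' Z' X Z \<gamma> dX dZ d\<xi> where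
        near: "near (u (t\<^sub>0 + real n * h)) (min (1 / C1) (1 / C2)) X Z" "near (u (t\<^sub>0 + real n * h)) (min (1 / C1) (1 / C2)) X' Z'"
        and se: "stage_errors \<theta> h X' Z' X Z \<gamma> (\<Delta>\<xi> n) (\<Delta>\<zeta> n) dX dZ"
        and \<Delta>\<xi>: "\<Delta>\<xi> (Suc n) = V\<^sub>E ** \<Delta>\<xi> n + h *\<^sub>R (B\<^sub>E ** (stagewise f X Z - stagewise f X' Z')) + d\<xi>"
        and d: "norm dX \<le> Cr * ?r" "norm dZ \<le> Cr * ?r" "norm d\<xi> \<le> h * (Cr * ?r)"
        using steps[rule_format, OF n] unfolding perturbed_step_def by (elim exE conjE)
      have near1: "near (u (t\<^sub>0 + real n * h)) (1 / C1) X Z" "near (u (t\<^sub>0 + real n * h)) (1 / C1) X' Z'"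
        by (rule near_weaken[OF near(1)] near_weaken[OF near(2)], simp)+
      have sbn: "stage_bound (u (t\<^sub>0 + real n * h)) \<theta> C1" using sb n by simp
      have "norm (stagewise f X Z - stagewise f X' Z') \<le> C1 * (norm (\<Delta>\<xi> n) + norm (\<Delta>\<zeta> n) + norm dX + norm dZ)"
        using sbn[unfolded stage_bound_def, THEN conjunct2, rule_format, OF h(1,2) near1 se] .
      also have "\<dots> \<le> C1 * (norm (\<Delta>\<xi> n) + norm (\<Delta>\<zeta> n) + 2 * Cr * ?r)"
        using d C1 by (intro mult_left_mono) auto
      finally have F: "norm (stagewise f X Z - stagewise f X' Z') \<le> C1 * (norm (\<Delta>\<xi> n) + norm (\<Delta>\<zeta> n) + 2 * Cr * ?r)" .
      have "q n = h *\<^sub>R (B\<^sub>E ** (stagewise f X Z - stagewise f X' Z')) + d\<xi>" by (simp add: q_def \<Delta>\<xi>)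
      also have "norm \<dots> \<le> h * (bE * (C1 * (norm (\<Delta>\<xi> n) + norm (\<Delta>\<zeta> n) + 2 * Cr * ?r))) + h * (Cr * ?r)"
      proof (intro norm_triangle_le add_mono d)
        have "norm (B\<^sub>E ** (stagewise f X Z - stagewise f X' Z')) \<le> bE * (C1 * (norm (\<Delta>\<xi> n) + norm (\<Delta>\<zeta> n) + 2 * Cr * ?r))"
          using bE(1) by (intro order_trans[OF bE(2)] mult_left_mono F) auto
        then show "norm (h *\<^sub>R (B\<^sub>E ** (stagewise f X Z - stagewise f X' Z')))
            \<le> h * (bE * (C1 * (norm (\<Delta>\<xi> n) + norm (\<Delta>\<zeta> n) + 2 * Cr * ?r)))"
          unfolding norm_scaleR using h(1) by simp
      qed
      finally show ?thesis by (simp add: algebra_simps)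
    qed
    have y: "norm (\<Delta>\<zeta> n) \<le> Cy * G"
      if n: "n \<le> N" and G: "?r \<le> G" "\<And>i. i < n \<Longrightarrow> norm (\<Delta>\<xi> i) \<le> G" for n G
    proof -
      define R where "R = (1 + Cr) * G"
      have G0: "0 \<le> G" using G(1) r by simp
      have R: "0 \<le> R" "G \<le> R" "Cr * ?r \<le> R"
      proof -
        show "0 \<le> R" "G \<le> R" using Cr G0 by (simp_all add: R_def distrib_right)
        have "Cr * ?r \<le> Cr * G" using G(1) Cr by (intro mult_left_mono)
        then show "Cr * ?r \<le> R" using G0 by (simp add: R_def distrib_right)
      qed
      have rec: "error_recursion (u (t\<^sub>0 + real i * h)) (1 / C2) \<theta> h R (\<Delta>\<zeta> i) (\<Delta>\<zeta> (Suc i))"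
        if i: "i < n" for i
      proof -
        have iN: "i < N" using i n by simp
        obtain X' Z' X Z \<gamma> dX dZ d\<zeta> where
          near: "near (u (t\<^sub>0 + real i * h)) (min (1 / C1) (1 / C2)) X Z" "near (u (t\<^sub>0 + real i * h)) (min (1 / C1) (1 / C2)) X' Z'"
          and se: "stage_errors \<theta> h X' Z' X Z \<gamma> (\<Delta>\<xi> i) (\<Delta>\<zeta> i) dX dZ"
          and \<Delta>\<zeta>: "\<Delta>\<zeta> (Suc i) = V\<^sub>I ** \<Delta>\<zeta> i + B\<^sub>I ** \<gamma> + d\<zeta>"
          and d: "norm dX \<le> Cr * ?r" "norm dZ \<le> Cr * ?r" "norm d\<zeta> \<le> Cr * ?r"
          using steps[rule_format, OF iN] unfolding perturbed_step_def by (elim exE conjE)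
        have near2: "near (u (t\<^sub>0 + real i * h)) (1 / C2) X Z" "near (u (t\<^sub>0 + real i * h)) (1 / C2) X' Z'"
          by (rule near_weaken[OF near(1)] near_weaken[OF near(2)], simp)+
        have dR: "norm (\<Delta>\<xi> i) \<le> R" "norm dX \<le> R" "norm dZ \<le> R" "norm d\<zeta> \<le> R"
          using d R G(2)[OF i] by linarith+
        show ?thesis
          unfolding error_recursion_def by (intro exI conjI) (rule near2 se \<Delta>\<zeta> dR)+
      qed
      have "norm (\<Delta>\<zeta> n) \<le> C2 * ((\<bar>C\<^sub>0\<bar> * G + 2 * (C2 * R)) + R)"
      proof (rule bounded_by_contracting_blocks[where y = "\<lambda>i. norm (\<Delta>\<zeta> i)" and N = n])
        fix m assume m: "m \<le> n"
        have "contracting_block u \<theta> (t\<^sub>0 + real m * h) C2" using cb m n by simp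
        then obtain k where k: "1 \<le> k" and block: "\<And>\<sigma> R y j. 0 < \<sigma> \<Longrightarrow> \<sigma> \<le> 1 / C2 \<Longrightarrow> 0 \<le> R \<Longrightarrow> j \<le> k \<Longrightarrow>
          (\<forall>i<j. error_recursion (u (t\<^sub>0 + real m * h + real i * \<sigma>)) (1 / C2) \<theta> \<sigma> R (y i) (y (Suc i))) \<Longrightarrow>
          norm (y j) \<le> C2 * (norm (y 0) + R) \<and> (j = k \<longrightarrow> norm (y j) \<le> 1 / 2 * norm (y 0) + C2 * R)"
          unfolding contracting_block_def by blast
        have "norm (\<Delta>\<zeta> (m + j)) \<le> C2 * (norm (\<Delta>\<zeta> m) + R) \<and> (j = k \<longrightarrow> norm (\<Delta>\<zeta> (m + j)) \<le> 1 / 2 * norm (\<Delta>\<zeta> m) + C2 * R)"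
          if j: "j \<le> k" "m + j \<le> n" for j
        proof -
          have eq: "t\<^sub>0 + real m * h + real i * h = t\<^sub>0 + real (m + i) * h" for i
            by (simp add: distrib_right)
          have "\<forall>i<j. error_recursion (u (t\<^sub>0 + real m * h + real i * h)) (1 / C2) \<theta> h R
              (\<Delta>\<zeta> (m + i)) (\<Delta>\<zeta> (m + Suc i))"
          proof (intro allI impI)
            fix i assume "i < j"
            then have "m + i < n" using j by simp
            from rec[OF this] show "error_recursion (u (t\<^sub>0 + real m * h + real i * h)) (1 / C2) \<theta> h R
                (\<Delta>\<zeta> (m + i)) (\<Delta>\<zeta> (m + Suc i))"
              by (simp only: eq add_Suc_right)
          qed
          from block[OF h(1,3) R(1) j(1) this] show ?thesis by simp
        qed
        then show "\<exists>k\<ge>1. \<forall>j\<le>k. m + j \<le> n \<longrightarrow> norm (\<Delta>\<zeta> (m + j)) \<le> C2 * (norm (\<Delta>\<zeta> m) + R) \<and>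
            (j = k \<longrightarrow> norm (\<Delta>\<zeta> (m + j)) \<le> 1 / 2 * norm (\<Delta>\<zeta> m) + C2 * R)"
          using k by blast
      next
        have C0G: "C\<^sub>0 * ?r \<le> \<bar>C\<^sub>0\<bar> * G" using G(1) r by (intro mult_mono) auto
        show "2 * (C2 * R) \<le> \<bar>C\<^sub>0\<bar> * G + 2 * (C2 * R)" using G0 by simp
        have "0 \<le> C2 * R" using C2 R by simp
        then show "norm (\<Delta>\<zeta> 0) \<le> \<bar>C\<^sub>0\<bar> * G + 2 * (C2 * R)" using init(2) C0G by linarith
      qed (use C2 R in auto)
      also have "\<dots> = Cy * G" by (simp add: Cy_def R_def algebra_simps)
      finally show ?thesis .
    qed
    define G where "G n = a * ?r * (1 + b * h) ^ n" for n
    have Gr: "?r \<le> G n" for n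
    proof -
      have "1 * ?r * 1 \<le> a * ?r * (1 + b * h) ^ n"
        using a r b h by (intro mult_mono one_le_power) auto
      then show ?thesis by (simp add: G_def)
    qed
    have Gmono: "G i \<le> G j" if "i \<le> j" for i j
      unfolding G_def using a r b h that by (intro mult_left_mono power_increasing) auto
    have x: "norm (\<Delta>\<xi> n) \<le> a * ?r * (1 + b * h) ^ n" if n: "n \<le> N" for n
    proof (rule discrete_gronwall[OF _ n])
      fix n assume n: "n \<le> N" and IH: "\<And>i. i < n \<Longrightarrow> norm (\<Delta>\<xi> i) \<le> a * ?r * (1 + b * h) ^ i"
      have qj: "norm (q j) \<le> h * Cq * G j" if j: "j < n" for j
      proof -
        have xj: "norm (\<Delta>\<xi> j) \<le> G j" using IH[OF j] by (simp add: G_def)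
        have yj: "norm (\<Delta>\<zeta> j) \<le> Cy * G j"
        proof (rule y)
          fix i assume "i < j"
          then show "norm (\<Delta>\<xi> i) \<le> G j"
            using IH[of i] j Gmono[of i j] by (simp add: G_def)
        qed (use j n Gr in auto)
        have "norm (q j) \<le> h * (bE * C1 * (norm (\<Delta>\<xi> j) + norm (\<Delta>\<zeta> j) + 2 * Cr * ?r) + Cr * ?r)"
          by (rule q) (use j n in simp)
        also have "\<dots> \<le> h * (bE * C1 * (G j + Cy * G j + 2 * Cr * G j) + Cr * G j)"
          using h bE(1) C1 Cr xj yj Gr[of j] by (intro mult_left_mono add_mono) auto
        also have "\<dots> = h * Cq * G j" by (simp add: Cq_def algebra_simps)
        finally show ?thesis .
      qed
      have "norm (\<Delta>\<xi> n) \<le> P * (norm (\<Delta>\<xi> 0) + (\<Sum>j<n. norm (q j)))"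
        by (rule perturbed_power_bounded_recursion[OF P(2) _ order_refl]) (simp add: q_def)
      also have "\<dots> \<le> P * (\<bar>C\<^sub>0\<bar> * ?r + (\<Sum>j<n. h * Cq * G j))"
      proof (intro mult_left_mono add_mono sum_mono)
        show "norm (\<Delta>\<xi> 0) \<le> \<bar>C\<^sub>0\<bar> * ?r"
          by (rule order_trans[OF init(1)]) (use r in \<open>auto intro: mult_right_mono\<close>)
        show "norm (q j) \<le> h * Cq * G j" if "j \<in> {..<n}" for j using qj that by simp
      qed (use P in simp)
      also have "\<dots> = (P * \<bar>C\<^sub>0\<bar>) * ?r + b * h * (\<Sum>j<n. G j)"
        by (simp add: b_def distrib_left sum_distrib_left mult_ac)
      also have "\<dots> \<le> a * ?r + b * h * (\<Sum>j<n. G j)"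
        using a(2) r by (intro add_right_mono mult_right_mono) auto
      finally show "norm (\<Delta>\<xi> n) \<le> a * ?r + b * h * (\<Sum>j<n. a * ?r * (1 + b * h) ^ j)" by (simp add: G_def)
    qed
    have Gexp: "G n \<le> a * exp (b * T) * ?r"
    proof -
      have "(1 + b * h) ^ n \<le> exp (b * h) ^ n"
        using b h by (intro power_mono) (auto simp: exp_ge_add_one_self)
      also have "\<dots> = exp (real n * (b * h))" by (rule exp_of_nat_mult[symmetric])
      also have "\<dots> \<le> exp (b * T)"
      proof -
        have "real n * h \<le> real N * h" using n h(1) by (intro mult_right_mono) auto
        then have "b * (real n * h) \<le> b * T" using N b by (intro mult_left_mono) auto
        then show ?thesis by (simp add: mult_ac)
      qed
      finally have "a * ?r * (1 + b * h) ^ n \<le> a * ?r * exp (b * T)" using a r by (intro mult_left_mono) auto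
      then show ?thesis by (simp add: G_def mult_ac)
    qed
    have "norm (\<Delta>\<xi> n) \<le> G n" using x[OF n] by (simp add: G_def)
    moreover have "norm (\<Delta>\<zeta> n) \<le> Cy * G n"
    proof (rule y[OF n Gr])
      fix i assume "i < n"
      then show "norm (\<Delta>\<xi> i) \<le> G n" using x[of i] n Gmono[of i n] by (simp add: G_def)
    qed
    moreover have "G n \<le> (1 + Cy) * G n" "Cy * G n \<le> (1 + Cy) * G n"
      using Cy Gr[of n] r by (simp_all add: distrib_right)
    moreover have "(1 + Cy) * G n \<le> C * ?r"
      using mult_left_mono[OF Gexp, of "1 + Cy"] Cy by (simp add: C_def mult.assoc)
    ultimately show "norm (\<Delta>\<xi> n) \<le> C * ?r \<and> norm (\<Delta>\<zeta> n) \<le> C * ?r" by linarith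
  qed
qed

text \<open>\<open>E\<close>, \<open>I\<close> and \<open>E'\<close>, \<open>I'\<close> are reference values for the external stages before and after the step.\<close>

lemma imex_step_errors:
  assumes pos: "0 < \<epsilon>" "0 < h"
    and step: "imex_step f g \<epsilon> h A\<^sub>E U\<^sub>E B\<^sub>E V\<^sub>E A\<^sub>I U\<^sub>I B\<^sub>I V\<^sub>I \<xi> \<zeta> X Z \<xi>' \<zeta>'"
  shows "\<exists>\<gamma>. stage_errors (\<epsilon> / h) h X' Z' X Z \<gamma> (\<xi> - E) (\<zeta> - I)
       (h *\<^sub>R (A\<^sub>E ** stagewise f X' Z') + U\<^sub>E ** E - X') (h *\<^sub>R (A\<^sub>I ** ((1 / \<epsilon>) *\<^sub>R stagewise g X' Z')) + U\<^sub>I ** I - Z') \<and>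
     \<xi>' - E' = V\<^sub>E ** (\<xi> - E) + h *\<^sub>R (B\<^sub>E ** (stagewise f X Z - stagewise f X' Z'))
       + (h *\<^sub>R (B\<^sub>E ** stagewise f X' Z') + V\<^sub>E ** E - E') \<and>
     \<zeta>' - I' = V\<^sub>I ** (\<zeta> - I) + B\<^sub>I ** \<gamma> + (h *\<^sub>R (B\<^sub>I ** ((1 / \<epsilon>) *\<^sub>R stagewise g X' Z')) + V\<^sub>I ** I - I')"
proof -
  let ?\<gamma> = "(h / \<epsilon>) *\<^sub>R (stagewise g X Z - stagewise g X' Z')"
  have X: "X = h *\<^sub>R (A\<^sub>E ** stagewise f X Z) + U\<^sub>E ** \<xi>" and Z: "Z = h *\<^sub>R (A\<^sub>I ** ((1 / \<epsilon>) *\<^sub>R stagewise g X Z)) + U\<^sub>I ** \<zeta>"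
    and \<xi>': "\<xi>' = h *\<^sub>R (B\<^sub>E ** stagewise f X Z) + V\<^sub>E ** \<xi>"
    and \<zeta>': "\<zeta>' = h *\<^sub>R (B\<^sub>I ** ((1 / \<epsilon>) *\<^sub>R stagewise g X Z)) + V\<^sub>I ** \<zeta>"
    using step unfolding imex_step_def by blast+
  have g: "h *\<^sub>R (Q ** ((1 / \<epsilon>) *\<^sub>R stagewise g X Z)) = Q ** ?\<gamma> + h *\<^sub>R (Q ** ((1 / \<epsilon>) *\<^sub>R stagewise g X' Z'))"
    for Q :: "real^'s^'k"
    by (simp add: linear_scale[OF linear_matrix_mult] linear_diff[OF linear_matrix_mult] algebra_simps)
  have "X - X' = h *\<^sub>R (A\<^sub>E ** (stagewise f X Z - stagewise f X' Z')) + U\<^sub>E ** (\<xi> - E)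
      + (h *\<^sub>R (A\<^sub>E ** stagewise f X' Z') + U\<^sub>E ** E - X')"
    by (subst X) (simp add: linear_diff[OF linear_matrix_mult] algebra_simps)
  moreover have "Z - Z' = A\<^sub>I ** ?\<gamma> + U\<^sub>I ** (\<zeta> - I) + (h *\<^sub>R (A\<^sub>I ** ((1 / \<epsilon>) *\<^sub>R stagewise g X' Z')) + U\<^sub>I ** I - Z')"
    by (subst Z, subst g) (simp add: linear_diff[OF linear_matrix_mult] algebra_simps)
  moreover have "(\<epsilon> / h) *\<^sub>R ?\<gamma> = stagewise g X Z - stagewise g X' Z'" using pos by simp
  moreover have "\<xi>' - E' = V\<^sub>E ** (\<xi> - E) + h *\<^sub>R (B\<^sub>E ** (stagewise f X Z - stagewise f X' Z'))
       + (h *\<^sub>R (B\<^sub>E ** stagewise f X' Z') + V\<^sub>E ** E - E')"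
    unfolding \<xi>' by (simp add: linear_diff[OF linear_matrix_mult] algebra_simps)
  moreover have "\<zeta>' - I' = V\<^sub>I ** (\<zeta> - I) + B\<^sub>I ** ?\<gamma> + (h *\<^sub>R (B\<^sub>I ** ((1 / \<epsilon>) *\<^sub>R stagewise g X' Z')) + V\<^sub>I ** I - I')"
    unfolding \<zeta>' g by (simp add: linear_diff[OF linear_matrix_mult] algebra_simps)
  ultimately show ?thesis unfolding stage_errors_def by blast
qed

lemma imex_step_from_errors:
  assumes pos: "0 < \<epsilon>" "0 < h"
    and se: "stage_errors (\<epsilon> / h) h X' Z' X Z \<gamma> (\<xi> - E) (\<zeta> - I)
       (h *\<^sub>R (A\<^sub>E ** stagewise f X' Z') + U\<^sub>E ** E - X') (h *\<^sub>R (A\<^sub>I ** ((1 / \<epsilon>) *\<^sub>R stagewise g X' Z')) + U\<^sub>I ** I - Z')"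
  shows "\<exists>\<xi>' \<zeta>'. imex_step f g \<epsilon> h A\<^sub>E U\<^sub>E B\<^sub>E V\<^sub>E A\<^sub>I U\<^sub>I B\<^sub>I V\<^sub>I \<xi> \<zeta> X Z \<xi>' \<zeta>'"
proof -
  have X: "X - X' = h *\<^sub>R (A\<^sub>E ** (stagewise f X Z - stagewise f X' Z')) + U\<^sub>E ** (\<xi> - E)
      + (h *\<^sub>R (A\<^sub>E ** stagewise f X' Z') + U\<^sub>E ** E - X')"
    and Z: "Z - Z' = A\<^sub>I ** \<gamma> + U\<^sub>I ** (\<zeta> - I) + (h *\<^sub>R (A\<^sub>I ** ((1 / \<epsilon>) *\<^sub>R stagewise g X' Z')) + U\<^sub>I ** I - Z')"
    and g: "(\<epsilon> / h) *\<^sub>R \<gamma> = stagewise g X Z - stagewise g X' Z'"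
    using se unfolding stage_errors_def by blast+
  have "(h / \<epsilon>) *\<^sub>R ((\<epsilon> / h) *\<^sub>R \<gamma>) = (h / \<epsilon>) *\<^sub>R (stagewise g X Z - stagewise g X' Z')"
    by (simp only: g)
  then have \<gamma>: "\<gamma> = (h / \<epsilon>) *\<^sub>R (stagewise g X Z - stagewise g X' Z')" using pos by simp
  have "X - X' = h *\<^sub>R (A\<^sub>E ** stagewise f X Z) + U\<^sub>E ** \<xi> - X'"
    by (subst X) (simp add: linear_diff[OF linear_matrix_mult] algebra_simps)
  then have 1: "X = h *\<^sub>R (A\<^sub>E ** stagewise f X Z) + U\<^sub>E ** \<xi>" by simp
  have "Z - Z' = h *\<^sub>R (A\<^sub>I ** ((1 / \<epsilon>) *\<^sub>R stagewise g X Z)) + U\<^sub>I ** \<zeta> - Z'"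
    by (subst Z, subst \<gamma>) (simp add: linear_diff[OF linear_matrix_mult] linear_scale[OF linear_matrix_mult] algebra_simps)
  then have 2: "Z = h *\<^sub>R (A\<^sub>I ** ((1 / \<epsilon>) *\<^sub>R stagewise g X Z)) + U\<^sub>I ** \<zeta>" by simp
  show ?thesis unfolding imex_step_def using 1 2 by blast
qed

end

section \<open>Convergence\<close>

lemma positive_lower_bound:
  fixes S :: "real set"
  assumes "finite S" "\<forall>\<sigma>\<in>S. 0 < \<sigma>"
  shows "\<exists>h>0. \<forall>\<sigma>\<in>S. h \<le> \<sigma>"
  using assms
proof (induction S)
  case (insert s S)
  then obtain h where "0 < h" "\<forall>\<sigma>\<in>S. h \<le> \<sigma>" by auto
  then show ?case using insert.prems by (intro exI[of _ "min s h"]) auto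
qed (auto intro: exI[of _ 1])

lemma dist_Pair_le: "dist (a, b) (c, d) \<le> dist a c + dist b d"
  for a b c d :: "'a::real_normed_vector"
  using norm_Pair_le[of "a - c" "b - d"] by (simp add: dist_norm)

theorem corollary2:
  fixes f g :: "(real^'m) \<times> (real^'m) \<Rightarrow> real^'m"
    and \<Omega> :: "((real^'m) \<times> (real^'m)) set"
    and x z :: "real \<Rightarrow> real \<Rightarrow> real^'m"
    and xk zk :: "nat \<Rightarrow> real \<Rightarrow> real^'m"
    and \<epsilon>\<^sub>0 ta tb t\<^sub>0 T :: real
    and c :: "real^'s::{finite,linorder}"
    and A\<^sub>E A\<^sub>I :: "real^'s::{finite,linorder}^'s::{finite,linorder}" and U\<^sub>E U\<^sub>I :: "real^'r^'s::{finite,linorder}"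
    and B\<^sub>E B\<^sub>I :: "real^'s::{finite,linorder}^'r" and V\<^sub>E V\<^sub>I :: "real^'r^'r"
    and w\<^sub>E w\<^sub>I :: "nat \<Rightarrow> real^'r"
    and p q\<^sub>E q\<^sub>I :: nat
    and \<alpha> D C\<^sub>\<epsilon> :: real
  assumes \<Omega>: "open \<Omega>" "smooth_on \<Omega> f" "smooth_on \<Omega> g"
    and g_z: "\<And>w. w \<in> \<Omega> \<Longrightarrow> invertible (partial_z g w) \<and> log_norm (partial_z g w) \<le> -1"
    and times: "ta < t\<^sub>0" "0 < T" "t\<^sub>0 + T < tb"
    and \<epsilon>\<^sub>0: "0 < \<epsilon>\<^sub>0"
    and coeffs: "consistent_coefficients f g {ta<..<tb} xk zk"
    and expansions: "eps_expansion \<epsilon>\<^sub>0 {ta<..<tb} x xk" "eps_expansion \<epsilon>\<^sub>0 {ta<..<tb} z zk"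
    and solution: "\<And>\<epsilon>. \<epsilon> \<in> {0<..\<epsilon>\<^sub>0} \<Longrightarrow> spp_solution f g \<epsilon> {ta<..<tb} (x \<epsilon>) (z \<epsilon>)"
    and in_\<Omega>: "\<And>t. t \<in> {ta<..<tb} \<Longrightarrow> (xk 0 t, zk 0 t) \<in> \<Omega>"
      "\<And>\<epsilon> t. \<epsilon> \<in> {0<..\<epsilon>\<^sub>0} \<Longrightarrow> t \<in> {ta<..<tb} \<Longrightarrow> (x \<epsilon> t, z \<epsilon> t) \<in> \<Omega>"
    and p: "1 \<le> p"
    and explicit: "strictly_lower_triangular A\<^sub>E"
    and orderE: "glm_order p q\<^sub>E c A\<^sub>E U\<^sub>E B\<^sub>E V\<^sub>E w\<^sub>E"
    and orderI: "glm_order p q\<^sub>I c A\<^sub>I U\<^sub>I B\<^sub>I V\<^sub>I w\<^sub>I"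
    and eig_pos: "\<And>l. l \<in> eigenvalues (cmatrix A\<^sub>I) \<Longrightarrow> l \<in> \<real> \<and> 0 < Re l"
    and rho_inf: "spectral_radius (cmatrix (stab_matrix_inf A\<^sub>I U\<^sub>I B\<^sub>I V\<^sub>I)) < 1"
    and rho: "\<alpha> < 1"
      "\<And>\<mu>. Re \<mu> \<le> - D \<Longrightarrow> spectral_radius (stab_matrix A\<^sub>I U\<^sub>I B\<^sub>I V\<^sub>I \<mu>) \<le> \<alpha>"
    and zero_stable: "power_bounded V\<^sub>E"
    and C\<^sub>\<epsilon>: "0 < D" "C\<^sub>\<epsilon> \<le> 1 / D"
  shows "\<forall>C\<^sub>0. \<exists>h\<^sub>0>0. \<exists>\<delta>>0. \<exists>C. \<forall>\<epsilon> h N \<xi>\<^sub>0 \<zeta>\<^sub>0.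
      0 < \<epsilon> \<and> \<epsilon> \<le> \<epsilon>\<^sub>0 \<and> 0 < h \<and> h \<le> h\<^sub>0 \<and> \<epsilon> \<le> C\<^sub>\<epsilon> * h \<and> real N * h \<le> T \<and>
      norm (\<xi>\<^sub>0 - exact_ext p w\<^sub>E h (x \<epsilon>) t\<^sub>0) \<le> C\<^sub>0 * h ^ p \<and>
      norm (\<zeta>\<^sub>0 - exact_ext p w\<^sub>I h (z \<epsilon>) t\<^sub>0) \<le> C\<^sub>0 * h ^ p \<longrightarrow>
      (let numerical_solution = (\<lambda>X Z \<xi> \<zeta>. \<xi> 0 = \<xi>\<^sub>0 \<and> \<zeta> 0 = \<zeta>\<^sub>0 \<and>
             (\<forall>n<N. imex_step f g \<epsilon> h A\<^sub>E U\<^sub>E B\<^sub>E V\<^sub>E A\<^sub>I U\<^sub>I B\<^sub>I V\<^sub>I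
                (\<xi> n) (\<zeta> n) (X (Suc n)) (Z (Suc n)) (\<xi> (Suc n)) (\<zeta> (Suc n))) \<and>
             stages_near \<delta> t\<^sub>0 h c N (x \<epsilon>) X \<and> stages_near \<delta> t\<^sub>0 h c N (z \<epsilon>) Z)
       in (\<exists>X Z \<xi> \<zeta>. numerical_solution X Z \<xi> \<zeta>) \<and>
          (\<forall>X Z \<xi> \<zeta>. numerical_solution X Z \<xi> \<zeta> \<longrightarrow>
             (\<forall>n\<le>N. norm (\<xi> n - exact_ext p w\<^sub>E h (x \<epsilon>) (t\<^sub>0 + real n * h)) \<le> C * h ^ p \<and>
                    norm (\<zeta> n - exact_ext p w\<^sub>I h (z \<epsilon>) (t\<^sub>0 + real n * h)) \<le> C * h ^ p)))"
proof (rule allI, goal_cases)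
  case (1 C\<^sub>0)
  define a where "a = (ta + t\<^sub>0) / 2"
  define b where "b = (t\<^sub>0 + T + tb) / 2"
  have ab: "ta < a" "a < t\<^sub>0" "t\<^sub>0 + T < b" "b < tb" "a < b" using times by (auto simp: a_def b_def)
  let ?S = "{a<..<b}"
  have smooth: "\<And>k. smooth_on {ta<..<tb} (xk k)" "\<And>k. smooth_on {ta<..<tb} (zk k)"
    using coeffs by (auto simp: consistent_coefficients_def)
  \<comment> \<open>The reduced solution does not depend on \<open>\<epsilon>\<close>; freezing \<open>g\<^sub>z\<close> along it leaves a compact set of parameters.\<close>
  define u where "u t = (xk 0 t, zk 0 t)" for t
  have u\<Omega>: "u \<tau> \<in> \<Omega>" if "\<tau> \<in> {t\<^sub>0..t\<^sub>0 + T}" for \<tau>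
    unfolding u_def using that times by (intro in_\<Omega>(1)) auto
  have ucont: "isCont u \<tau>" if "\<tau> \<in> {t\<^sub>0..t\<^sub>0 + T}" for \<tau>
  proof -
    have "continuous_on {ta<..<tb} u"
      unfolding u_def by (intro continuous_on_Pair smooth_on_continuous smooth)
    then show ?thesis using that times by (simp add: continuous_on_eq_continuous_at)
  qed
  have A: "positive_spectrum A\<^sub>I" using eig_pos by (simp add: positive_spectrum_def)
  have J: "dissipative (partial_z g w)" if "w \<in> \<Omega>" for w
    using g_z[OF that] log_norm_dissipative by (auto simp: dissipative_def)
  interpret imex: imex_problem f g \<Omega> A\<^sub>E A\<^sub>I U\<^sub>E U\<^sub>I B\<^sub>E B\<^sub>I V\<^sub>E V\<^sub>I
    by unfold_locales (fact \<Omega> A J)+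
  have M: "\<exists>k\<ge>1. \<forall>\<zeta>. norm ((propagation \<theta> (partial_z g w) A\<^sub>I U\<^sub>I B\<^sub>I V\<^sub>I ^^ k) \<zeta>) \<le> 1 / 4 * norm \<zeta>"
    if "\<theta> \<in> {0..1 / D}" "w \<in> \<Omega>" for \<theta> w
  proof (rule propagation_contracts[OF A J[OF that(2)] _ _ rho_inf rho(1)])
    show "0 \<le> \<theta>" "\<theta> * D \<le> 1" using that(1) C\<^sub>\<epsilon>(1) by (auto simp: field_simps)
    show "spectral_radius (stab_matrix A\<^sub>I U\<^sub>I B\<^sub>I V\<^sub>I \<mu>) \<le> \<alpha>" if "Re \<mu> \<le> - D" for \<mu>
      by (rule rho(2)[OF that])
  qed
  obtain e where e: "0 < e" "e \<le> \<epsilon>\<^sub>0" and der: "\<And>k \<epsilon> t. \<epsilon> \<in> {0<..e} \<Longrightarrow> t \<in> ?S \<Longrightarrow>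
        (nderiv k (x \<epsilon>) has_vector_derivative nderiv (Suc k) (x \<epsilon>) t) (at t) \<and>
        (nderiv k (z \<epsilon>) has_vector_derivative nderiv (Suc k) (z \<epsilon>) t) (at t)"
    and "\<forall>k. \<exists>C. \<forall>\<epsilon>\<in>{0<..e}. \<forall>t\<in>?S. norm (nderiv k (x \<epsilon>) t) \<le> C \<and> norm (nderiv k (z \<epsilon>) t) \<le> C"
    using solution_derivatives_uniformly_bounded[OF \<Omega> ab(1,5,4) \<epsilon>\<^sub>0 smooth expansions solution in_\<Omega>(1)] by auto
  then obtain Kd where Kd: "\<And>k \<epsilon> t. \<epsilon> \<in> {0<..e} \<Longrightarrow> t \<in> ?S \<Longrightarrow>
      norm (nderiv k (x \<epsilon>) t) \<le> Kd k \<and> norm (nderiv k (z \<epsilon>) t) \<le> Kd k"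
    by metis
  define K where "K = (\<Sum>k\<le>Suc p. \<bar>Kd k\<bar>)"
  have K0: "0 \<le> K" by (simp add: K_def sum_nonneg)
  have K: "norm (nderiv k (x \<epsilon>) t) \<le> K \<and> norm (nderiv k (z \<epsilon>) t) \<le> K"
    if "k \<le> Suc p" "\<epsilon> \<in> {0<..e}" "t \<in> ?S" for k \<epsilon> t
  proof -
    have "\<bar>Kd k\<bar> \<le> K" unfolding K_def using that(1) by (intro member_le_sum) auto
    then show ?thesis using Kd[OF that(2,3), of k] by linarith
  qed
  obtain CE where CE: "0 \<le> CE" "\<forall>(y :: nat \<Rightarrow> real \<Rightarrow> real^'m) S t h.
     bounded_derivatives p K S y \<longrightarrow> t \<in> S \<longrightarrow> t + h \<in> S \<longrightarrow> (\<forall>i. t + c $ i * h \<in> S) \<longrightarrow> 0 < h \<longrightarrow> h \<le> 1 \<longrightarrow>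
     norm (stage_residual c A\<^sub>E U\<^sub>E w\<^sub>E p h y t) \<le> CE * h ^ p \<and>
     norm (output_residual c B\<^sub>E V\<^sub>E w\<^sub>E p h y t) \<le> h * (CE * h ^ p)"
    using glm_residuals[OF orderE p, where K = K] by (elim exE conjE)
  obtain CI where CI: "0 \<le> CI" "\<forall>(y :: nat \<Rightarrow> real \<Rightarrow> real^'m) S t h.
     bounded_derivatives p K S y \<longrightarrow> t \<in> S \<longrightarrow> t + h \<in> S \<longrightarrow> (\<forall>i. t + c $ i * h \<in> S) \<longrightarrow> 0 < h \<longrightarrow> h \<le> 1 \<longrightarrow>
     norm (stage_residual c A\<^sub>I U\<^sub>I w\<^sub>I p h y t) \<le> CI * h ^ p \<and>
     norm (output_residual c B\<^sub>I V\<^sub>I w\<^sub>I p h y t) \<le> h * (CI * h ^ p)"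
    using glm_residuals[OF orderI p, where K = K] by (elim exE conjE)
  define Cr where "Cr = CE + CI"
  have Cr: "0 \<le> Cr" "CE \<le> Cr" "CI \<le> Cr" using CE(1) CI(1) by (auto simp: Cr_def)
  have "\<exists>C. \<forall>\<theta>\<in>{0..1 / D}. \<forall>\<tau>\<in>{t\<^sub>0..t\<^sub>0 + T}. imex.stage_bound (u \<tau>) \<theta> C"
    by (rule imex.uniform_stage_bound[OF u\<Omega> ucont])
  then obtain C1 where C1: "\<forall>\<theta>\<in>{0..1 / D}. \<forall>\<tau>\<in>{t\<^sub>0..t\<^sub>0 + T}. imex.stage_bound (u \<tau>) \<theta> C1"
    by (elim exE)
  have "\<exists>C. \<forall>\<theta>\<in>{0..1 / D}. \<forall>\<tau>\<in>{t\<^sub>0..t\<^sub>0 + T}. imex.contracting_block u \<theta> \<tau> C"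
    by (rule imex.uniform_contracting_block[OF u\<Omega> ucont M])
  then obtain C2 where C2: "\<forall>\<theta>\<in>{0..1 / D}. \<forall>\<tau>\<in>{t\<^sub>0..t\<^sub>0 + T}. imex.contracting_block u \<theta> \<tau> C2"
    by (elim exE)
  have param: "0 \<in> {0..1 / D}" "t\<^sub>0 \<in> {t\<^sub>0..t\<^sub>0 + T}" using C\<^sub>\<epsilon>(1) times by auto
  have C12: "0 < C1" "0 < C2"
    using C1[rule_format, OF param] C2[rule_format, OF param] by (auto simp: imex.stage_bound_def imex.contracting_block_def)
  let ?\<rho> = "min (1 / C1) (1 / C2)"
  \<comment> \<open>The exact stages will lie within \<open>?\<rho> / 2\<close> of \<open>u t\<close>; with both components at distance \<open>\<delta>\<close> the
    numerical ones are still in the ball of radius \<open>?\<rho>\<close> where the estimates hold.\<close>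
  define \<delta> where "\<delta> = ?\<rho> / 4"
  have \<delta>: "0 < \<delta>" using C12 by (simp add: \<delta>_def)
  have "\<exists>C. \<forall>\<theta>\<in>{0..1 / D}. \<forall>\<tau>\<in>{t\<^sub>0..t\<^sub>0 + T}. imex.stages_solvable \<delta> (u \<tau>) \<theta> C"
    by (rule imex.uniform_stages_solvable[OF u\<Omega> ucont \<delta>])
  then obtain C3 where C3: "\<forall>\<theta>\<in>{0..1 / D}. \<forall>\<tau>\<in>{t\<^sub>0..t\<^sub>0 + T}. imex.stages_solvable \<delta> (u \<tau>) \<theta> C3"
    by (elim exE)
  have C30: "0 < C3" using C3[rule_format, OF param] by (auto simp: imex.stages_solvable_def)
  have T0: "0 \<le> T" using times by simp
  obtain C where C: "0 \<le> C" and bound: "\<And>\<theta> h N (\<Delta>\<xi> :: nat \<Rightarrow> real^'m^'r) (\<Delta>\<zeta> :: nat \<Rightarrow> real^'m^'r).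
    0 < h \<Longrightarrow> h \<le> 1 / C1 \<Longrightarrow> h \<le> 1 / C2 \<Longrightarrow> real N * h \<le> T \<Longrightarrow>
    norm (\<Delta>\<xi> 0) \<le> C\<^sub>0 * h ^ p \<Longrightarrow> norm (\<Delta>\<zeta> 0) \<le> C\<^sub>0 * h ^ p \<Longrightarrow>
    (\<forall>n\<le>N. imex.stage_bound (u (t\<^sub>0 + real n * h)) \<theta> C1) \<Longrightarrow>
    (\<forall>n\<le>N. imex.contracting_block u \<theta> (t\<^sub>0 + real n * h) C2) \<Longrightarrow>
    (\<forall>n<N. imex.perturbed_step (u (t\<^sub>0 + real n * h)) ?\<rho> \<theta> h (Cr * h ^ p)
      (\<Delta>\<xi> n) (\<Delta>\<zeta> n) (\<Delta>\<xi> (Suc n)) (\<Delta>\<zeta> (Suc n))) \<Longrightarrow>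
    (\<forall>n\<le>N. norm (\<Delta>\<xi> n) \<le> C * h ^ p \<and> norm (\<Delta>\<zeta> n) \<le> C * h ^ p)"
    using imex.global_error_bound[OF zero_stable C12 Cr(1) T0, where u = u and C\<^sub>0 = C\<^sub>0 and p = p and t\<^sub>0 = t\<^sub>0]
    by (elim exE conjE) presburger
  obtain Kx where Kx: "\<And>\<epsilon> t. \<epsilon> \<in> {0<..\<epsilon>\<^sub>0} \<Longrightarrow> t \<in> {ta<..<tb} \<Longrightarrow> norm (x \<epsilon> t - xk 0 t) \<le> Kx * \<epsilon>"
  proof -
    obtain k where "\<forall>\<epsilon>\<in>{0<..\<epsilon>\<^sub>0}. \<forall>t\<in>{ta<..<tb}. norm (x \<epsilon> t - (\<Sum>k\<le>0. \<epsilon> ^ k *\<^sub>R xk k t)) \<le> k * \<epsilon> ^ (0 + 1)"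
      using expansions(1)[unfolded eps_expansion_def, THEN spec, of 0] by (elim exE)
    then show ?thesis by (intro that[of k]) simp
  qed
  obtain Kz where Kz: "\<And>\<epsilon> t. \<epsilon> \<in> {0<..\<epsilon>\<^sub>0} \<Longrightarrow> t \<in> {ta<..<tb} \<Longrightarrow> norm (z \<epsilon> t - zk 0 t) \<le> Kz * \<epsilon>"
  proof -
    obtain k where "\<forall>\<epsilon>\<in>{0<..\<epsilon>\<^sub>0}. \<forall>t\<in>{ta<..<tb}. norm (z \<epsilon> t - (\<Sum>k\<le>0. \<epsilon> ^ k *\<^sub>R zk k t)) \<le> k * \<epsilon> ^ (0 + 1)"
      using expansions(2)[unfolded eps_expansion_def, THEN spec, of 0] by (elim exE)
    then show ?thesis by (intro that[of k]) simp
  qed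
  define cm where "cm = (\<Sum>i\<in>UNIV. \<bar>c $ i\<bar>) + 1"
  have cm: "1 \<le> cm" "\<bar>c $ i\<bar> \<le> cm" for i
  proof -
    show "1 \<le> cm" by (simp add: cm_def sum_nonneg)
    have "\<bar>c $ i\<bar> \<le> (\<Sum>i\<in>UNIV. \<bar>c $ i\<bar>)" by (intro member_le_sum) auto
    then show "\<bar>c $ i\<bar> \<le> cm" by (simp add: cm_def)
  qed
  define gap where "gap = min (t\<^sub>0 - a) (b - (t\<^sub>0 + T))"
  have gap: "0 < gap" using ab by (simp add: gap_def)
  define \<rho>0 where "\<rho>0 = min (?\<rho> / 2) (1 / C3)"
  have \<rho>0: "0 < \<rho>0" "\<rho>0 \<le> ?\<rho> / 2" "\<rho>0 \<le> 1 / C3"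
  proof -
    show "0 < \<rho>0" using C12 C30 by (simp add: \<rho>0_def)
    show "\<rho>0 \<le> ?\<rho> / 2" unfolding \<rho>0_def by (rule min.cobounded1)
    show "\<rho>0 \<le> 1 / C3" unfolding \<rho>0_def by (rule min.cobounded2)
  qed
  have "r0 + (d + d) \<le> r" "r0 \<le> r" if "0 < r0" "r0 \<le> r / 2" "d = r / 4" for r0 d r :: real
    using that by simp_all
  from this[OF \<rho>0(1,2) \<delta>_def] have \<rho>\<delta>: "\<rho>0 + (\<delta> + \<delta>) \<le> ?\<rho>" and \<rho>0_le: "\<rho>0 \<le> ?\<rho>" .
  \<comment> \<open>\<open>L h\<close> bounds the distance of the exact stages from the reduced solution: movement in time, and the
    distance \<open>O(\<epsilon>)\<close> to the reduced solution with \<open>\<epsilon> \<le> C\<^sub>\<epsilon> h\<close>.\<close>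
  define L where "L = 2 * (K * cm) + (\<bar>Kx\<bar> + \<bar>Kz\<bar>) * \<bar>C\<^sub>\<epsilon>\<bar> + 1"
  have L: "0 < L" using K0 cm(1) by (auto simp: L_def intro!: add_nonneg_pos)
  have CC: "0 < C3 * (C + Cr + 1)" using C30 C Cr(1) by simp
  have "0 < (1::real)" "0 < 1 / C1" "0 < 1 / C2" "0 < 1 / C3" "0 < gap / (2 * cm)" "0 < e / (\<bar>C\<^sub>\<epsilon>\<bar> + 1)" "0 < \<rho>0 / (2 * L)" "0 < 1 / (C3 * (C + Cr + 1))"
    using C12 C30 gap cm(1) e(1) \<rho>0(1) L CC by simp_all
  then have "\<forall>\<sigma>\<in>{1, 1 / C1, 1 / C2, 1 / C3, gap / (2 * cm), e / (\<bar>C\<^sub>\<epsilon>\<bar> + 1), \<rho>0 / (2 * L), 1 / (C3 * (C + Cr + 1))}. 0 < \<sigma>"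
    by (simp only: ball_simps simp_thms)
  then obtain h\<^sub>0 where h0: "0 < h\<^sub>0" and "\<forall>\<sigma>\<in>{1, 1 / C1, 1 / C2, 1 / C3, gap / (2 * cm), e / (\<bar>C\<^sub>\<epsilon>\<bar> + 1), \<rho>0 / (2 * L), 1 / (C3 * (C + Cr + 1))}. h\<^sub>0 \<le> \<sigma>"
    using positive_lower_bound[of "{1, 1 / C1, 1 / C2, 1 / C3, gap / (2 * cm), e / (\<bar>C\<^sub>\<epsilon>\<bar> + 1), \<rho>0 / (2 * L), 1 / (C3 * (C + Cr + 1))}"] by (meson finite.emptyI finite_insert)
  then have h0_le: "h\<^sub>0 \<le> 1" "h\<^sub>0 \<le> 1 / C1" "h\<^sub>0 \<le> 1 / C2" "h\<^sub>0 \<le> 1 / C3" "h\<^sub>0 \<le> gap / (2 * cm)" "h\<^sub>0 \<le> e / (\<bar>C\<^sub>\<epsilon>\<bar> + 1)" "h\<^sub>0 \<le> \<rho>0 / (2 * L)" "h\<^sub>0 \<le> 1 / (C3 * (C + Cr + 1))"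
    by (simp_all only: ball_simps simp_thms)
  define numsol where "numsol \<epsilon> h M \<xi>\<^sub>0 \<zeta>\<^sub>0 X Z \<xi> \<zeta> \<longleftrightarrow> \<xi> 0 = \<xi>\<^sub>0 \<and> \<zeta> 0 = \<zeta>\<^sub>0 \<and>
             (\<forall>n<M. imex_step f g \<epsilon> h A\<^sub>E U\<^sub>E B\<^sub>E V\<^sub>E A\<^sub>I U\<^sub>I B\<^sub>I V\<^sub>I
                (\<xi> n) (\<zeta> n) (X (Suc n)) (Z (Suc n)) (\<xi> (Suc n)) (\<zeta> (Suc n))) \<and>
             stages_near \<delta> t\<^sub>0 h c M (x \<epsilon>) X \<and> stages_near \<delta> t\<^sub>0 h c M (z \<epsilon>) Z"
    for \<epsilon> h M \<xi>\<^sub>0 \<zeta>\<^sub>0 X Z \<xi> \<zeta>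
  have main: "(\<exists>X Z \<xi> \<zeta>. numsol \<epsilon> h N \<xi>\<^sub>0 \<zeta>\<^sub>0 X Z \<xi> \<zeta>) \<and>
       (\<forall>X Z \<xi> \<zeta>. numsol \<epsilon> h N \<xi>\<^sub>0 \<zeta>\<^sub>0 X Z \<xi> \<zeta> \<longrightarrow>
             (\<forall>n\<le>N. norm (\<xi> n - exact_ext p w\<^sub>E h (x \<epsilon>) (t\<^sub>0 + real n * h)) \<le> C * h ^ p \<and>
                    norm (\<zeta> n - exact_ext p w\<^sub>I h (z \<epsilon>) (t\<^sub>0 + real n * h)) \<le> C * h ^ p))"
    if asm: "0 < \<epsilon>" "\<epsilon> \<le> \<epsilon>\<^sub>0" "0 < h" "h \<le> h\<^sub>0" "\<epsilon> \<le> C\<^sub>\<epsilon> * h" "real N * h \<le> T"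
      "norm (\<xi>\<^sub>0 - exact_ext p w\<^sub>E h (x \<epsilon>) t\<^sub>0) \<le> C\<^sub>0 * h ^ p"
      "norm (\<zeta>\<^sub>0 - exact_ext p w\<^sub>I h (z \<epsilon>) t\<^sub>0) \<le> C\<^sub>0 * h ^ p"
    for \<epsilon> h N \<xi>\<^sub>0 \<zeta>\<^sub>0
  proof -
    have hs: "h \<le> 1" "h \<le> 1 / C1" "h \<le> 1 / C2" "h \<le> 1 / C3" "h \<le> gap / (2 * cm)" "h \<le> e / (\<bar>C\<^sub>\<epsilon>\<bar> + 1)"
      "h \<le> \<rho>0 / (2 * L)" "h \<le> 1 / (C3 * (C + Cr + 1))"
      by (rule order_trans[OF asm(4)], rule h0_le)+
    have hcm: "cm * h < gap"
    proof -
      have "cm * h \<le> gap / 2" using hs(5) cm(1) by (simp add: field_simps)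
      then show ?thesis using gap by simp
    qed
    have \<epsilon>h: "\<epsilon> \<le> \<bar>C\<^sub>\<epsilon>\<bar> * h" using asm(3,5) mult_right_mono[of C\<^sub>\<epsilon> "\<bar>C\<^sub>\<epsilon>\<bar>" h] by linarith
    have \<epsilon>e: "\<epsilon> \<in> {0<..e}"
    proof -
      have "\<bar>C\<^sub>\<epsilon>\<bar> * h \<le> (\<bar>C\<^sub>\<epsilon>\<bar> + 1) * h" using asm(3) by (simp add: distrib_right)
      also have "\<dots> \<le> e" using hs(6) by (simp add: pos_le_divide_eq mult.commute)
      finally show ?thesis using asm(1) \<epsilon>h by simp
    qed
    have \<epsilon>0: "\<epsilon> \<in> {0<..\<epsilon>\<^sub>0}" using asm by simp
    define \<theta> where "\<theta> = \<epsilon> / h"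
    have \<theta>: "\<theta> \<in> {0..1 / D}"
    proof -
      have "\<theta> \<le> C\<^sub>\<epsilon>" using asm(3,5) by (simp add: \<theta>_def pos_divide_le_eq)
      then show ?thesis using C\<^sub>\<epsilon>(2) asm(1,3) by (simp add: \<theta>_def)
    qed
    define t where "t n = t\<^sub>0 + real n * h" for n
    have tT: "t n \<in> {t\<^sub>0..t\<^sub>0 + T}" if "n \<le> N" for n
    proof -
      have "real n * h \<le> real N * h" using that asm(3) by (intro mult_right_mono) auto
      then have "real n * h \<le> T" using asm(6) by linarith
      then show ?thesis using asm(3) by (simp add: t_def)
    qed
    have inS: "t n + s \<in> ?S" if "n \<le> N" "\<bar>s\<bar> \<le> cm * h" for n s
    proof -
      have "\<bar>s\<bar> < gap" using that(2) hcm by simp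
      then show ?thesis using tT[OF that(1)] unfolding gap_def by auto
    qed
    have ch: "\<bar>c $ i * h\<bar> \<le> cm * h" for i
      using cm(2)[of i] asm(3) by (simp add: abs_mult mult_right_mono)
    have tS: "t n \<in> ?S" "t n + h \<in> ?S" "\<forall>i. t n + c $ i * h \<in> ?S" if "n \<le> N" for n
    proof -
      have "0 \<le> cm * h" "h \<le> cm * h" using cm(1) asm(3) by simp_all
      then show "t n \<in> ?S" "t n + h \<in> ?S" using inS[OF that, of 0] inS[OF that, of h] asm(3) by simp_all
      show "\<forall>i. t n + c $ i * h \<in> ?S" using inS[OF that ch] by blast
    qed
    define X' where "X' n = sampled c h (t n) (x \<epsilon>)" for n
    define Z' where "Z' n = sampled c h (t n) (z \<epsilon>)" for n
    define E where "E n = exact_ext p w\<^sub>E h (x \<epsilon>) (t n)" for n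
    define I where "I n = exact_ext p w\<^sub>I h (z \<epsilon>) (t n)" for n
    have Esum: "E n = (\<Sum>k\<le>p. outer (w\<^sub>E k) (h ^ k *\<^sub>R nderiv k (x \<epsilon>) (t n)))"
      and Isum: "I n = (\<Sum>k\<le>p. outer (w\<^sub>I k) (h ^ k *\<^sub>R nderiv k (z \<epsilon>) (t n)))" for n
      by (simp_all add: E_def I_def exact_ext_outer nordsieck_def)
    have tSuc: "t (Suc n) = t n + h" for n by (simp add: t_def algebra_simps)
    have sol: "nderiv 1 (x \<epsilon>) s = f (x \<epsilon> s, z \<epsilon> s)" "nderiv 1 (z \<epsilon>) s = (1 / \<epsilon>) *\<^sub>R g (x \<epsilon> s, z \<epsilon> s)"
      if "s \<in> ?S" for s
    proof -
      have "s \<in> {ta<..<tb}" using that ab by auto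
      then have "(x \<epsilon> has_vector_derivative f (x \<epsilon> s, z \<epsilon> s)) (at s)"
        "(z \<epsilon> has_vector_derivative (1 / \<epsilon>) *\<^sub>R g (x \<epsilon> s, z \<epsilon> s)) (at s)"
        using solution[OF \<epsilon>0] by (auto simp: spp_solution_def)
      then show "nderiv 1 (x \<epsilon>) s = f (x \<epsilon> s, z \<epsilon> s)" "nderiv 1 (z \<epsilon>) s = (1 / \<epsilon>) *\<^sub>R g (x \<epsilon> s, z \<epsilon> s)"
        unfolding One_nat_def nderiv_Suc nderiv_0 by (auto intro: vector_derivative_at)
    qed
    have F': "stagewise f (X' n) (Z' n) = sampled c h (t n) (nderiv 1 (x \<epsilon>))"
      and G': "(1 / \<epsilon>) *\<^sub>R stagewise g (X' n) (Z' n) = sampled c h (t n) (nderiv 1 (z \<epsilon>))" if "n \<le> N" for n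
      using sol tS(3)[OF that] by (auto simp: X'_def Z'_def stagewise_def sampled_def vec_eq_iff[where 'b = 's])
    have bdx: "bounded_derivatives p K ?S (\<lambda>k. nderiv k (x \<epsilon>))"
      and bdz: "bounded_derivatives p K ?S (\<lambda>k. nderiv k (z \<epsilon>))"
      using der[OF \<epsilon>e] K[OF _ \<epsilon>e] by (simp_all add: bounded_derivatives_def convex_real_interval)
    define dX where "dX n = h *\<^sub>R (A\<^sub>E ** stagewise f (X' n) (Z' n)) + U\<^sub>E ** E n - X' n" for n
    define dZ where "dZ n = h *\<^sub>R (A\<^sub>I ** ((1 / \<epsilon>) *\<^sub>R stagewise g (X' n) (Z' n))) + U\<^sub>I ** I n - Z' n" for n
    define d\<xi> where "d\<xi> n = h *\<^sub>R (B\<^sub>E ** stagewise f (X' n) (Z' n)) + V\<^sub>E ** E n - E (Suc n)" for n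
    define d\<zeta> where "d\<zeta> n = h *\<^sub>R (B\<^sub>I ** ((1 / \<epsilon>) *\<^sub>R stagewise g (X' n) (Z' n))) + V\<^sub>I ** I n - I (Suc n)" for n
    have hp: "0 < h ^ p" "h ^ Suc p \<le> h ^ p" "h ^ p \<le> h"
      using asm(3) hs(1) p power_decreasing[of 1 p h] power_decreasing[of p "Suc p" h] by auto
    have res: "norm (dX n) \<le> Cr * h ^ p" "norm (dZ n) \<le> Cr * h ^ p" "norm (d\<zeta> n) \<le> Cr * h ^ p" "norm (d\<xi> n) \<le> h * (Cr * h ^ p)"
      if n: "n \<le> N" for n
    proof -
      note ti = tS(1,2)[OF n] tS(3)[OF n, rule_format] asm(3) hs(1)
      have rX: "dX n = stage_residual c A\<^sub>E U\<^sub>E w\<^sub>E p h (\<lambda>k. nderiv k (x \<epsilon>)) (t n)"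
        and rZ: "dZ n = stage_residual c A\<^sub>I U\<^sub>I w\<^sub>I p h (\<lambda>k. nderiv k (z \<epsilon>)) (t n)"
        and r\<xi>: "d\<xi> n = output_residual c B\<^sub>E V\<^sub>E w\<^sub>E p h (\<lambda>k. nderiv k (x \<epsilon>)) (t n)"
        and r\<zeta>: "d\<zeta> n = output_residual c B\<^sub>I V\<^sub>I w\<^sub>I p h (\<lambda>k. nderiv k (z \<epsilon>)) (t n)"
        unfolding dX_def dZ_def d\<xi>_def d\<zeta>_def F'[OF n] G'[OF n] Esum Isum tSuc stage_residual_def output_residual_def
        by (simp_all add: X'_def Z'_def)
      have CrE: "CE * h ^ p \<le> Cr * h ^ p" and CrI: "CI * h ^ p \<le> Cr * h ^ p"
        using Cr(2,3) hp by (auto intro!: mult_right_mono)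
      have "norm (dX n) \<le> CE * h ^ p" and \<xi>1: "norm (d\<xi> n) \<le> h * (CE * h ^ p)"
        unfolding rX r\<xi> using CE(2)[rule_format, OF bdx ti] by blast+
      then show "norm (dX n) \<le> Cr * h ^ p" using CrE by linarith
      show "norm (d\<xi> n) \<le> h * (Cr * h ^ p)"
        using CrE asm(3) by (intro order_trans[OF \<xi>1] mult_left_mono) auto
      have "norm (dZ n) \<le> CI * h ^ p" and \<zeta>1: "norm (d\<zeta> n) \<le> h * (CI * h ^ p)"
        unfolding rZ r\<zeta> using CI(2)[rule_format, OF bdz ti] by blast+
      then show "norm (dZ n) \<le> Cr * h ^ p" using CrI by linarith
      have "h * (CI * h ^ p) \<le> 1 * (Cr * h ^ p)" using CrI hs(1) asm(3) CI(1) by (intro mult_mono) auto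
      then show "norm (d\<zeta> n) \<le> Cr * h ^ p" using \<zeta>1 by linarith
    qed
    have near': "near (u (t n)) \<rho>0 (X' n) (Z' n)" if n: "n \<le> N" for n
      unfolding near_def mem_ball
    proof
      fix i
      have tn: "t n \<in> ?S" "t n + c $ i * h \<in> ?S" using tS[OF n] by auto
      have lip: "norm (y (t n + c $ i * h) - y (t n)) \<le> K * (cm * h)"
        if "bounded_derivatives p K ?S (\<lambda>k. nderiv k y)" for y :: "real \<Rightarrow> real^'m"
      proof -
        have "norm (nderiv 0 y (t n + c $ i * h) - (\<Sum>j\<le>0. ((c $ i * h) ^ j / fact j) *\<^sub>R nderiv j y (t n)))
            \<le> K * \<bar>c $ i * h\<bar> ^ Suc 0"
          by (rule taylor_remainder_bound[of ?S]) (use that tn in \<open>auto simp: bounded_derivatives_def\<close>)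
        then have "norm (y (t n + c $ i * h) - y (t n)) \<le> K * \<bar>c $ i * h\<bar>" by simp
        also have "\<dots> \<le> K * (cm * h)" using K0 ch by (intro mult_left_mono) auto
        finally show ?thesis .
      qed
      have tt: "t n \<in> {ta<..<tb}" using tn(1) ab by auto
      have kx: "norm (x \<epsilon> (t n) - xk 0 (t n)) \<le> \<bar>Kx\<bar> * (\<bar>C\<^sub>\<epsilon>\<bar> * h)"
        by (rule order_trans[OF Kx[OF \<epsilon>0 tt]]) (use \<epsilon>h asm(1) in \<open>intro mult_mono, auto\<close>)
      have kz: "norm (z \<epsilon> (t n) - zk 0 (t n)) \<le> \<bar>Kz\<bar> * (\<bar>C\<^sub>\<epsilon>\<bar> * h)"
        by (rule order_trans[OF Kz[OF \<epsilon>0 tt]]) (use \<epsilon>h asm(1) in \<open>intro mult_mono, auto\<close>)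
      have dx: "norm (x \<epsilon> (t n + c $ i * h) - xk 0 (t n)) \<le> K * (cm * h) + \<bar>Kx\<bar> * (\<bar>C\<^sub>\<epsilon>\<bar> * h)"
        using norm_triangle_le[OF add_mono[OF lip[of "x \<epsilon>", OF bdx] kx]] by simp
      have dz: "norm (z \<epsilon> (t n + c $ i * h) - zk 0 (t n)) \<le> K * (cm * h) + \<bar>Kz\<bar> * (\<bar>C\<^sub>\<epsilon>\<bar> * h)"
        using norm_triangle_le[OF add_mono[OF lip[of "z \<epsilon>", OF bdz] kz]] by simp
      have "dist (u (t n)) (X' n $ i, Z' n $ i) \<le> dist (xk 0 (t n)) (X' n $ i) + dist (zk 0 (t n)) (Z' n $ i)"
        unfolding u_def by (rule dist_Pair_le)
      also have "\<dots> = norm (x \<epsilon> (t n + c $ i * h) - xk 0 (t n)) + norm (z \<epsilon> (t n + c $ i * h) - zk 0 (t n))"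
        by (simp add: X'_def Z'_def sampled_def dist_norm norm_minus_commute)
      also have "\<dots> \<le> L * h"
        using dx dz asm(3) by (simp add: L_def algebra_simps)
      also have "\<dots> \<le> \<rho>0 / 2" using hs(7) L by (simp add: field_simps)
      also have "\<dots> < \<rho>0" using \<rho>0(1) by simp
      finally show "dist (u (t n)) (X' n $ i, Z' n $ i) < \<rho>0" .
    qed
    have apriori: "\<forall>n\<le>M. norm (\<xi> n - E n) \<le> C * h ^ p \<and> norm (\<zeta> n - I n) \<le> C * h ^ p"
      if ns: "numsol \<epsilon> h M \<xi>\<^sub>0 \<zeta>\<^sub>0 X Z \<xi> \<zeta>" and M: "M \<le> N" for M X Z \<xi> \<zeta>
    proof (rule bound[OF asm(3) hs(2,3), where \<theta> = \<theta>])
      have "real M * h \<le> real N * h" using M asm(3) by (intro mult_right_mono) auto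
      then show "real M * h \<le> T" using asm(6) by linarith
      show "norm (\<xi> 0 - E 0) \<le> C\<^sub>0 * h ^ p" "norm (\<zeta> 0 - I 0) \<le> C\<^sub>0 * h ^ p"
        using ns asm(7,8) by (simp_all add: numsol_def E_def I_def t_def)
      show "\<forall>n\<le>M. imex.stage_bound (u (t\<^sub>0 + real n * h)) \<theta> C1"
        "\<forall>n\<le>M. imex.contracting_block u \<theta> (t\<^sub>0 + real n * h) C2"
        using C1 C2 \<theta> tT M unfolding t_def by auto
      show "\<forall>n<M. imex.perturbed_step (u (t\<^sub>0 + real n * h)) ?\<rho> \<theta> h (Cr * h ^ p)
          (\<xi> n - E n) (\<zeta> n - I n) (\<xi> (Suc n) - E (Suc n)) (\<zeta> (Suc n) - I (Suc n))"
      proof (intro allI impI)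
        fix n assume n: "n < M"
        then have nN: "n \<le> N" using M by simp
        have step: "imex_step f g \<epsilon> h A\<^sub>E U\<^sub>E B\<^sub>E V\<^sub>E A\<^sub>I U\<^sub>I B\<^sub>I V\<^sub>I
                (\<xi> n) (\<zeta> n) (X (Suc n)) (Z (Suc n)) (\<xi> (Suc n)) (\<zeta> (Suc n))"
          and nX: "dist (X (Suc n) $ i) (X' n $ i) \<le> \<delta>" and nZ: "dist (Z (Suc n) $ i) (Z' n $ i) \<le> \<delta>" for i
          using ns n by (auto simp: numsol_def stages_near_def X'_def Z'_def sampled_def t_def)
        obtain \<gamma> where \<gamma>: "imex.stage_errors \<theta> h (X' n) (Z' n) (X (Suc n)) (Z (Suc n)) \<gamma> (\<xi> n - E n) (\<zeta> n - I n) (dX n) (dZ n)"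
          "\<xi> (Suc n) - E (Suc n) = V\<^sub>E ** (\<xi> n - E n) + h *\<^sub>R (B\<^sub>E ** (stagewise f (X (Suc n)) (Z (Suc n)) - stagewise f (X' n) (Z' n))) + d\<xi> n"
          "\<zeta> (Suc n) - I (Suc n) = V\<^sub>I ** (\<zeta> n - I n) + B\<^sub>I ** \<gamma> + d\<zeta> n"
          using imex.imex_step_errors[OF asm(1,3) step, of "X' n" "Z' n" "E n" "I n" "E (Suc n)" "I (Suc n)"]
          unfolding \<theta>_def dX_def dZ_def d\<xi>_def d\<zeta>_def by (elim exE conjE)
        have n1: "near (u (t\<^sub>0 + real n * h)) ?\<rho> (X' n) (Z' n)"
          using near_weaken[OF near'[OF nN] \<rho>0_le] unfolding t_def .
        have n2: "near (u (t\<^sub>0 + real n * h)) ?\<rho> (X (Suc n)) (Z (Suc n))"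
          unfolding near_def mem_ball
        proof
          fix i
          have "dist (u (t n)) (X' n $ i, Z' n $ i) < \<rho>0" using near'[OF nN] by (simp add: near_def)
          moreover have "dist (X' n $ i, Z' n $ i) (X (Suc n) $ i, Z (Suc n) $ i) \<le> \<delta> + \<delta>"
            using nX[of i] nZ[of i] dist_Pair_le[of "X' n $ i" "Z' n $ i" "X (Suc n) $ i" "Z (Suc n) $ i"]
            by (simp add: dist_commute)
          ultimately have "dist (u (t n)) (X (Suc n) $ i, Z (Suc n) $ i) < \<rho>0 + (\<delta> + \<delta>)"
            using dist_triangle[of "u (t n)" "(X (Suc n) $ i, Z (Suc n) $ i)" "(X' n $ i, Z' n $ i)"] by linarith
          from less_le_trans[OF this \<rho>\<delta>]
          show "dist (u (t\<^sub>0 + real n * h)) (X (Suc n) $ i, Z (Suc n) $ i) < ?\<rho>" unfolding t_def .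
        qed
        show "imex.perturbed_step (u (t\<^sub>0 + real n * h)) ?\<rho> \<theta> h (Cr * h ^ p)
            (\<xi> n - E n) (\<zeta> n - I n) (\<xi> (Suc n) - E (Suc n)) (\<zeta> (Suc n) - I (Suc n))"
          unfolding imex.perturbed_step_def
          by (rule exI[of _ "X' n"], rule exI[of _ "Z' n"], rule exI[of _ "X (Suc n)"], rule exI[of _ "Z (Suc n)"],
              rule exI[of _ \<gamma>], rule exI[of _ "dX n"], rule exI[of _ "dZ n"], rule exI[of _ "d\<xi> n"], rule exI[of _ "d\<zeta> n"])
            (intro conjI n1 n2 \<gamma> res[OF nN])
      qed
    qed
    have small: "r * h ^ p \<le> 1 / C3" if "0 \<le> r" "r \<le> C + Cr + 1" for r
    proof -
      have "r * h ^ p \<le> (C + Cr + 1) * h" using that hp(1,3) by (intro mult_mono) auto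
      also have "\<dots> \<le> (C + Cr + 1) * (1 / (C3 * (C + Cr + 1)))"
        using hs(8) that by (intro mult_left_mono) auto
      also have "\<dots> = 1 / C3" using C Cr(1) by simp
      finally show ?thesis .
    qed
    \<comment> \<open>The constant in the error bound does not depend on the number \<open>M\<close> of steps taken so far, so the errors stay
    small enough for the next stages to be solvable.\<close>
    have exist: "\<exists>X Z \<xi> \<zeta>. numsol \<epsilon> h M \<xi>\<^sub>0 \<zeta>\<^sub>0 X Z \<xi> \<zeta>" if "M \<le> N" for M
      using that
    proof (induction M)
      case 0
      show ?case
        by (rule exI, rule exI, rule exI[of _ "\<lambda>_. \<xi>\<^sub>0"], rule exI[of _ "\<lambda>_. \<zeta>\<^sub>0"])
          (simp add: numsol_def stages_near_def)
    next
      case (Suc M)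
      then obtain X Z \<xi> \<zeta> where ns: "numsol \<epsilon> h M \<xi>\<^sub>0 \<zeta>\<^sub>0 X Z \<xi> \<zeta>" by auto
      have M: "M \<le> N" using Suc.prems by simp
      have err: "norm (\<xi> M - E M) \<le> C * h ^ p" "norm (\<zeta> M - I M) \<le> C * h ^ p"
        using apriori[OF ns M] by auto
      have sm: "C * h ^ p \<le> 1 / C3" "Cr * h ^ p \<le> 1 / C3" using small[of C] small[of Cr] C Cr(1) by simp_all
      have "imex.stages_solvable \<delta> (u (t M)) \<theta> C3" using C3 \<theta> tT[OF M] by blast
      from this[unfolded imex.stages_solvable_def, THEN conjunct2, rule_format, OF asm(3) hs(4) near_weaken[OF near'[OF M] \<rho>0(3)]
          order_trans[OF err(1) sm(1)] order_trans[OF err(2) sm(1)]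
          order_trans[OF res(1)[OF M] sm(2)] order_trans[OF res(2)[OF M] sm(2)]]
      obtain X1 Z1 \<gamma> where se: "imex.stage_errors \<theta> h (X' M) (Z' M) X1 Z1 \<gamma> (\<xi> M - E M) (\<zeta> M - I M) (dX M) (dZ M)"
        and close: "norm (X1 - X' M) \<le> \<delta>" "norm (Z1 - Z' M) \<le> \<delta>" by blast
      obtain \<xi>1 \<zeta>1 where step: "imex_step f g \<epsilon> h A\<^sub>E U\<^sub>E B\<^sub>E V\<^sub>E A\<^sub>I U\<^sub>I B\<^sub>I V\<^sub>I (\<xi> M) (\<zeta> M) X1 Z1 \<xi>1 \<zeta>1"
        using imex.imex_step_from_errors[OF asm(1,3) se[unfolded \<theta>_def dX_def dZ_def]] by blast
      have rows: "dist (X1 $ i) (X' M $ i) \<le> \<delta>" "dist (Z1 $ i) (Z' M $ i) \<le> \<delta>" for i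
        using Finite_Cartesian_Product.norm_nth_le[of "X1 - X' M" i] Finite_Cartesian_Product.norm_nth_le[of "Z1 - Z' M" i] close
        by (auto simp: dist_norm)
      have "numsol \<epsilon> h (Suc M) \<xi>\<^sub>0 \<zeta>\<^sub>0 (X(Suc M := X1)) (Z(Suc M := Z1)) (\<xi>(Suc M := \<xi>1)) (\<zeta>(Suc M := \<zeta>1))"
        using ns step rows unfolding numsol_def stages_near_def
        by (auto simp: less_Suc_eq X'_def Z'_def sampled_def t_def)
      then show ?case by blast
    qed
    show ?thesis
      using exist[OF order_refl] apriori[OF _ order_refl] unfolding E_def I_def t_def by blast
  qed
  show ?case
    unfolding Let_def
    by (rule exI[of _ h\<^sub>0], rule conjI[OF h0], rule exI[of _ \<delta>], rule conjI[OF \<delta>], rule exI[of _ C], intro allI impI)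
      (rule main[unfolded numsol_def]; blast)
qed

end
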